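(* Let $n,m\ge1$ be natural numbers and let $f\in L^2(\mathbb{R}_+^n)$ and $g\in L^2(\mathbb{R}_+^m)$ be symmetric functions. If $I_n^{\hat N}(f)$ and $I_m^{\hat N}(g)$ are free, then $I_n^S(f)$ and $I_m^S(g)$ are free. The converse implication does not hold in general: there exist natural numbers $n,m\ge1$ and symmetric functions $f\in L^2(\mathbb{R}_+^n)$, $g\in L^2(\mathbb{R}_+^m)$ such that $I_n^S(f)$ and $I_m^S(g)$ are free but $I_n^{\hat N}(f)$ and $I_m^{\hat N}(g)$ are not free.
   Context: $\mathbb{R}_+=[0,\infty)$ with Lebesgue measure; $L^2(\mathbb{R}_+^n)$ is the space of complex-valued square-integrable functions. A function $f\in L^2(\mathbb{R}_+^n)$ is called symmetric if it is real-valued and $f(t_1,\dots,t_n)=f(t_{\sigma(1)},\dots,t_{\sigma(n)})$ for a.e. $(t_1,\dots,t_n)$ and every permutation $\sigma$. Its adjoint is $f^*(t_1,\dots,t_n)=\overline{f(t_n,\dots,t_1)}$. $(\mathscr{A},\varphi)$ is a tracial $W^*$-probability space: $\mathscr{A}$ is a von Neumann algebra and $\varphi:\mathscr{A}\to\mathbb{C}$ is a unital, weakly continuous, positive, faithful, tracial linear functional. $L^2(\mathscr{A},\varphi)$ is the completion of $\mathscr{A}$ for $\|X\|_2=\sqrt{\varphi(XX^* )}$. Freeness: $X_1,\dots,X_d$ are free if $\varphi\big([P_1(X_{i_1})-\varphi(P_1(X_{i_1}))]\cdots[P_r(X_{i_r})-\varphi(P_r(X_{i_r}))]\big)=0$ whenever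 $r\ge1$, $P_1,\dots,P_r$ are polynomials and $i_1,\dots,i_r\in\{1,\dots,d\}$ have no two adjacent indices equal. Free Brownian motion $S=\{S_t\}_{t\ge0}$: self-adjoint elements of $\mathscr{A}$, adapted to an increasing filtration $(\mathscr{A}_t)_{t\ge 0}$ of von Neumann subalgebras, with $S_0=0$ and such that for $0\le u<t$ the increment $S_t-S_u$ is free from $\mathscr{A}_u$ and has the centered semicircular law of variance $t-u$, with density $(2\pi(t-u))^{-1}\sqrt{4(t-u)-x^2}$ on $[-2\sqrt{t-u},2\sqrt{t-u}]$. Free Poisson process $N=\{N_t\}_{t\ge0}$: positive elements of $\mathscr{A}$ adapted to such a filtration, with $N_0=0$ and $N_t-N_u$ free from $\mathscr{A}_u$ with the free Poisson law of rate $\lambda=t-u$, i.e. $(1-\lambda)\delta_0+\tilde\nu$ if $\lambda\le1$ (with the understanding that $\tilde\nu$ carries mass $\lambda$) and $\tilde\nu$ if $\lambda>1$, where $\tilde\nu(dx)=(2\pi x)^{-1}\sqrt{4\lambda-(x-1-\lambda)^2}\,dx$ on $[(1-\sqrt\lambda)^2,(1+\sqrt\lambda)^2]$. $\hat N_t=N_t-t\mathbf{1}$ is the compensated process. Multiple integrals: for $\mathfrak{M}\in\{S,\hat N\}$, $I_n^{\mathfrak{M}}$ is the linear map $L^2(\mathbb{R}_+^n)\to L^2(\mathscr{A},\varphi)$ determined by $I_n^{\mathfrak{M}}(\mathbf{1}_{[a_1,b_1]\times\cdots\times[a_n,b_n]})=(\mathfrak{M}_{b_1}-\mathfrak{M}_{a_1})\cdots(\mathfrak{M}_{b_n}-\mathfrak{M}_{a_n})$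 for pairwise disjoint intervals and extended by linearity and the isometry $\varphi(I_n^{\mathfrak{M}}(f)I_n^{\mathfrak{M}}(g)^* )=\langle f,g\rangle_{L^2(\mathbb{R}_+^n)}$; $I_0^{\mathfrak M}(c)=c\mathbf 1$. Integrals of different orders are orthogonal, and $I_n^{\mathfrak{M}}(f)^*=I_n^{\mathfrak{M}}(f^* )$. Contractions, for $f\in L^2(\mathbb{R}_+^n)$, $g\in L^2(\mathbb{R}_+^m)$: for $0\le p\le n\wedge m$, $(f\stackrel{p}{\frown}g)(t_1,\dots,t_{n+m-2p})=\int_{\mathbb{R}_+^p}f(t_1,\dots,t_{n-p},s_1,\dots,s_p)\,g(s_p,\dots,s_1,t_{n-p+1},\dots,t_{n+m-2p})\,ds_1\cdots ds_p$; and for $1\le p\le n\wedge m$, $(f\star_p^{p-1}g)(t_1,\dots,t_{n+m-2p+1})=\int_{\mathbb{R}_+^{p-1}}f(t_1,\dots,t_{n-p+1},s_{p-1},\dots,s_1)\,g(s_1,\dots,s_{p-1},t_{n-p+1},\dots,t_{n+m-2p+1})\,ds_1\cdots ds_{p-1}$. Standing convention: the multiple integrals span a unital $*$-algebra, with products (hence moments) computed by $I_n^S(f)I_m^S(g)=\sum_{p=0}^{n\wedge m}I_{n+m-2p}^S(f\stackrel{p}{\frown}g)$ in the Wigner case and $I_n^{\hat N}(f)I_m^{\hat N}(g)=\sum_{p=0}^{n\wedge m}I_{n+m-2p}^{\hat N}(f\stackrel{p}{\frown}g)+\sum_{p=1}^{n\wedge m}I_{n+m-2p+1}^{\hat N}(f\star_p^{p-1}g)$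 in the free Poisson case. *)

theory Defs
  imports "HOL-Probability.Probability" "HOL-Computational_Algebra.Polynomial"
begin

section \<open>Complex Hilbert spaces and von Neumann algebras\<close>

class complex_space = real_vector +
  fixes scaleC :: "complex \<Rightarrow> 'a \<Rightarrow> 'a"  (infixr \<open>*\<^sub>C\<close> 75)
  assumes scaleC_add_right: "c *\<^sub>C (x + y) = c *\<^sub>C x + c *\<^sub>C y"
    and scaleC_add_left: "(c + d) *\<^sub>C x = c *\<^sub>C x + d *\<^sub>C x"
    and scaleC_scaleC: "c *\<^sub>C d *\<^sub>C x = (c * d) *\<^sub>C x"
    and scaleC_of_real: "complex_of_real r *\<^sub>C x = r *\<^sub>R x"

text \<open>The norm is the one induced by \<open>cinner\<close>, because \<open>inner\<close> is its real part.
  The complex inner product is linear in its first argument.\<close>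

class complex_hilbert = complex_space + real_inner + complete_space +
  fixes cinner :: "'a \<Rightarrow> 'a \<Rightarrow> complex"
  assumes cinner_add_left: "cinner (x + y) z = cinner x z + cinner y z"
    and cinner_scaleC_left: "cinner (c *\<^sub>C x) y = c * cinner x y"
    and cinner_commute: "cinner x y = cnj (cinner y x)"
    and Re_cinner: "Re (cinner x y) = inner x y"

lemma norm_scaleC: "norm (c *\<^sub>C x) = cmod c * norm (x :: 'a::complex_hilbert)"
proof -
  have self: "cinner y y = complex_of_real ((norm y)\<^sup>2)" for y :: 'a
  proof (rule complex_eqI)
    show "Re (cinner y y) = Re (complex_of_real ((norm y)\<^sup>2))"
      by (simp add: Re_cinner power2_norm_eq_inner)
    have "Im (cinner y y) = - Im (cinner y y)"
      using arg_cong[OF cinner_commute[of y y], of Im] by simp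
    then show "Im (cinner y y) = Im (complex_of_real ((norm y)\<^sup>2))" by simp
  qed
  have "cinner (c *\<^sub>C x) (c *\<^sub>C x) = c * (cnj c * cinner x x)"
    by (metis cinner_commute cinner_scaleC_left complex_cnj_cnj complex_cnj_mult)
  also have "\<dots> = complex_of_real ((cmod c * norm x)\<^sup>2)"
    by (simp add: self power_mult_distrib mult.assoc[symmetric] complex_norm_square[symmetric])
  finally have "(norm (c *\<^sub>C x))\<^sup>2 = (cmod c * norm x)\<^sup>2"
    by (metis self of_real_eq_iff)
  then show ?thesis by (simp add: power2_eq_iff_nonneg)
qed

lemma bounded_linear_scaleC: "bounded_linear (\<lambda>x :: 'a::complex_hilbert. c *\<^sub>C x)"
proof (rule bounded_linear_intro)
  show "c *\<^sub>C (x + y) = c *\<^sub>C x + c *\<^sub>C y" for x y :: 'a by (rule scaleC_add_right)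
  show "c *\<^sub>C r *\<^sub>R x = r *\<^sub>R c *\<^sub>C x" for r and x :: 'a
    by (metis scaleC_of_real scaleC_scaleC mult.commute)
  show "norm (c *\<^sub>C x) \<le> norm x * cmod c" for x :: 'a by (simp add: norm_scaleC mult.commute)
qed

instantiation blinfun :: (real_normed_vector, complex_hilbert) complex_space
begin

lift_definition scaleC_blinfun :: "complex \<Rightarrow> ('a \<Rightarrow>\<^sub>L 'b) \<Rightarrow> ('a \<Rightarrow>\<^sub>L 'b)" is "\<lambda>c a x. c *\<^sub>C a x"
  by (rule bounded_linear_compose[OF bounded_linear_scaleC])

instance
  by standard (transfer; simp add: scaleC_add_right scaleC_add_left scaleC_scaleC scaleC_of_real)+

end

text \<open>Bounded real-linear operators are the type \<open>'h \<Rightarrow>\<^sub>L 'h\<close>; the bounded operators of a complex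
  Hilbert space are the ones among them that satisfy \<open>complex_linear\<close>.\<close>

definition complex_linear :: "('h::complex_hilbert \<Rightarrow>\<^sub>L 'h) \<Rightarrow> bool" where
  "complex_linear a \<longleftrightarrow> (\<forall>c x. blinfun_apply a (c *\<^sub>C x) = c *\<^sub>C blinfun_apply a x)"

definition is_adjoint :: "('h::complex_hilbert \<Rightarrow>\<^sub>L 'h) \<Rightarrow> ('h \<Rightarrow>\<^sub>L 'h) \<Rightarrow> bool" where
  "is_adjoint a b \<longleftrightarrow> (\<forall>x y. cinner (blinfun_apply a x) y = cinner x (blinfun_apply b y))"

definition adj :: "('h::complex_hilbert \<Rightarrow>\<^sub>L 'h) \<Rightarrow> ('h \<Rightarrow>\<^sub>L 'h)" where
  "adj a = (THE b. is_adjoint a b)"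

definition positive_operator :: "('h::complex_hilbert \<Rightarrow>\<^sub>L 'h) \<Rightarrow> bool" where
  "positive_operator a \<longleftrightarrow> complex_linear a \<and> (\<forall>x. cinner (blinfun_apply a x) x \<in> \<real>\<^sub>\<ge>\<^sub>0)"

definition commutant :: "('h::complex_hilbert \<Rightarrow>\<^sub>L 'h) set \<Rightarrow> ('h \<Rightarrow>\<^sub>L 'h) set" where
  "commutant X = {b. complex_linear b \<and> (\<forall>a\<in>X. a o\<^sub>L b = b o\<^sub>L a)}"

locale von_neumann_algebra =
  fixes A :: "('h::complex_hilbert \<Rightarrow>\<^sub>L 'h) set"
  assumes operators: "a \<in> A \<Longrightarrow> complex_linear a"
    and adjoint_closed: "a \<in> A \<Longrightarrow> \<exists>b\<in>A. is_adjoint a b"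
    and bicommutant: "commutant (commutant A) = A"

text \<open>The ultraweak topology is the coarsest one that makes all functionals
  \<open>a \<mapsto> \<Sum>k. \<langle>a x\<^sub>k, y\<^sub>k\<rangle>\<close> with square-summable \<open>x\<close>, \<open>y\<close> continuous. It is finer than the weak
  operator topology, so a functional continuous for the latter is continuous for the former.\<close>

definition ultraweak_topology :: "('h::complex_hilbert \<Rightarrow>\<^sub>L 'h) topology" where
  "ultraweak_topology = pullback_topology UNIV
     (\<lambda>a (x :: nat \<Rightarrow> 'h, y :: nat \<Rightarrow> 'h).
        if summable (\<lambda>k. (norm (x k))\<^sup>2) \<and> summable (\<lambda>k. (norm (y k))\<^sup>2)
        then \<Sum>k. cinner (blinfun_apply a (x k)) (y k) else 0) euclidean"

locale tracial_W_probability_space = von_neumann_algebra A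
  for A :: "('h::complex_hilbert \<Rightarrow>\<^sub>L 'h) set" +
  fixes \<phi> :: "('h \<Rightarrow>\<^sub>L 'h) \<Rightarrow> complex"
  assumes phi_add: "\<lbrakk>a \<in> A; b \<in> A\<rbrakk> \<Longrightarrow> \<phi> (a + b) = \<phi> a + \<phi> b"
    and phi_scale: "a \<in> A \<Longrightarrow> \<phi> (c *\<^sub>C a) = c * \<phi> a"
    and phi_unital: "\<phi> id_blinfun = 1"
    and phi_continuous: "continuous_map (subtopology ultraweak_topology A) euclidean \<phi>"
    and phi_positive: "\<lbrakk>a \<in> A; positive_operator a\<rbrakk> \<Longrightarrow> \<phi> a \<in> \<real>\<^sub>\<ge>\<^sub>0"
    and phi_faithful: "\<lbrakk>a \<in> A; \<phi> (adj a o\<^sub>L a) = 0\<rbrakk> \<Longrightarrow> a = 0"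
    and phi_tracial: "\<lbrakk>a \<in> A; b \<in> A\<rbrakk> \<Longrightarrow> \<phi> (a o\<^sub>L b) = \<phi> (b o\<^sub>L a)"

section \<open>Freeness\<close>

primrec power_by :: "('b \<Rightarrow> 'b \<Rightarrow> 'b) \<Rightarrow> 'b \<Rightarrow> 'b \<Rightarrow> nat \<Rightarrow> 'b" where
  "power_by mul one X 0 = one"
| "power_by mul one X (Suc k) = mul X (power_by mul one X k)"

definition poly_at :: "('b \<Rightarrow> 'b \<Rightarrow> 'b) \<Rightarrow> 'b \<Rightarrow> complex poly \<Rightarrow> 'b \<Rightarrow> 'b::complex_space" where
  "poly_at mul one P X = (\<Sum>k\<le>degree P. coeff P k *\<^sub>C power_by mul one X k)"

text \<open>A word is a list of pairs of an index into \<open>Bs\<close> and an element of the set at that index.\<close>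

definition free_sets ::
  "('b \<Rightarrow> 'b \<Rightarrow> 'b) \<Rightarrow> 'b \<Rightarrow> ('b \<Rightarrow> complex) \<Rightarrow> 'b::complex_space set list \<Rightarrow> bool" where
  "free_sets mul one \<tau> Bs \<longleftrightarrow>
     (\<forall>w. w \<noteq> [] \<and> (\<forall>(i, b) \<in> set w. i < length Bs \<and> b \<in> Bs ! i) \<and> distinct_adj (map fst w) \<longrightarrow>
        \<tau> (foldr mul (map (\<lambda>(i, b). b - \<tau> b *\<^sub>C one) w) one) = 0)"

definition polynomials_in :: "('b \<Rightarrow> 'b \<Rightarrow> 'b) \<Rightarrow> 'b \<Rightarrow> 'b \<Rightarrow> 'b::complex_space set" where
  "polynomials_in mul one X = range (\<lambda>P. poly_at mul one P X)"

definition free_elements ::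
  "('b \<Rightarrow> 'b \<Rightarrow> 'b) \<Rightarrow> 'b \<Rightarrow> ('b \<Rightarrow> complex) \<Rightarrow> 'b::complex_space list \<Rightarrow> bool" where
  "free_elements mul one \<tau> Xs \<longleftrightarrow> free_sets mul one \<tau> (map (polynomials_in mul one) Xs)"

section \<open>Free Brownian motion and the free Poisson process\<close>

text \<open>For the bounded self-adjoint \<open>X\<close> and the compactly supported \<open>\<mu>\<close> used below, the moments
  determine the law.\<close>

definition has_law ::
  "(('h::complex_hilbert \<Rightarrow>\<^sub>L 'h) \<Rightarrow> complex) \<Rightarrow> ('h \<Rightarrow>\<^sub>L 'h) \<Rightarrow> real measure \<Rightarrow> bool" where
  "has_law \<phi> X \<mu> \<longleftrightarrow>
     (\<forall>k. \<phi> (power_by (o\<^sub>L) id_blinfun X k) = complex_of_real (\<integral>x. x ^ k \<partial>\<mu>))"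

definition semicircular_law :: "real \<Rightarrow> real measure" where
  "semicircular_law v = density lborel
     (\<lambda>x. ennreal (indicator {- 2 * sqrt v .. 2 * sqrt v} x * sqrt (4 * v - x\<^sup>2) / (2 * pi * v)))"

definition free_poisson_continuous_part :: "real \<Rightarrow> real measure" where
  "free_poisson_continuous_part r = density lborel
     (\<lambda>x. ennreal (indicator {(1 - sqrt r)\<^sup>2 .. (1 + sqrt r)\<^sup>2} x *
        sqrt (4 * r - (x - 1 - r)\<^sup>2) / (2 * pi * x)))"

definition free_poisson_law :: "real \<Rightarrow> real measure" where
  "free_poisson_law r = measure_of UNIV (sets borel)
     (\<lambda>B. ennreal (max 0 (1 - r)) * indicator B 0 + emeasure (free_poisson_continuous_part r) B)"

lemma sets_free_poisson_law [simp]: "sets (free_poisson_law r) = sets borel"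
  unfolding free_poisson_law_def using sets.sigma_sets_eq[of borel] by (simp add: sets_measure_of)

lemma emeasure_free_poisson_law:
  assumes "B \<in> sets borel"
  shows "emeasure (free_poisson_law r) B =
    ennreal (max 0 (1 - r)) * indicator B 0 + emeasure (free_poisson_continuous_part r) B"
proof (rule emeasure_measure_of[OF free_poisson_law_def])
  show "countably_additive (sets (free_poisson_law r))
     (\<lambda>B. ennreal (max 0 (1 - r)) * indicator B 0 + emeasure (free_poisson_continuous_part r) B)"
  proof (rule countably_additiveI)
    fix F :: "nat \<Rightarrow> real set"
    assume F: "range F \<subseteq> sets (free_poisson_law r)" "disjoint_family F"
    have "(\<Sum>i. emeasure (free_poisson_continuous_part r) (F i)) =
        emeasure (free_poisson_continuous_part r) (\<Union>i. F i)"
      using F by (intro suminf_emeasure) (auto simp: free_poisson_continuous_part_def)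
    moreover have "(\<Sum>i. indicator (F i) 0 :: ennreal) = indicator (\<Union>i. F i) 0"
      using F(2) by (rule suminf_indicator)
    ultimately show "(\<Sum>i. ennreal (max 0 (1 - r)) * indicator (F i) 0 +
        emeasure (free_poisson_continuous_part r) (F i)) =
      ennreal (max 0 (1 - r)) * indicator (\<Union>i. F i) 0 +
        emeasure (free_poisson_continuous_part r) (\<Union>i. F i)"
      by (simp add: suminf_add[symmetric] ennreal_suminf_cmult)
  qed
qed (use assms in \<open>auto simp: positive_def\<close>)

locale von_neumann_filtration = von_neumann_algebra A
  for A :: "('h::complex_hilbert \<Rightarrow>\<^sub>L 'h) set" +
  fixes \<F> :: "real \<Rightarrow> ('h \<Rightarrow>\<^sub>L 'h) set"
  assumes subalgebra: "0 \<le> t \<Longrightarrow> von_neumann_algebra (\<F> t) \<and> \<F> t \<subseteq> A"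
    and increasing: "\<lbrakk>0 \<le> u; u \<le> t\<rbrakk> \<Longrightarrow> \<F> u \<subseteq> \<F> t"

definition free_brownian_motion ::
  "('h::complex_hilbert \<Rightarrow>\<^sub>L 'h) set \<Rightarrow> (('h \<Rightarrow>\<^sub>L 'h) \<Rightarrow> complex) \<Rightarrow> (real \<Rightarrow> 'h \<Rightarrow>\<^sub>L 'h) \<Rightarrow> bool" where
  "free_brownian_motion A \<phi> S \<longleftrightarrow> (\<exists>\<F>. von_neumann_filtration A \<F> \<and>
     S 0 = 0 \<and>
     (\<forall>t\<ge>0. S t \<in> \<F> t \<and> is_adjoint (S t) (S t)) \<and>
     (\<forall>u t. 0 \<le> u \<and> u < t \<longrightarrow>
        free_sets (o\<^sub>L) id_blinfun \<phi> [polynomials_in (o\<^sub>L) id_blinfun (S t - S u), \<F> u] \<and>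
        has_law \<phi> (S t - S u) (semicircular_law (t - u))))"

definition free_poisson_process ::
  "('h::complex_hilbert \<Rightarrow>\<^sub>L 'h) set \<Rightarrow> (('h \<Rightarrow>\<^sub>L 'h) \<Rightarrow> complex) \<Rightarrow> (real \<Rightarrow> 'h \<Rightarrow>\<^sub>L 'h) \<Rightarrow> bool" where
  "free_poisson_process A \<phi> N \<longleftrightarrow> (\<exists>\<F>. von_neumann_filtration A \<F> \<and>
     N 0 = 0 \<and>
     (\<forall>t\<ge>0. N t \<in> \<F> t \<and> positive_operator (N t)) \<and>
     (\<forall>u t. 0 \<le> u \<and> u < t \<longrightarrow>
        free_sets (o\<^sub>L) id_blinfun \<phi> [polynomials_in (o\<^sub>L) id_blinfun (N t - N u), \<F> u] \<and>
        has_law \<phi> (N t - N u) (free_poisson_law (t - u))))"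

definition compensated :: "(real \<Rightarrow> 'h::complex_hilbert \<Rightarrow>\<^sub>L 'h) \<Rightarrow> real \<Rightarrow> 'h \<Rightarrow>\<^sub>L 'h" where
  "compensated N t = N t - t *\<^sub>R id_blinfun"

section \<open>The space \<open>L\<^sup>2(A, \<phi>)\<close>\<close>

text \<open>A completion of \<open>A\<close> is a Hilbert space together with an isometric embedding \<open>\<iota>\<close> of \<open>A\<close>
  with dense range; it is unique up to isomorphism.\<close>

locale L2_completion = tracial_W_probability_space A \<phi>
  for A :: "('h::complex_hilbert \<Rightarrow>\<^sub>L 'h) set" and \<phi> +
  fixes \<iota> :: "('h \<Rightarrow>\<^sub>L 'h) \<Rightarrow> 'l::complex_hilbert"
  assumes iota_add: "\<lbrakk>a \<in> A; b \<in> A\<rbrakk> \<Longrightarrow> \<iota> (a + b) = \<iota> a + \<iota> b"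
    and iota_scale: "a \<in> A \<Longrightarrow> \<iota> (c *\<^sub>C a) = c *\<^sub>C \<iota> a"
    and iota_isometric: "\<lbrakk>a \<in> A; b \<in> A\<rbrakk> \<Longrightarrow> cinner (\<iota> a) (\<iota> b) = \<phi> (a o\<^sub>L adj b)"
    and iota_dense: "closure (\<iota> ` A) = UNIV"

text \<open>The involution of \<open>A\<close> extends to \<open>L\<^sup>2\<close> by continuity, and so does \<open>\<phi>\<close>.\<close>

definition L2_adj ::
  "('h::complex_hilbert \<Rightarrow>\<^sub>L 'h) set \<Rightarrow> (('h \<Rightarrow>\<^sub>L 'h) \<Rightarrow> 'l::complex_hilbert) \<Rightarrow> 'l \<Rightarrow> 'l" where
  "L2_adj A \<iota> x = (THE y. \<exists>b. range b \<subseteq> A \<and>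
     (\<lambda>k. \<iota> (b k)) \<longlonglongrightarrow> x \<and> (\<lambda>k. \<iota> (adj (b k))) \<longlonglongrightarrow> y)"

definition L2_state ::
  "(('h::complex_hilbert \<Rightarrow>\<^sub>L 'h) \<Rightarrow> 'l::complex_hilbert) \<Rightarrow> 'l \<Rightarrow> complex" where
  "L2_state \<iota> x = cinner x (\<iota> id_blinfun)"

text \<open>The multiplication of \<open>A\<close> extends by continuity to a map \<open>L\<^sup>2 \<times> L\<^sup>2 \<rightarrow> L\<^sup>1\<close>, and an element
  of \<open>L\<^sup>1\<close> is determined by the functional \<open>a \<mapsto> \<phi> (x a\<^sup>*)\<close> on \<open>A\<close>. So \<open>L2_prod A \<phi> \<iota> x y z\<close> says
  that the product of \<open>x\<close> and \<open>y\<close> lies in \<open>L\<^sup>2\<close> and equals \<open>z\<close>; it does not depend on the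
  approximating sequences.\<close>

definition L2_prod ::
  "('h::complex_hilbert \<Rightarrow>\<^sub>L 'h) set \<Rightarrow> (('h \<Rightarrow>\<^sub>L 'h) \<Rightarrow> complex) \<Rightarrow>
     (('h \<Rightarrow>\<^sub>L 'h) \<Rightarrow> 'l::complex_hilbert) \<Rightarrow> 'l \<Rightarrow> 'l \<Rightarrow> 'l \<Rightarrow> bool" where
  "L2_prod A \<phi> \<iota> x y z \<longleftrightarrow> (\<exists>b c. range b \<subseteq> A \<and> range c \<subseteq> A \<and>
     (\<lambda>k. \<iota> (b k)) \<longlonglongrightarrow> x \<and> (\<lambda>k. \<iota> (c k)) \<longlonglongrightarrow> y \<and>
     (\<forall>a\<in>A. (\<lambda>k. \<phi> (b k o\<^sub>L c k o\<^sub>L adj a)) \<longlonglongrightarrow> cinner z (\<iota> a)))"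

text \<open>A set of (possibly unbounded) elements of \<open>L\<^sup>2\<close> that forms a unital \<open>*\<close>-algebra for the
  multiplication and the involution of \<open>A\<close>. All moments of its elements are finite.\<close>

locale L2_star_algebra =
  fixes A :: "('h::complex_hilbert \<Rightarrow>\<^sub>L 'h) set" and \<phi> :: "('h \<Rightarrow>\<^sub>L 'h) \<Rightarrow> complex"
    and \<iota> :: "('h \<Rightarrow>\<^sub>L 'h) \<Rightarrow> 'l::complex_hilbert"
    and B :: "'l set" and mul :: "'l \<Rightarrow> 'l \<Rightarrow> 'l"
  assumes one_closed: "\<iota> id_blinfun \<in> B"
    and add_closed: "\<lbrakk>x \<in> B; y \<in> B\<rbrakk> \<Longrightarrow> x + y \<in> B"
    and scale_closed: "x \<in> B \<Longrightarrow> c *\<^sub>C x \<in> B"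
    and adj_closed: "x \<in> B \<Longrightarrow> L2_adj A \<iota> x \<in> B"
    and mul_closed: "\<lbrakk>x \<in> B; y \<in> B\<rbrakk> \<Longrightarrow> mul x y \<in> B"
    and mul_L2_prod: "\<lbrakk>x \<in> B; y \<in> B\<rbrakk> \<Longrightarrow> L2_prod A \<phi> \<iota> x y (mul x y)"
    and mul_one_left: "x \<in> B \<Longrightarrow> mul (\<iota> id_blinfun) x = x"
    and mul_one_right: "x \<in> B \<Longrightarrow> mul x (\<iota> id_blinfun) = x"
    and mul_assoc: "\<lbrakk>x \<in> B; y \<in> B; z \<in> B\<rbrakk> \<Longrightarrow> mul (mul x y) z = mul x (mul y z)"
    and mul_add_left: "\<lbrakk>x \<in> B; y \<in> B; z \<in> B\<rbrakk> \<Longrightarrow> mul (x + y) z = mul x z + mul y z"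
    and mul_add_right: "\<lbrakk>x \<in> B; y \<in> B; z \<in> B\<rbrakk> \<Longrightarrow> mul x (y + z) = mul x y + mul x z"
    and mul_scale_left: "\<lbrakk>x \<in> B; y \<in> B\<rbrakk> \<Longrightarrow> mul (c *\<^sub>C x) y = c *\<^sub>C mul x y"
    and mul_scale_right: "\<lbrakk>x \<in> B; y \<in> B\<rbrakk> \<Longrightarrow> mul x (c *\<^sub>C y) = c *\<^sub>C mul x y"
    and adj_mul: "\<lbrakk>x \<in> B; y \<in> B\<rbrakk> \<Longrightarrow>
      L2_adj A \<iota> (mul x y) = mul (L2_adj A \<iota> y) (L2_adj A \<iota> x)"

text \<open>For unbounded elements freeness only makes sense if the mixed moments exist. The choice of
  \<open>B\<close> is irrelevant, because \<open>L2_prod\<close> determines the multiplication.\<close>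

definition L2_moments_exist ::
  "('h::complex_hilbert \<Rightarrow>\<^sub>L 'h) set \<Rightarrow> (('h \<Rightarrow>\<^sub>L 'h) \<Rightarrow> complex) \<Rightarrow>
     (('h \<Rightarrow>\<^sub>L 'h) \<Rightarrow> 'l::complex_hilbert) \<Rightarrow> 'l list \<Rightarrow> bool" where
  "L2_moments_exist A \<phi> \<iota> Xs \<longleftrightarrow> (\<exists>B mul. L2_star_algebra A \<phi> \<iota> B mul \<and> set Xs \<subseteq> B)"

definition L2_free ::
  "('h::complex_hilbert \<Rightarrow>\<^sub>L 'h) set \<Rightarrow> (('h \<Rightarrow>\<^sub>L 'h) \<Rightarrow> complex) \<Rightarrow>
     (('h \<Rightarrow>\<^sub>L 'h) \<Rightarrow> 'l::complex_hilbert) \<Rightarrow> 'l list \<Rightarrow> bool" where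
  "L2_free A \<phi> \<iota> Xs \<longleftrightarrow> (\<exists>B mul. L2_star_algebra A \<phi> \<iota> B mul \<and> set Xs \<subseteq> B \<and>
     free_elements mul (\<iota> id_blinfun) (L2_state \<iota>) Xs)"

section \<open>Kernels and contractions\<close>

text \<open>A point of \<open>[0, \<infinity>)\<^sup>n\<close> is an extensional function on \<open>{..<n}\<close>; the coordinate \<open>t\<^sub>i\<close> is
  \<open>t (i - 1)\<close>. Kernels are functions, not classes modulo null sets.\<close>

type_synonym kernel = "(nat \<Rightarrow> real) \<Rightarrow> complex"

definition Rplus_power :: "nat \<Rightarrow> (nat \<Rightarrow> real) measure" where
  "Rplus_power n = PiM {..<n} (\<lambda>_. restrict_space lborel {0..})"

definition L2_kernel :: "nat \<Rightarrow> kernel \<Rightarrow> bool" where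
  "L2_kernel n f \<longleftrightarrow> f \<in> borel_measurable (Rplus_power n) \<and>
     integrable (Rplus_power n) (\<lambda>t. (cmod (f t))\<^sup>2)"

definition symmetric_kernel :: "nat \<Rightarrow> kernel \<Rightarrow> bool" where
  "symmetric_kernel n f \<longleftrightarrow> L2_kernel n f \<and>
     (AE t in Rplus_power n. f t \<in> \<real>) \<and>
     (\<forall>\<sigma>. \<sigma> permutes {..<n} \<longrightarrow> (AE t in Rplus_power n. f (t \<circ> \<sigma>) = f t))"

definition adjoint_kernel :: "nat \<Rightarrow> kernel \<Rightarrow> kernel" where
  "adjoint_kernel n f t = cnj (f (\<lambda>i\<in>{..<n}. t (n - 1 - i)))"

text \<open>In the two contractions \<open>f\<close> has \<open>n\<close> and \<open>g\<close> has \<open>m\<close> arguments.\<close>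

definition contraction :: "nat \<Rightarrow> nat \<Rightarrow> nat \<Rightarrow> kernel \<Rightarrow> kernel \<Rightarrow> kernel" where
  "contraction n m p f g t = (\<integral>s.
      f (\<lambda>i\<in>{..<n}. if i < n - p then t i else s (i - (n - p))) *
      g (\<lambda>i\<in>{..<m}. if i < p then s (p - 1 - i) else t (n - p + (i - p)))
    \<partial>Rplus_power p)"

definition star_contraction :: "nat \<Rightarrow> nat \<Rightarrow> nat \<Rightarrow> kernel \<Rightarrow> kernel \<Rightarrow> kernel" where
  "star_contraction n m p f g t = (\<integral>s.
      f (\<lambda>i\<in>{..<n}. if i < n - p + 1 then t i else s (n - 1 - i)) *
      g (\<lambda>i\<in>{..<m}. if i < p - 1 then s i else t (n - p + (i - (p - 1))))
    \<partial>Rplus_power (p - 1))"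

section \<open>Multiple integrals\<close>

definition box_kernel :: "nat \<Rightarrow> (nat \<Rightarrow> real) \<Rightarrow> (nat \<Rightarrow> real) \<Rightarrow> kernel" where
  "box_kernel n a b = indicator (PiE {..<n} (\<lambda>i. {a i..b i}))"

text \<open>The box formula determines the family \<open>I\<close> of maps on \<open>L\<^sup>2\<close> kernels, by linearity and the
  isometry; in particular \<open>I n f\<close> only depends on the class of \<open>f\<close> modulo null sets. Orthogonality, the
  adjoint rule and (below) the product formulas are consequences of the other conditions that are
  taken as part of the standing conventions on multiple integrals.\<close>

locale multiple_integral =
  fixes A :: "('h::complex_hilbert \<Rightarrow>\<^sub>L 'h) set"
    and \<iota> :: "('h \<Rightarrow>\<^sub>L 'h) \<Rightarrow> 'l::complex_hilbert"
    and M :: "real \<Rightarrow> 'h \<Rightarrow>\<^sub>L 'h"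
    and I :: "nat \<Rightarrow> kernel \<Rightarrow> 'l"
  assumes I_add: "\<lbrakk>L2_kernel n f; L2_kernel n g\<rbrakk> \<Longrightarrow> I n (\<lambda>t. f t + g t) = I n f + I n g"
    and I_scale: "L2_kernel n f \<Longrightarrow> I n (\<lambda>t. c * f t) = c *\<^sub>C I n f"
    and I_box: "\<lbrakk>\<And>i. i < n \<Longrightarrow> 0 \<le> a i \<and> a i \<le> b i;
        \<And>i j. \<lbrakk>i < n; j < n; i \<noteq> j\<rbrakk> \<Longrightarrow> {a i..b i} \<inter> {a j..b j} = {}\<rbrakk> \<Longrightarrow>
      I n (box_kernel n a b) =
        \<iota> (foldr (o\<^sub>L) (map (\<lambda>i. M (b i) - M (a i)) [0..<n]) id_blinfun)"
    and I_isometry: "\<lbrakk>L2_kernel n f; L2_kernel n g\<rbrakk> \<Longrightarrow>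
      cinner (I n f) (I n g) = (\<integral>t. f t * cnj (g t) \<partial>Rplus_power n)"
    and I_zero: "I 0 (\<lambda>_. c) = c *\<^sub>C \<iota> id_blinfun"
    and I_orthogonal: "\<lbrakk>L2_kernel n f; L2_kernel m g; n \<noteq> m\<rbrakk> \<Longrightarrow> cinner (I n f) (I m g) = 0"
    and I_adjoint: "L2_kernel n f \<Longrightarrow> L2_adj A \<iota> (I n f) = I n (adjoint_kernel n f)"

text \<open>The set of Wigner integrals is closed under complex scaling, so its real span is its
  complex span. The contractions \<open>f \<frown>\<^sup>p g\<close> of \<open>L\<^sup>2\<close> kernels are again in \<open>L\<^sup>2\<close>.\<close>

locale wigner_integral = multiple_integral A \<iota> S I
  for A :: "('h::complex_hilbert \<Rightarrow>\<^sub>L 'h) set" and \<phi> :: "('h \<Rightarrow>\<^sub>L 'h) \<Rightarrow> complex"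
    and \<iota> :: "('h \<Rightarrow>\<^sub>L 'h) \<Rightarrow> 'l::complex_hilbert" and S I +
  assumes brownian: "free_brownian_motion A \<phi> S"
    and wigner_algebra: "\<exists>mul. L2_star_algebra A \<phi> \<iota> (span {I n f | n f. L2_kernel n f}) mul"
    and wigner_product: "\<lbrakk>L2_kernel n f; L2_kernel m g\<rbrakk> \<Longrightarrow>
      L2_prod A \<phi> \<iota> (I n f) (I m g) X \<longleftrightarrow>
        X = (\<Sum>p\<le>min n m. I (n + m - 2 * p) (contraction n m p f g))"

text \<open>In contrast, \<open>star_contraction n m p f g\<close> need not be in \<open>L\<^sup>2\<close>: for \<open>n = m = p = 1\<close> it is the
  pointwise product. The product of two integrals is in \<open>L\<^sup>2\<close> if and only if these kernels are.\<close>

locale free_poisson_integral = multiple_integral A \<iota> "compensated N" I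
  for A :: "('h::complex_hilbert \<Rightarrow>\<^sub>L 'h) set" and \<phi> :: "('h \<Rightarrow>\<^sub>L 'h) \<Rightarrow> complex"
    and \<iota> :: "('h \<Rightarrow>\<^sub>L 'h) \<Rightarrow> 'l::complex_hilbert" and N I +
  assumes poisson: "free_poisson_process A \<phi> N"
    and poisson_product: "\<lbrakk>L2_kernel n f; L2_kernel m g\<rbrakk> \<Longrightarrow>
      L2_prod A \<phi> \<iota> (I n f) (I m g) X \<longleftrightarrow>
        (\<forall>p\<in>{1..min n m}. L2_kernel (n + m - 2 * p + 1) (star_contraction n m p f g)) \<and>
        X = (\<Sum>p\<le>min n m. I (n + m - 2 * p) (contraction n m p f g)) +
            (\<Sum>p = 1..min n m. I (n + m - 2 * p + 1) (star_contraction n m p f g))"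

end

theory Submission
  imports Defs
begin

text \<open>
  Let \<open>X\<close> and \<open>Y\<close> be the integrals of \<open>f\<close> and \<open>g\<close>. If the Poisson integrals are free, then
  \<open>\<tau>(X\<^sup>2 Y\<^sup>2) = \<tau>(X\<^sup>2) \<tau>(Y\<^sup>2)\<close>, which by the trace property means \<open>\<parallel>X Y\<parallel> = \<parallel>X\<parallel> \<parallel>Y\<parallel>\<close>. The product formula writes
  \<open>X Y\<close> as an orthogonal sum whose leading term, the integral of \<open>f \<otimes> g\<close>, already has norm \<open>\<parallel>X\<parallel> \<parallel>Y\<parallel>\<close>. Hence
  all contractions \<open>f \<frown>\<^sup>p g\<close> with \<open>p \<ge> 1\<close>, and all star contractions, vanish almost everywhere
  (\<open>norm_mul_if_free\<close>, \<open>contractions_zero_if_norm_product\<close>).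

  Conversely, vanishing of the contractions \<open>f \<frown>\<^sup>p g\<close> and \<open>g \<frown>\<^sup>p f\<close> with \<open>p \<ge> 1\<close> makes the Wigner integrals free
  (\<open>free_if_contractions_vanish\<close>). The class of kernels whose contractions with a given kernel vanish is
  closed under contraction with \<open>f\<close> from the left if it contains the symmetric kernel \<open>f\<close>
  (\<open>contractions_vanish_contraction\<close>, an application of Fubini's theorem). So the property passes from
  \<open>f\<close> and \<open>g\<close> to the kernels of polynomials in \<open>X\<close> and in \<open>Y\<close>. Multiplying a centered polynomial in \<open>X\<close> with a
  word that starts with a centered polynomial in \<open>Y\<close> is then just the tensor product of kernels, without any
  contraction (\<open>letter_mul_word_chaos\<close>). By induction, an alternating product of centered polynomials is a
  sum of integrals of positive order, and these have state zero.

  Kernels of one variable show that the converse fails: the Wigner integrals of orthogonal functions are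
  free, whereas freeness of the Poisson integrals forces the pointwise product, a star contraction, to
  vanish. The indicator function of \<open>[0, 2]\<close> and the difference of those of \<open>[0, 1]\<close> and \<open>[1, 2]\<close> are
  orthogonal and have a nonzero product.
\<close>

section \<open>Integrals of products of three kernels\<close>

lemma cmod_integral_le_nn_integral:
  fixes f :: "'a \<Rightarrow> complex"
  shows "ennreal (cmod (\<integral>x. f x \<partial>M)) \<le> (\<integral>\<^sup>+x. ennreal (cmod (f x)) \<partial>M)"
  by (cases "integrable M f") (simp_all add: integral_norm_bound_ennreal not_integrable_integral_eq)

lemma cmod_integral_mult_le:
  fixes f g :: "'a \<Rightarrow> complex"
  assumes [measurable]: "f \<in> borel_measurable M" "g \<in> borel_measurable M"
  shows "ennreal ((cmod (\<integral>x. f x * g x \<partial>M))\<^sup>2) \<le>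
    (\<integral>\<^sup>+x. ennreal ((cmod (f x))\<^sup>2) \<partial>M) * (\<integral>\<^sup>+x. ennreal ((cmod (g x))\<^sup>2) \<partial>M)"
proof -
  have "ennreal ((cmod (\<integral>x. f x * g x \<partial>M))\<^sup>2) = (ennreal (cmod (\<integral>x. f x * g x \<partial>M)))\<^sup>2"
    by (simp add: ennreal_power)
  also have "\<dots> \<le> (\<integral>\<^sup>+x. ennreal (cmod (f x)) * ennreal (cmod (g x)) \<partial>M)\<^sup>2"
    using cmod_integral_le_nn_integral[of M "\<lambda>x. f x * g x"]
    by (intro power_mono) (simp_all add: norm_mult ennreal_mult)
  also have "\<dots> \<le> (\<integral>\<^sup>+x. (ennreal (cmod (f x)))\<^sup>2 \<partial>M) * (\<integral>\<^sup>+x. (ennreal (cmod (g x)))\<^sup>2 \<partial>M)"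
    by (intro Cauchy_Schwarz_nn_integral) measurable
  finally show ?thesis by (simp add: ennreal_power)
qed

lemma ennreal_mult_le_sum_squares: "x * y \<le> x\<^sup>2 + (y::ennreal)\<^sup>2"
proof (cases "x \<le> y")
  case True
  then have "x * y \<le> y * y" by (intro mult_right_mono) auto
  then show ?thesis by (simp add: power2_eq_square add_increasing)
next
  case False
  then have "x * y \<le> x * x" by (intro mult_left_mono) auto
  then show ?thesis by (simp add: power2_eq_square add_increasing2)
qed

text \<open>Each of three square-integrable kernels shares one variable with each of the other two. The
  integral over \<open>b\<close> of \<open>H z b * W b a\<close> is a composition of Hilbert--Schmidt kernels, which is square
  integrable in \<open>(z, a)\<close> by the Cauchy--Schwarz inequality, and \<open>F\<close> is square integrable in the same two
  variables; this is what makes Fubini's theorem available for the triple product.\<close>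

lemma triple_product_integrable:
  fixes F :: "'a \<Rightarrow> 'z \<Rightarrow> complex" and H :: "'z \<Rightarrow> 'b \<Rightarrow> complex" and W :: "'b \<Rightarrow> 'a \<Rightarrow> complex"
  assumes "sigma_finite_measure A" "sigma_finite_measure B" "sigma_finite_measure Z"
    and F[measurable]: "case_prod F \<in> borel_measurable (A \<Otimes>\<^sub>M Z)"
    and H[measurable]: "case_prod H \<in> borel_measurable (Z \<Otimes>\<^sub>M B)"
    and W[measurable]: "case_prod W \<in> borel_measurable (B \<Otimes>\<^sub>M A)"
    and F2: "(\<integral>\<^sup>+a. \<integral>\<^sup>+z. ennreal ((cmod (F a z))\<^sup>2) \<partial>Z \<partial>A) < \<infinity>"
    and H2: "(\<integral>\<^sup>+b. \<integral>\<^sup>+z. ennreal ((cmod (H z b))\<^sup>2) \<partial>Z \<partial>B) < \<infinity>"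
    and W2: "(\<integral>\<^sup>+a. \<integral>\<^sup>+b. ennreal ((cmod (W b a))\<^sup>2) \<partial>B \<partial>A) < \<infinity>"
  shows "integrable ((A \<Otimes>\<^sub>M B) \<Otimes>\<^sub>M Z)
    (\<lambda>(p, z). F (fst p) z * H z (snd p) * W (snd p) (fst p))" (is "integrable _ (\<lambda>(p, z). ?\<Phi> p z)")
proof (rule integrableI_bounded)
  interpret A: sigma_finite_measure A by fact
  interpret B: sigma_finite_measure B by fact
  interpret Z: sigma_finite_measure Z by fact
  interpret BZ: pair_sigma_finite B Z ..
  show meas[measurable]: "(\<lambda>(p, z). ?\<Phi> p z) \<in> borel_measurable ((A \<Otimes>\<^sub>M B) \<Otimes>\<^sub>M Z)" by measurable
  define \<eta> where "\<eta> z = (\<integral>\<^sup>+b. ennreal ((cmod (H z b))\<^sup>2) \<partial>B)" for z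
  define \<omega> where "\<omega> a = (\<integral>\<^sup>+b. ennreal ((cmod (W b a))\<^sup>2) \<partial>B)" for a
  have [measurable]: "\<eta> \<in> borel_measurable Z" "\<omega> \<in> borel_measurable A"
    unfolding \<eta>_def \<omega>_def by measurable
  have \<eta>2: "(\<integral>\<^sup>+z. \<eta> z \<partial>Z) < \<infinity>"
    unfolding \<eta>_def using H2 BZ.Fubini'[of "\<lambda>b z. ennreal ((cmod (H z b))\<^sup>2)"] by simp
  have bound: "(\<integral>\<^sup>+b. ennreal (cmod (F a z * H z b * W b a)) \<partial>B) \<le>
      ennreal ((cmod (F a z))\<^sup>2) + \<eta> z * \<omega> a" if az: "a \<in> space A" "z \<in> space Z" for a z
  proof -
    define K where "K = (\<integral>\<^sup>+b. ennreal (cmod (H z b)) * ennreal (cmod (W b a)) \<partial>B)"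
    have [measurable]: "H z \<in> borel_measurable B" "(\<lambda>b. W b a) \<in> borel_measurable B"
      using az by measurable
    \<comment> \<open>Cauchy--Schwarz for the composition of \<open>H\<close> and \<open>W\<close> at fixed \<open>(z, a)\<close>.\<close>
    have "K\<^sup>2 \<le> (\<integral>\<^sup>+b. (ennreal (cmod (H z b)))\<^sup>2 \<partial>B) * (\<integral>\<^sup>+b. (ennreal (cmod (W b a)))\<^sup>2 \<partial>B)"
      unfolding K_def by (intro Cauchy_Schwarz_nn_integral) measurable
    then have K2: "K\<^sup>2 \<le> \<eta> z * \<omega> a" by (simp add: \<eta>_def \<omega>_def ennreal_power)
    have "(\<integral>\<^sup>+b. ennreal (cmod (F a z * H z b * W b a)) \<partial>B) = ennreal (cmod (F a z)) * K"
      unfolding K_def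
      by (subst nn_integral_cmult[symmetric]) (auto simp: norm_mult ennreal_mult mult.assoc)
    also have "\<dots> \<le> (ennreal (cmod (F a z)))\<^sup>2 + K\<^sup>2" by (rule ennreal_mult_le_sum_squares)
    finally show ?thesis using K2 by (simp add: ennreal_power add_left_mono order_trans)
  qed
  have "(\<integral>\<^sup>+q. ennreal (cmod (case q of (p, z) \<Rightarrow> ?\<Phi> p z)) \<partial>((A \<Otimes>\<^sub>M B) \<Otimes>\<^sub>M Z)) =
      (\<integral>\<^sup>+p. \<integral>\<^sup>+z. ennreal (cmod (?\<Phi> p z)) \<partial>Z \<partial>(A \<Otimes>\<^sub>M B))"
    by (subst Z.nn_integral_fst[symmetric]) auto
  also have "\<dots> = (\<integral>\<^sup>+a. \<integral>\<^sup>+b. \<integral>\<^sup>+z. ennreal (cmod (?\<Phi> (a, b) z)) \<partial>Z \<partial>B \<partial>A)"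
    by (subst B.nn_integral_fst[symmetric]) auto
  also have "\<dots> = (\<integral>\<^sup>+a. \<integral>\<^sup>+z. \<integral>\<^sup>+b. ennreal (cmod (F a z * H z b * W b a)) \<partial>B \<partial>Z \<partial>A)"
  proof (rule nn_integral_cong)
    fix a assume "a \<in> space A"
    then have [measurable]: "F a \<in> borel_measurable Z" "(\<lambda>b. W b a) \<in> borel_measurable B" by measurable
    show "(\<integral>\<^sup>+b. \<integral>\<^sup>+z. ennreal (cmod (?\<Phi> (a, b) z)) \<partial>Z \<partial>B) =
        (\<integral>\<^sup>+z. \<integral>\<^sup>+b. ennreal (cmod (F a z * H z b * W b a)) \<partial>B \<partial>Z)"
      using BZ.Fubini'[of "\<lambda>b z. ennreal (cmod (F a z * H z b * W b a))"] by simp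
  qed
  also have "\<dots> \<le> (\<integral>\<^sup>+a. \<integral>\<^sup>+z. ennreal ((cmod (F a z))\<^sup>2) + \<eta> z * \<omega> a \<partial>Z \<partial>A)"
    using bound by (intro nn_integral_mono) auto
  also have "\<dots> = (\<integral>\<^sup>+a. (\<integral>\<^sup>+z. ennreal ((cmod (F a z))\<^sup>2) \<partial>Z) + (\<integral>\<^sup>+z. \<eta> z \<partial>Z) * \<omega> a \<partial>A)"
    by (intro nn_integral_cong) (simp add: nn_integral_add nn_integral_multc)
  also have "\<dots> = (\<integral>\<^sup>+a. \<integral>\<^sup>+z. ennreal ((cmod (F a z))\<^sup>2) \<partial>Z \<partial>A) +
      (\<integral>\<^sup>+z. \<eta> z \<partial>Z) * (\<integral>\<^sup>+a. \<omega> a \<partial>A)"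
    by (simp add: nn_integral_add nn_integral_cmult)
  also have "\<dots> < \<infinity>"
    using F2 \<eta>2 W2 by (simp add: \<omega>_def ennreal_mult_less_top)
  finally show "(\<integral>\<^sup>+q. ennreal (cmod (case q of (p, z) \<Rightarrow> ?\<Phi> p z)) \<partial>((A \<Otimes>\<^sub>M B) \<Otimes>\<^sub>M Z)) < \<infinity>" .
qed

text \<open>The triple integral may be evaluated by starting with any of its three variables. So it is zero
  as soon as one of the pairwise compositions vanishes almost everywhere, in whatever order the integral
  is written.\<close>

lemma triple_integral_eq_zero:
  fixes F :: "'a \<Rightarrow> 'z \<Rightarrow> complex" and H :: "'z \<Rightarrow> 'b \<Rightarrow> complex" and W :: "'b \<Rightarrow> 'a \<Rightarrow> complex"
  assumes sf: "sigma_finite_measure A" "sigma_finite_measure B" "sigma_finite_measure Z"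
    and F[measurable]: "case_prod F \<in> borel_measurable (A \<Otimes>\<^sub>M Z)"
    and H[measurable]: "case_prod H \<in> borel_measurable (Z \<Otimes>\<^sub>M B)"
    and W[measurable]: "case_prod W \<in> borel_measurable (B \<Otimes>\<^sub>M A)"
    and F2: "(\<integral>\<^sup>+a. \<integral>\<^sup>+z. ennreal ((cmod (F a z))\<^sup>2) \<partial>Z \<partial>A) < \<infinity>"
    and H2: "(\<integral>\<^sup>+b. \<integral>\<^sup>+z. ennreal ((cmod (H z b))\<^sup>2) \<partial>Z \<partial>B) < \<infinity>"
    and W2: "(\<integral>\<^sup>+a. \<integral>\<^sup>+b. ennreal ((cmod (W b a))\<^sup>2) \<partial>B \<partial>A) < \<infinity>"
    and zero: "(AE a in A. AE z in Z. (\<integral>b. H z b * W b a \<partial>B) = 0) \<or>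
      (AE z in Z. AE b in B. (\<integral>a. F a z * W b a \<partial>A) = 0)"
  shows "(\<integral>p. (\<integral>z. F (fst p) z * H z (snd p) \<partial>Z) * W (snd p) (fst p) \<partial>(A \<Otimes>\<^sub>M B)) = 0"
proof -
  interpret A: sigma_finite_measure A by fact
  interpret B: sigma_finite_measure B by fact
  interpret Z: sigma_finite_measure Z by fact
  interpret AB: pair_sigma_finite A B ..
  interpret AZ: pair_sigma_finite A Z ..
  interpret AB': sigma_finite_measure "A \<Otimes>\<^sub>M B" by (rule sigma_finite_pair_measure) unfold_locales
  interpret ABZ: pair_sigma_finite "A \<Otimes>\<^sub>M B" Z ..
  let ?\<Phi> = "\<lambda>p z. F (fst p) z * H z (snd p) * W (snd p) (fst p)"
  have int: "integrable ((A \<Otimes>\<^sub>M B) \<Otimes>\<^sub>M Z) (\<lambda>(p, z). ?\<Phi> p z)"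
    by (rule triple_product_integrable; fact)
  have "(\<integral>p. (\<integral>z. F (fst p) z * H z (snd p) \<partial>Z) * W (snd p) (fst p) \<partial>(A \<Otimes>\<^sub>M B)) =
      (\<integral>p. \<integral>z. ?\<Phi> p z \<partial>Z \<partial>(A \<Otimes>\<^sub>M B))"
    by simp
  also have "\<dots> = (\<integral>z. \<integral>p. ?\<Phi> p z \<partial>(A \<Otimes>\<^sub>M B) \<partial>Z)"
    by (rule ABZ.Fubini_integral[OF int, symmetric])
  also have "\<dots> = (\<integral>z. 0 \<partial>Z)"
  proof (rule integral_cong_AE)
    have "AE z in Z. integrable (A \<Otimes>\<^sub>M B) (\<lambda>p. ?\<Phi> p z)"
      using ABZ.AE_integrable_snd[OF int] by simp
    then have "AE z in Z. (\<integral>p. ?\<Phi> p z \<partial>(A \<Otimes>\<^sub>M B)) = (\<integral>a. \<integral>b. ?\<Phi> (a, b) z \<partial>B \<partial>A) \<and>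
        (\<integral>p. ?\<Phi> p z \<partial>(A \<Otimes>\<^sub>M B)) = (\<integral>b. \<integral>a. ?\<Phi> (a, b) z \<partial>A \<partial>B)"
    proof eventually_elim
      case (elim z)
      then have "integrable (A \<Otimes>\<^sub>M B) (\<lambda>(a, b). ?\<Phi> (a, b) z)" by (simp add: case_prod_unfold)
      then show ?case
        using AB.integral_fst'[OF elim] AB.Fubini_integral[of "\<lambda>a b. ?\<Phi> (a, b) z"] by simp
    qed
    moreover from zero have "AE z in Z. (\<integral>a. \<integral>b. ?\<Phi> (a, b) z \<partial>B \<partial>A) = 0 \<or>
        (\<integral>b. \<integral>a. ?\<Phi> (a, b) z \<partial>A \<partial>B) = 0"
    proof
      assume "AE a in A. AE z in Z. (\<integral>b. H z b * W b a \<partial>B) = 0"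
      then have "AE z in Z. AE a in A. (\<integral>b. H z b * W b a \<partial>B) = 0"
        by (subst AZ.AE_commute[symmetric]) auto
      then show ?thesis
      proof eventually_elim
        case (elim z)
        then have "AE a in A. (\<integral>b. ?\<Phi> (a, b) z \<partial>B) = 0"
          by eventually_elim (simp add: mult.assoc)
        then show ?case by (simp add: integral_eq_zero_AE)
      qed
    next
      assume "AE z in Z. AE b in B. (\<integral>a. F a z * W b a \<partial>A) = 0"
      then show ?thesis
      proof eventually_elim
        case (elim z)
        have "(\<integral>a. ?\<Phi> (a, b) z \<partial>A) = H z b * (\<integral>a. F a z * W b a \<partial>A)" for b
          by (subst integral_mult_right_zero[symmetric]) (simp add: mult_ac)
        moreover from elim have "AE b in B. H z b * (\<integral>a. F a z * W b a \<partial>A) = 0"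
          by eventually_elim simp
        ultimately have "AE b in B. (\<integral>a. ?\<Phi> (a, b) z \<partial>A) = 0" by simp
        then show ?case by (simp add: integral_eq_zero_AE)
      qed
    qed
    ultimately show "AE z in Z. (\<integral>p. ?\<Phi> p z \<partial>(A \<Otimes>\<^sub>M B)) = 0" by eventually_elim auto
  qed measurable
  finally show ?thesis by simp
qed

section \<open>Points and their blocks\<close>

text \<open>The point that consists of \<open>a\<close> coordinates of \<open>x\<close> followed by \<open>y\<close>. Points are extensional
  functions, so the length of \<open>y\<close> need not be given: beyond it, \<open>y\<close> already has the default value.\<close>

definition juxt :: "nat \<Rightarrow> (nat \<Rightarrow> 'a) \<Rightarrow> (nat \<Rightarrow> 'a) \<Rightarrow> nat \<Rightarrow> 'a" where
  "juxt a x y i = (if i < a then x i else y (i - a))"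

text \<open>In a contraction, the contracted arguments enter the second kernel in reverse order.\<close>

definition flip :: "nat \<Rightarrow> (nat \<Rightarrow> 'a) \<Rightarrow> nat \<Rightarrow> 'a" where
  "flip p s = (\<lambda>i\<in>{..<p}. s (p - 1 - i))"

lemma juxt_assoc: "juxt a x (juxt b y z) = juxt (a + b) (juxt a x y) z"
  by (auto simp: juxt_def fun_eq_iff)

lemma juxt_0 [simp]: "juxt 0 x y = y"
  by (simp add: juxt_def fun_eq_iff)

abbreviation half_line :: "real measure" where
  "half_line \<equiv> restrict_space lborel {0..}"

interpretation half_line: product_sigma_finite "\<lambda>_ :: nat. half_line"
  by (intro product_sigma_finite.intro sigma_finite_measure_restrict_space sigma_finite_lborel) simp

lemma space_Rplus_power: "space (Rplus_power n) = PiE {..<n} (\<lambda>_. {0..})"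
  by (simp add: Rplus_power_def space_PiM space_restrict_space)

lemma sigma_finite_Rplus_power: "sigma_finite_measure (Rplus_power n)"
  unfolding Rplus_power_def by (rule half_line.sigma_finite) simp

interpretation Rplus_power: sigma_finite_measure "Rplus_power n" for n
  by (rule sigma_finite_Rplus_power)

interpretation Rplus_pair: pair_sigma_finite "Rplus_power a" "Rplus_power b" for a b ..

lemma Rplus_power_extensional: "x \<in> space (Rplus_power n) \<Longrightarrow> n \<le> i \<Longrightarrow> x i = undefined"
  by (auto simp: space_Rplus_power PiE_def extensional_def)

lemma juxt_point [simp]:
  "x \<in> space (Rplus_power n) \<Longrightarrow> y \<in> space (Rplus_power 0) \<Longrightarrow> juxt n x y = x"
  by (auto simp: juxt_def fun_eq_iff Rplus_power_extensional)

lemma measurable_juxt [measurable]: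
  "(\<lambda>(x, y). juxt a x y) \<in> Rplus_power a \<Otimes>\<^sub>M Rplus_power b \<rightarrow>\<^sub>M Rplus_power (a + b)"
  unfolding Rplus_power_def
proof (rule measurable_PiM_single')
  fix i assume i: "i \<in> {..<a + b}"
  show "(\<lambda>p. (case p of (x, y) \<Rightarrow> juxt a x y) i)
      \<in> Pi\<^sub>M {..<a} (\<lambda>_. half_line) \<Otimes>\<^sub>M Pi\<^sub>M {..<b} (\<lambda>_. half_line) \<rightarrow>\<^sub>M half_line"
  proof (cases "i < a")
    case True
    have "(\<lambda>p. (fst p) i) \<in> Pi\<^sub>M {..<a} (\<lambda>_. half_line) \<Otimes>\<^sub>M Pi\<^sub>M {..<b} (\<lambda>_. half_line) \<rightarrow>\<^sub>M half_line"
      by (rule measurable_compose[OF measurable_fst measurable_component_singleton]) (use True in auto)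
    then show ?thesis using True by (simp add: juxt_def case_prod_unfold)
  next
    case False
    have "(\<lambda>p. (snd p) (i - a)) \<in> Pi\<^sub>M {..<a} (\<lambda>_. half_line) \<Otimes>\<^sub>M Pi\<^sub>M {..<b} (\<lambda>_. half_line) \<rightarrow>\<^sub>M half_line"
      by (rule measurable_compose[OF measurable_snd measurable_component_singleton]) (use False i in auto)
    then show ?thesis using False by (simp add: juxt_def case_prod_unfold)
  qed
qed (auto simp: space_pair_measure space_PiM space_restrict_space juxt_def PiE_def extensional_def Pi_def)

lemma juxt_in_space:
  "x \<in> space (Rplus_power a) \<Longrightarrow> y \<in> space (Rplus_power b) \<Longrightarrow> juxt a x y \<in> space (Rplus_power (a + b))"
  using measurable_space[OF measurable_juxt, of "(x, y)" a b] by (simp add: space_pair_measure)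

definition tail_block :: "nat \<Rightarrow> nat \<Rightarrow> (nat \<Rightarrow> 'a) \<Rightarrow> nat \<Rightarrow> 'a" where
  "tail_block a b t = (\<lambda>i\<in>{..<b}. t (a + i))"

lemma measurable_head_block [measurable]:
  "(\<lambda>t. restrict t {..<a}) \<in> Rplus_power (a + b) \<rightarrow>\<^sub>M Rplus_power a"
  unfolding Rplus_power_def by (rule measurable_restrict_subset) auto

lemma measurable_tail_block [measurable]:
  "tail_block a b \<in> Rplus_power (a + b) \<rightarrow>\<^sub>M Rplus_power b"
  unfolding Rplus_power_def tail_block_def
  by (rule measurable_restrict, rule measurable_component_singleton) auto

lemma juxt_blocks:
  "t \<in> space (Rplus_power (a + b)) \<Longrightarrow> juxt a (restrict t {..<a}) (tail_block a b t) = t"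
  by (auto simp: juxt_def tail_block_def fun_eq_iff Rplus_power_extensional)

lemma head_block_juxt: "x \<in> space (Rplus_power a) \<Longrightarrow> restrict (juxt a x y) {..<a} = x"
  by (auto simp: juxt_def fun_eq_iff Rplus_power_extensional)

lemma tail_block_juxt: "y \<in> space (Rplus_power b) \<Longrightarrow> tail_block a b (juxt a x y) = y"
  by (auto simp: juxt_def tail_block_def fun_eq_iff Rplus_power_extensional)

text \<open>This image measure is what turns an integral over points with \<open>a + b\<close> coordinates into a double
  integral over blocks; all later computations with contractions go through it.\<close>

lemma distr_juxt:
  "distr (Rplus_power a \<Otimes>\<^sub>M Rplus_power b) (Rplus_power (a + b)) (\<lambda>(x, y). juxt a x y) =
    Rplus_power (a + b)"
proof -
  have "distr (Rplus_power a \<Otimes>\<^sub>M Rplus_power b) (Rplus_power (a + b)) (\<lambda>(x, y). juxt a x y) =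
      Pi\<^sub>M {..<a + b} (\<lambda>_. half_line)"
  proof (rule half_line.PiM_eqI)
    fix A :: "nat \<Rightarrow> real set"
    assume A: "\<And>i. i \<in> {..<a + b} \<Longrightarrow> A i \<in> sets half_line"
    have A1: "Pi\<^sub>E {..<a} A \<in> sets (Rplus_power a)" and A2: "Pi\<^sub>E {..<b} (\<lambda>i. A (a + i)) \<in> sets (Rplus_power b)"
      and A3: "Pi\<^sub>E {..<a + b} A \<in> sets (Rplus_power (a + b))"
      unfolding Rplus_power_def by (intro sets_PiM_I_finite; use A in auto)+
    have vim: "(\<lambda>(x, y). juxt a x y) -` Pi\<^sub>E {..<a + b} A \<inter> space (Rplus_power a \<Otimes>\<^sub>M Rplus_power b) =
        Pi\<^sub>E {..<a} A \<times> Pi\<^sub>E {..<b} (\<lambda>i. A (a + i))" (is "?L = ?R")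
    proof (intro set_eqI iffI)
      fix p assume "p \<in> ?L"
      then obtain x y where p: "p = (x, y)" and x: "x \<in> space (Rplus_power a)"
        and y: "y \<in> space (Rplus_power b)" and j: "juxt a x y \<in> Pi\<^sub>E {..<a + b} A"
        by (auto simp: space_pair_measure)
      have "x i \<in> A i" if "i < a" for i
        using PiE_mem[OF j, of i] that by (simp add: juxt_def)
      moreover have "y i \<in> A (a + i)" if "i < b" for i
        using PiE_mem[OF j, of "a + i"] that by (simp add: juxt_def)
      ultimately show "p \<in> ?R" using x y p by (auto simp: space_Rplus_power PiE_def)
    next
      fix p assume p: "p \<in> ?R"
      then have "p \<in> space (Rplus_power a) \<times> space (Rplus_power b)"
        using sets.sets_into_space[OF A1] sets.sets_into_space[OF A2] by auto
      with p show "p \<in> ?L"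
        by (auto simp: space_pair_measure juxt_def PiE_def Pi_def extensional_def)
           (metis add_diff_inverse_nat nat_add_left_cancel_less)
    qed
    have "emeasure (distr (Rplus_power a \<Otimes>\<^sub>M Rplus_power b) (Rplus_power (a + b)) (\<lambda>(x, y). juxt a x y))
        (Pi\<^sub>E {..<a + b} A) = emeasure (Rplus_power a) (Pi\<^sub>E {..<a} A) * emeasure (Rplus_power b) (Pi\<^sub>E {..<b} (\<lambda>i. A (a + i)))"
      by (simp only: emeasure_distr[OF measurable_juxt A3] vim Rplus_power.emeasure_pair_measure_Times[OF A1 A2])
    also have "\<dots> = (\<Prod>i<a. emeasure half_line (A i)) * (\<Prod>i<b. emeasure half_line (A (a + i)))"
      unfolding Rplus_power_def using A by (subst (1 2) half_line.emeasure_PiM) auto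
    also have "\<dots> = (\<Prod>i<a + b. emeasure half_line (A i))"
      by (induction b) (simp_all add: mult.assoc[symmetric])
    finally show "emeasure (distr (Rplus_power a \<Otimes>\<^sub>M Rplus_power b) (Rplus_power (a + b)) (\<lambda>(x, y). juxt a x y))
        (Pi\<^sub>E {..<a + b} A) = (\<Prod>i<a + b. emeasure half_line (A i))" .
  qed (auto simp: Rplus_power_def)
  then show ?thesis by (simp add: Rplus_power_def)
qed

text \<open>Cutting a point into two blocks is measurable and inverts joining them. So each of the two
  measures is an image of the other, and null sets correspond.\<close>

lemma AE_juxt:
  "(AE t in Rplus_power (a + b). P t) \<longleftrightarrow>
    (AE p in Rplus_power a \<Otimes>\<^sub>M Rplus_power b. P (juxt a (fst p) (snd p)))"
proof
  assume "AE t in Rplus_power (a + b). P t"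
  then have "AE t in distr (Rplus_power a \<Otimes>\<^sub>M Rplus_power b) (Rplus_power (a + b)) (\<lambda>(x, y). juxt a x y). P t"
    by (simp only: distr_juxt)
  from AE_distrD[OF measurable_juxt this]
  show "AE p in Rplus_power a \<Otimes>\<^sub>M Rplus_power b. P (juxt a (fst p) (snd p))"
    by (simp add: case_prod_unfold)
next
  assume *: "AE p in Rplus_power a \<Otimes>\<^sub>M Rplus_power b. P (juxt a (fst p) (snd p))"
  let ?s = "\<lambda>t. (restrict t {..<a}, tail_block a b t)"
  have [measurable]: "?s \<in> Rplus_power (a + b) \<rightarrow>\<^sub>M Rplus_power a \<Otimes>\<^sub>M Rplus_power b" by measurable
  \<comment> \<open>Splitting inverts joining, so the product measure is also an image of the joined one.\<close>
  have "distr (Rplus_power (a + b)) (Rplus_power a \<Otimes>\<^sub>M Rplus_power b) ?s =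
      distr (Rplus_power a \<Otimes>\<^sub>M Rplus_power b) (Rplus_power a \<Otimes>\<^sub>M Rplus_power b) (?s \<circ> (\<lambda>(x, y). juxt a x y))"
    by (subst distr_juxt[symmetric], subst distr_distr) auto
  also have "\<dots> = distr (Rplus_power a \<Otimes>\<^sub>M Rplus_power b) (Rplus_power a \<Otimes>\<^sub>M Rplus_power b) (\<lambda>p. p)"
    by (rule distr_cong) (auto simp: space_pair_measure head_block_juxt tail_block_juxt)
  also have "\<dots> = Rplus_power a \<Otimes>\<^sub>M Rplus_power b" by (rule distr_id2) simp
  finally have eq: "distr (Rplus_power (a + b)) (Rplus_power a \<Otimes>\<^sub>M Rplus_power b) ?s =
    Rplus_power a \<Otimes>\<^sub>M Rplus_power b" .
  have "AE p in distr (Rplus_power (a + b)) (Rplus_power a \<Otimes>\<^sub>M Rplus_power b) ?s. P (juxt a (fst p) (snd p))"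
    unfolding eq by (rule *)
  from AE_distrD[OF _ this]
  have "AE t in Rplus_power (a + b). P (juxt a (restrict t {..<a}) (tail_block a b t))" by simp
  then show "AE t in Rplus_power (a + b). P t"
    by (rule AE_mp) (auto intro!: AE_I2 simp: juxt_blocks)
qed

lemma nn_integral_juxt:
  assumes [measurable]: "f \<in> borel_measurable (Rplus_power (a + b))"
  shows "(\<integral>\<^sup>+t. f t \<partial>Rplus_power (a + b)) =
    (\<integral>\<^sup>+x. \<integral>\<^sup>+y. f (juxt a x y) \<partial>Rplus_power b \<partial>Rplus_power a)"
  using nn_integral_distr[OF measurable_juxt, of f a b, unfolded distr_juxt]
    Rplus_power.nn_integral_fst[of "\<lambda>(x, y). f (juxt a x y)" "Rplus_power a" b]
  by (simp add: case_prod_unfold)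

lemma integral_juxt:
  fixes f :: "(nat \<Rightarrow> real) \<Rightarrow> complex"
  assumes [measurable]: "f \<in> borel_measurable (Rplus_power (a + b))"
  shows "(\<integral>t. f t \<partial>Rplus_power (a + b)) =
    (\<integral>p. f (juxt a (fst p) (snd p)) \<partial>(Rplus_power a \<Otimes>\<^sub>M Rplus_power b))"
  using integral_distr[OF measurable_juxt, of f a b, unfolded distr_juxt] by (simp add: case_prod_unfold)

lemma flip_flip: "s \<in> space (Rplus_power p) \<Longrightarrow> flip p (flip p s) = s"
  by (auto simp: flip_def fun_eq_iff Rplus_power_extensional)

lemma flip_juxt:
  "x \<in> space (Rplus_power a) \<Longrightarrow> y \<in> space (Rplus_power b) \<Longrightarrow>
    flip (a + b) (juxt a x y) = juxt b (flip b y) (flip a x)"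
  by (auto simp: flip_def juxt_def fun_eq_iff Rplus_power_extensional)

lemma measurable_flip [measurable]: "flip p \<in> Rplus_power p \<rightarrow>\<^sub>M Rplus_power p"
  unfolding Rplus_power_def flip_def
  by (rule measurable_restrict, rule measurable_component_singleton) auto

lemma flip_in_space: "s \<in> space (Rplus_power p) \<Longrightarrow> flip p s \<in> space (Rplus_power p)"
  by (rule measurable_space[OF measurable_flip])

lemma distr_flip: "distr (Rplus_power p) (Rplus_power p) (flip p) = Rplus_power p"
proof -
  have "distr (Rplus_power p) (Rplus_power p) (flip p) = Pi\<^sub>M {..<p} (\<lambda>_. half_line)"
  proof (rule half_line.PiM_eqI)
    fix A :: "nat \<Rightarrow> real set"
    assume A: "\<And>i. i \<in> {..<p} \<Longrightarrow> A i \<in> sets half_line"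
    have S: "Pi\<^sub>E {..<p} A \<in> sets (Rplus_power p)"
      unfolding Rplus_power_def by (intro sets_PiM_I_finite; use A in auto)+
    have vim: "flip p -` Pi\<^sub>E {..<p} A \<inter> space (Rplus_power p) = Pi\<^sub>E {..<p} (\<lambda>i. A (p - 1 - i))" (is "?L = ?R")
    proof (intro set_eqI iffI)
      fix t assume "t \<in> ?L"
      then have t: "t \<in> space (Rplus_power p)" and m: "flip p t \<in> Pi\<^sub>E {..<p} A" by auto
      have "t i \<in> A (p - 1 - i)" if "i < p" for i
        using PiE_mem[OF m, of "p - 1 - i"] that by (simp add: flip_def)
      then show "t \<in> ?R" using t by (auto simp: space_Rplus_power PiE_def)
    next
      fix t assume t: "t \<in> ?R"
      have "t i \<in> {0..}" if "i < p" for i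
        using PiE_mem[OF t, of i] sets.sets_into_space[OF A[of "p - 1 - i"]] that
        by (auto simp: space_restrict_space)
      moreover have "t (p - 1 - i) \<in> A i" if "i < p" for i
        using PiE_mem[OF t, of "p - 1 - i"] that by simp
      ultimately show "t \<in> ?L" using t by (auto simp: space_Rplus_power PiE_def flip_def)
    qed
    have "emeasure (distr (Rplus_power p) (Rplus_power p) (flip p)) (Pi\<^sub>E {..<p} A) =
        emeasure (Rplus_power p) (Pi\<^sub>E {..<p} (\<lambda>i. A (p - 1 - i)))"
      by (simp only: emeasure_distr[OF measurable_flip S] vim)
    also have "\<dots> = (\<Prod>i<p. emeasure half_line (A (p - 1 - i)))"
      unfolding Rplus_power_def using A by (subst half_line.emeasure_PiM) auto
    also have "\<dots> = (\<Prod>i<p. emeasure half_line (A i))"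
      using prod.nat_diff_reindex[of "\<lambda>i. emeasure half_line (A i)" p] by simp
    finally show "emeasure (distr (Rplus_power p) (Rplus_power p) (flip p)) (Pi\<^sub>E {..<p} A) =
        (\<Prod>i<p. emeasure half_line (A i))" .
  qed (auto simp: Rplus_power_def)
  then show ?thesis by (simp add: Rplus_power_def)
qed

lemma AE_flip: "(AE t in Rplus_power p. P (flip p t)) \<longleftrightarrow> (AE t in Rplus_power p. P t)"
proof -
  have *: "AE t in Rplus_power p. Q (flip p t)" if "AE t in Rplus_power p. Q t" for Q
    by (rule AE_distrD[OF measurable_flip[of p], unfolded distr_flip, OF that])
  have "AE t in Rplus_power p. P t" if "AE t in Rplus_power p. P (flip p t)"
    using *[OF that] by (rule AE_mp) (auto intro!: AE_I2 simp: flip_flip)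
  with * show ?thesis by blast
qed

lemma nn_integral_flip:
  "f \<in> borel_measurable (Rplus_power p) \<Longrightarrow>
    (\<integral>\<^sup>+t. f (flip p t) \<partial>Rplus_power p) = (\<integral>\<^sup>+t. f t \<partial>Rplus_power p)"
  using nn_integral_distr[OF measurable_flip, of f p] by (simp add: distr_flip)

section \<open>Square integrals of kernels\<close>

text \<open>The value lies in \<^typ>\<open>ennreal\<close>, so that Tonelli's theorem applies before finiteness is known.\<close>

definition square_integral :: "nat \<Rightarrow> kernel \<Rightarrow> ennreal" where
  "square_integral n f = (\<integral>\<^sup>+t. ennreal ((cmod (f t))\<^sup>2) \<partial>Rplus_power n)"

lemma L2_kernel_iff:
  "L2_kernel n f \<longleftrightarrow> f \<in> borel_measurable (Rplus_power n) \<and> square_integral n f < \<infinity>"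
  unfolding L2_kernel_def square_integral_def by (auto simp: integrable_iff_bounded)

lemma L2_kernel_measurable: "L2_kernel n f \<Longrightarrow> f \<in> borel_measurable (Rplus_power n)"
  by (simp add: L2_kernel_def)

lemma nn_integral_point: "(\<integral>\<^sup>+s. f s \<partial>Rplus_power 0) = f (\<lambda>_. undefined)"
  by (simp add: Rplus_power_def PiM_empty nn_integral_count_space_finite)

lemma integral_point:
  fixes f :: "(nat \<Rightarrow> real) \<Rightarrow> complex"
  shows "(\<integral>s. f s \<partial>Rplus_power 0) = f (\<lambda>_. undefined)"
  by (simp add: Rplus_power_def PiM_empty lebesgue_integral_count_space_finite)

lemma point_in_space [simp]: "(\<lambda>_. undefined) \<in> space (Rplus_power 0)"
  by (simp add: Rplus_power_def)

lemma space_point: "t \<in> space (Rplus_power 0) \<longleftrightarrow> t = (\<lambda>_. undefined)"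
  by (simp add: Rplus_power_def space_PiM_empty)

lemma measurable_juxt' [measurable (raw)]:
  assumes "f \<in> M \<rightarrow>\<^sub>M Rplus_power a" "g \<in> M \<rightarrow>\<^sub>M Rplus_power b"
  shows "(\<lambda>\<omega>. juxt a (f \<omega>) (g \<omega>)) \<in> M \<rightarrow>\<^sub>M Rplus_power (a + b)"
  using measurable_compose[OF measurable_Pair[OF assms] measurable_juxt] by simp

lemma measurable_juxt_eq:
  assumes "n = a + b" "f \<in> M \<rightarrow>\<^sub>M Rplus_power a" "g \<in> M \<rightarrow>\<^sub>M Rplus_power b"
  shows "(\<lambda>\<omega>. juxt a (f \<omega>) (g \<omega>)) \<in> M \<rightarrow>\<^sub>M Rplus_power n"
  using measurable_juxt'[OF assms(2,3)] assms(1) by simp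

section \<open>Almost everywhere statements on blocks\<close>

text \<open>A statement that holds for almost every point holds for almost every choice of its blocks, with
  the blocks quantified in either order. The converse needs a measurable statement.\<close>

lemma AE_juxt_fst:
  assumes "AE t in Rplus_power (a + b). P t"
  shows "AE x in Rplus_power a. AE y in Rplus_power b. P (juxt a x y)"
  using Rplus_pair.AE_pair[OF assms[unfolded AE_juxt]] by simp

lemma AE_juxt_snd:
  assumes "AE t in Rplus_power (a + b). P t"
  shows "AE y in Rplus_power b. AE x in Rplus_power a. P (juxt a x y)"
proof -
  have "AE p in distr (Rplus_power b \<Otimes>\<^sub>M Rplus_power a) (Rplus_power a \<Otimes>\<^sub>M Rplus_power b) (\<lambda>(x, y). (y, x)).
      P (juxt a (fst p) (snd p))"
    using assms unfolding AE_juxt by (simp only: Rplus_pair.distr_pair_swap[of a b, symmetric])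
  from AE_distrD[OF measurable_pair_swap' this]
  have "AE q in Rplus_power b \<Otimes>\<^sub>M Rplus_power a. P (juxt a (snd q) (fst q))"
    by (simp add: case_prod_unfold)
  from Rplus_pair.AE_pair[OF this] show ?thesis by simp
qed

lemma AE_juxtI_fst:
  assumes "{t \<in> space (Rplus_power (a + b)). P t} \<in> sets (Rplus_power (a + b))"
    and "AE x in Rplus_power a. AE y in Rplus_power b. P (juxt a x y)"
  shows "AE t in Rplus_power (a + b). P t"
proof -
  have "{p \<in> space (Rplus_power a \<Otimes>\<^sub>M Rplus_power b). P (juxt a (fst p) (snd p))} =
      (\<lambda>(x, y). juxt a x y) -` {t \<in> space (Rplus_power (a + b)). P t} \<inter>
        space (Rplus_power a \<Otimes>\<^sub>M Rplus_power b)"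
    by (auto simp: space_pair_measure juxt_in_space)
  also have "\<dots> \<in> sets (Rplus_power a \<Otimes>\<^sub>M Rplus_power b)"
    by (rule measurable_sets[OF measurable_juxt assms(1)])
  finally show ?thesis
    unfolding AE_juxt using assms(2) by (intro Rplus_pair.AE_pair_measure) simp_all
qed

lemma AE_juxtI_snd:
  assumes meas: "{t \<in> space (Rplus_power (a + b)). P t} \<in> sets (Rplus_power (a + b))"
    and "AE y in Rplus_power b. AE x in Rplus_power a. P (juxt a x y)"
  shows "AE t in Rplus_power (a + b). P t"
proof (rule AE_juxtI_fst[OF meas])
  have "{p \<in> space (Rplus_power a \<Otimes>\<^sub>M Rplus_power b). P (juxt a (fst p) (snd p))} =
      (\<lambda>(x, y). juxt a x y) -` {t \<in> space (Rplus_power (a + b)). P t} \<inter>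
        space (Rplus_power a \<Otimes>\<^sub>M Rplus_power b)"
    by (auto simp: space_pair_measure juxt_in_space)
  also have "\<dots> \<in> sets (Rplus_power a \<Otimes>\<^sub>M Rplus_power b)"
    by (rule measurable_sets[OF measurable_juxt meas])
  finally show "AE x in Rplus_power a. AE y in Rplus_power b. P (juxt a x y)"
    using assms(2) by (subst Rplus_pair.AE_commute)
qed

section \<open>Contractions\<close>

text \<open>With the free arguments split into those of \<open>f\<close> and those of \<open>g\<close>, the contraction is a plain
  composition of kernels, and the index arithmetic of its definition disappears.\<close>

lemma contraction_juxt:
  assumes "p \<le> n" "p \<le> m" "x \<in> space (Rplus_power (n - p))" "y \<in> space (Rplus_power (m - p))"
  shows "contraction n m p f g (juxt (n - p) x y) =
    (\<integral>s. f (juxt (n - p) x s) * g (juxt p (flip p s) y) \<partial>Rplus_power p)"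
  unfolding contraction_def
proof (rule Bochner_Integration.integral_cong)
  fix s assume s: "s \<in> space (Rplus_power p)"
  have "(\<lambda>i\<in>{..<n}. if i < n - p then juxt (n - p) x y i else s (i - (n - p))) = juxt (n - p) x s"
    using assms s by (auto simp: fun_eq_iff juxt_def Rplus_power_extensional)
  moreover have "(\<lambda>i\<in>{..<m}. if i < p then s (p - 1 - i) else juxt (n - p) x y (n - p + (i - p))) =
      juxt p (flip p s) y"
    using assms s by (auto simp: fun_eq_iff juxt_def flip_def Rplus_power_extensional)
  ultimately show "f (\<lambda>i\<in>{..<n}. if i < n - p then juxt (n - p) x y i else s (i - (n - p))) *
      g (\<lambda>i\<in>{..<m}. if i < p then s (p - 1 - i) else juxt (n - p) x y (n - p + (i - p))) =
      f (juxt (n - p) x s) * g (juxt p (flip p s) y)" by simp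
qed simp

lemma contraction_order: "p \<le> n \<Longrightarrow> p \<le> m \<Longrightarrow> n + m - 2 * p = (n - p) + (m - (p::nat))"
  by simp

lemma measurable_contraction:
  assumes "p \<le> n" "p \<le> m"
    and [measurable]: "f \<in> borel_measurable (Rplus_power n)" "g \<in> borel_measurable (Rplus_power m)"
  shows "contraction n m p f g \<in> borel_measurable (Rplus_power (n + m - 2 * p))"
proof -
  let ?C = "\<lambda>q. \<integral>s. f (juxt (n - p) (fst q) s) * g (juxt p (flip p s) (snd q)) \<partial>Rplus_power p"
  have [measurable]: "(\<lambda>w. juxt (n - p) (fst (fst w)) (snd w))
      \<in> (Rplus_power (n - p) \<Otimes>\<^sub>M Rplus_power (m - p)) \<Otimes>\<^sub>M Rplus_power p \<rightarrow>\<^sub>M Rplus_power n"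
    "(\<lambda>w. juxt p (flip p (snd w)) (snd (fst w)))
      \<in> (Rplus_power (n - p) \<Otimes>\<^sub>M Rplus_power (m - p)) \<Otimes>\<^sub>M Rplus_power p \<rightarrow>\<^sub>M Rplus_power m"
    using assms(1,2) by (intro measurable_juxt_eq[where b = p] measurable_juxt_eq[where b = "m - p"]; measurable; simp)+
  have C: "?C \<in> borel_measurable (Rplus_power (n - p) \<Otimes>\<^sub>M Rplus_power (m - p))"
    by (rule Rplus_power.borel_measurable_lebesgue_integral) (simp add: case_prod_unfold)
  have "(\<lambda>t. ?C (restrict t {..<n - p}, tail_block (n - p) (m - p) t))
      \<in> borel_measurable (Rplus_power ((n - p) + (m - p)))"
    by (rule measurable_compose[OF _ C]) measurable
  moreover have "?C (restrict t {..<n - p}, tail_block (n - p) (m - p) t) = contraction n m p f g t"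
    if t: "t \<in> space (Rplus_power ((n - p) + (m - p)))" for t
    using contraction_juxt[OF assms(1,2), of "restrict t {..<n - p}" "tail_block (n - p) (m - p) t" f g]
      measurable_space[OF measurable_head_block t] measurable_space[OF measurable_tail_block t]
      juxt_blocks[OF t] by simp
  ultimately show ?thesis
    unfolding contraction_order[OF assms(1,2)] by (simp cong: measurable_cong)
qed

lemma sets_contraction_zero:
  assumes "p \<le> n" "p \<le> m"
    and meas: "f \<in> borel_measurable (Rplus_power n)" "g \<in> borel_measurable (Rplus_power m)"
  shows "{t \<in> space (Rplus_power (n + m - 2 * p)). contraction n m p f g t = 0}
    \<in> sets (Rplus_power (n + m - 2 * p))"
  using measurable_contraction[OF assms] by measurable

text \<open>Both block integrals below are square integrals in disguise: they are taken over the blocks of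
  \<open>f\<close> and of \<open>g\<close>, and reversing the contracted block preserves the measure.\<close>

lemma square_integral_blocks:
  assumes "p \<le> n" "p \<le> m"
    and [measurable]: "f \<in> borel_measurable (Rplus_power n)" "g \<in> borel_measurable (Rplus_power m)"
  shows "(\<integral>\<^sup>+x. \<integral>\<^sup>+s. ennreal ((cmod (f (juxt (n - p) x s)))\<^sup>2) \<partial>Rplus_power p \<partial>Rplus_power (n - p)) =
      square_integral n f"
    and "(\<integral>\<^sup>+y. \<integral>\<^sup>+s. ennreal ((cmod (g (juxt p (flip p s) y)))\<^sup>2) \<partial>Rplus_power p \<partial>Rplus_power (m - p)) =
      square_integral m g"
proof -
  show "(\<integral>\<^sup>+x. \<integral>\<^sup>+s. ennreal ((cmod (f (juxt (n - p) x s)))\<^sup>2) \<partial>Rplus_power p \<partial>Rplus_power (n - p)) =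
      square_integral n f"
    using nn_integral_juxt[of "\<lambda>t. ennreal ((cmod (f t))\<^sup>2)" "n - p" p] assms
    by (simp add: square_integral_def)
  have [measurable]: "(\<lambda>(s, y). juxt p s y) \<in> Rplus_power p \<Otimes>\<^sub>M Rplus_power (m - p) \<rightarrow>\<^sub>M Rplus_power m"
    using measurable_juxt[of p "m - p"] assms(2) by simp
  have "(\<integral>\<^sup>+s. ennreal ((cmod (g (juxt p (flip p s) y)))\<^sup>2) \<partial>Rplus_power p) =
      (\<integral>\<^sup>+s. ennreal ((cmod (g (juxt p s y)))\<^sup>2) \<partial>Rplus_power p)"
    if "y \<in> space (Rplus_power (m - p))" for y
  proof (rule nn_integral_flip)
    have "(\<lambda>s. (s, y)) \<in> Rplus_power p \<rightarrow>\<^sub>M Rplus_power p \<Otimes>\<^sub>M Rplus_power (m - p)"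
      using that by measurable
    then show "(\<lambda>s. ennreal ((cmod (g (juxt p s y)))\<^sup>2)) \<in> borel_measurable (Rplus_power p)"
      by (rule measurable_compose[where f = "\<lambda>s. (s, y)" and g = "\<lambda>(s, y). ennreal ((cmod (g (juxt p s y)))\<^sup>2)", simplified])
        measurable
  qed
  then have "(\<integral>\<^sup>+y. \<integral>\<^sup>+s. ennreal ((cmod (g (juxt p (flip p s) y)))\<^sup>2) \<partial>Rplus_power p \<partial>Rplus_power (m - p)) =
      (\<integral>\<^sup>+y. \<integral>\<^sup>+s. ennreal ((cmod (g (juxt p s y)))\<^sup>2) \<partial>Rplus_power p \<partial>Rplus_power (m - p))"
    by (rule nn_integral_cong)
  also have "\<dots> = (\<integral>\<^sup>+s. \<integral>\<^sup>+y. ennreal ((cmod (g (juxt p s y)))\<^sup>2) \<partial>Rplus_power (m - p) \<partial>Rplus_power p)"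
    by (rule Rplus_pair.Fubini') measurable
  also have "\<dots> = square_integral m g"
    using nn_integral_juxt[of "\<lambda>t. ennreal ((cmod (g t))\<^sup>2)" p "m - p"] assms
    by (simp add: square_integral_def)
  finally show "(\<integral>\<^sup>+y. \<integral>\<^sup>+s. ennreal ((cmod (g (juxt p (flip p s) y)))\<^sup>2) \<partial>Rplus_power p \<partial>Rplus_power (m - p)) =
      square_integral m g" .
qed

lemma square_integral_contraction_blocks:
  assumes "p \<le> n" "p \<le> m"
    and meas: "f \<in> borel_measurable (Rplus_power n)" "g \<in> borel_measurable (Rplus_power m)"
  shows "square_integral (n + m - 2 * p) (contraction n m p f g) =
    (\<integral>\<^sup>+x. \<integral>\<^sup>+y. ennreal ((cmod (\<integral>s. f (juxt (n - p) x s) * g (juxt p (flip p s) y) \<partial>Rplus_power p))\<^sup>2)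
      \<partial>Rplus_power (m - p) \<partial>Rplus_power (n - p))"
proof -
  have "contraction n m p f g \<in> borel_measurable (Rplus_power ((n - p) + (m - p)))"
    using measurable_contraction[OF assms] unfolding contraction_order[OF assms(1,2)] .
  then show ?thesis
    unfolding square_integral_def contraction_order[OF assms(1,2)]
    by (subst nn_integral_juxt) (auto intro!: nn_integral_cong simp: contraction_juxt[OF assms(1,2)])
qed

lemma measurable_slices:
  assumes "p \<le> n" "p \<le> m"
    and [measurable]: "f \<in> borel_measurable (Rplus_power n)" "g \<in> borel_measurable (Rplus_power m)"
  shows "x \<in> space (Rplus_power (n - p)) \<Longrightarrow> (\<lambda>s. f (juxt (n - p) x s)) \<in> borel_measurable (Rplus_power p)"
    and "y \<in> space (Rplus_power (m - p)) \<Longrightarrow> (\<lambda>s. g (juxt p (flip p s) y)) \<in> borel_measurable (Rplus_power p)"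
proof -
  assume x: "x \<in> space (Rplus_power (n - p))"
  have "(\<lambda>s. juxt (n - p) x s) \<in> Rplus_power p \<rightarrow>\<^sub>M Rplus_power n"
    by (rule measurable_juxt_eq[where b = p]) (use assms(1) x in simp_all)
  then show "(\<lambda>s. f (juxt (n - p) x s)) \<in> borel_measurable (Rplus_power p)" by measurable
next
  assume y: "y \<in> space (Rplus_power (m - p))"
  have "(\<lambda>s. juxt p (flip p s) y) \<in> Rplus_power p \<rightarrow>\<^sub>M Rplus_power m"
    by (rule measurable_juxt_eq[where b = "m - p"]) (use assms(2) y measurable_flip in simp_all)
  then show "(\<lambda>s. g (juxt p (flip p s) y)) \<in> borel_measurable (Rplus_power p)" by measurable
qed

text \<open>The Cauchy--Schwarz inequality in the contracted block, integrated over the two free blocks,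
  which then separate.\<close>

lemma square_integral_contraction_le:
  assumes "p \<le> n" "p \<le> m"
    and [measurable]: "f \<in> borel_measurable (Rplus_power n)" "g \<in> borel_measurable (Rplus_power m)"
  shows "square_integral (n + m - 2 * p) (contraction n m p f g) \<le> square_integral n f * square_integral m g"
proof -
  let ?a = "\<lambda>x. \<integral>\<^sup>+s. ennreal ((cmod (f (juxt (n - p) x s)))\<^sup>2) \<partial>Rplus_power p"
  let ?b = "\<lambda>y. \<integral>\<^sup>+s. ennreal ((cmod (g (juxt p (flip p s) y)))\<^sup>2) \<partial>Rplus_power p"
  have [measurable]: "(\<lambda>(x, s). juxt (n - p) x s) \<in> Rplus_power (n - p) \<Otimes>\<^sub>M Rplus_power p \<rightarrow>\<^sub>M Rplus_power n"
    "(\<lambda>(y, s). juxt p (flip p s) y) \<in> Rplus_power (m - p) \<Otimes>\<^sub>M Rplus_power p \<rightarrow>\<^sub>M Rplus_power m"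
    using assms(1,2) by (auto simp: case_prod_unfold intro!: measurable_juxt_eq)
  have [measurable]: "?a \<in> borel_measurable (Rplus_power (n - p))" "?b \<in> borel_measurable (Rplus_power (m - p))"
    by measurable
  have "square_integral (n + m - 2 * p) (contraction n m p f g) \<le>
      (\<integral>\<^sup>+x. \<integral>\<^sup>+y. ?a x * ?b y \<partial>Rplus_power (m - p) \<partial>Rplus_power (n - p))"
    unfolding square_integral_contraction_blocks[OF assms]
    by (intro nn_integral_mono cmod_integral_mult_le measurable_slices[OF assms])
  also have "\<dots> = (\<integral>\<^sup>+x. ?a x \<partial>Rplus_power (n - p)) * (\<integral>\<^sup>+y. ?b y \<partial>Rplus_power (m - p))"
    by (simp add: nn_integral_cmult nn_integral_multc)
  finally show ?thesis unfolding square_integral_blocks[OF assms] .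
qed

lemma L2_kernel_contraction:
  assumes "L2_kernel n f" "L2_kernel m g" "p \<le> n" "p \<le> m"
  shows "L2_kernel (n + m - 2 * p) (contraction n m p f g)"
proof -
  have "square_integral n f * square_integral m g < \<infinity>"
    using assms(1,2) by (simp add: L2_kernel_iff ennreal_mult_less_top)
  with square_integral_contraction_le[of p n m f g] measurable_contraction[of p n m f g] assms
  show ?thesis by (auto simp: L2_kernel_iff intro: order.strict_trans1)
qed

lemma contraction_0_juxt:
  assumes "x \<in> space (Rplus_power n)" "y \<in> space (Rplus_power m)"
  shows "contraction n m 0 f g (juxt n x y) = f x * g y"
  using contraction_juxt[of 0 n m x y f g] assms by (simp add: integral_point)

text \<open>For \<open>p = 0\<close> the contracted block is a single point and the estimate becomes an equality.\<close>

lemma square_integral_tensor: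
  assumes [measurable]: "f \<in> borel_measurable (Rplus_power n)" "g \<in> borel_measurable (Rplus_power m)"
  shows "square_integral (n + m) (contraction n m 0 f g) = square_integral n f * square_integral m g"
proof -
  have "square_integral (n + m) (contraction n m 0 f g) =
      (\<integral>\<^sup>+x. \<integral>\<^sup>+y. ennreal ((cmod (f x))\<^sup>2) * ennreal ((cmod (g y))\<^sup>2) \<partial>Rplus_power m \<partial>Rplus_power n)"
    using square_integral_contraction_blocks[of 0 n m f g]
    by (auto intro!: nn_integral_cong simp: integral_point norm_mult power_mult_distrib ennreal_mult)
  then show ?thesis
    by (simp add: nn_integral_cmult nn_integral_multc square_integral_def)
qed

section \<open>Kernels all of whose contractions vanish\<close>

text \<open>The vanishing of the first contraction implies that of the others, because the latter are traces
  of the former. But a trace is an integral over a diagonal, on which an identity that holds almost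
  everywhere says nothing directly. Carrying all orders \<open>p\<close> along avoids diagonals altogether.\<close>

definition contractions_vanish :: "nat \<Rightarrow> kernel \<Rightarrow> nat \<Rightarrow> kernel \<Rightarrow> bool" where
  "contractions_vanish n f m g \<longleftrightarrow>
    (\<forall>p. 1 \<le> p \<and> p \<le> n \<and> p \<le> m \<longrightarrow> (AE t in Rplus_power (n + m - 2 * p). contraction n m p f g t = 0))"

text \<open>Symmetry at every point, and not just almost everywhere, allows blocks of arguments to be
  exchanged under an integral sign without exceptional sets.\<close>

definition symmetric_everywhere :: "nat \<Rightarrow> kernel \<Rightarrow> bool" where
  "symmetric_everywhere n f \<longleftrightarrow> (\<forall>t \<in> space (Rplus_power n).
     f t \<in> \<real> \<and> (\<forall>\<sigma>. \<sigma> permutes {..<n} \<longrightarrow> f (t \<circ> \<sigma>) = f t))"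

lemma symmetric_everywhere_swap_blocks:
  assumes f: "symmetric_everywhere n f" and n: "n = c + a + b"
    and x: "x \<in> space (Rplus_power c)" and y: "y \<in> space (Rplus_power a)" and z: "z \<in> space (Rplus_power b)"
  shows "f (juxt c x (juxt b z y)) = f (juxt c x (juxt a y z))"
proof -
  \<comment> \<open>The permutation that moves the block of length \<open>b\<close> behind the one of length \<open>a\<close>.\<close>
  define \<sigma> where "\<sigma> i = (if c \<le> i \<and> i < c + b then i + a
    else if c + b \<le> i \<and> i < c + a + b then i - b else i)" for i
  have "bij_betw \<sigma> {..<n} {..<n}"
    by (rule bij_betw_byWitness[where f' = "\<lambda>i. if c \<le> i \<and> i < c + a then i + b
      else if c + a \<le> i \<and> i < c + a + b then i - a else i"]) (auto simp: \<sigma>_def n)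
  then have \<sigma>: "\<sigma> permutes {..<n}"
    by (rule bij_imp_permutes) (auto simp: \<sigma>_def n)
  have "juxt c x (juxt b z y) = juxt c x (juxt a y z) \<circ> \<sigma>"
    using x y z by (auto simp: fun_eq_iff juxt_def \<sigma>_def Rplus_power_extensional add.commute[of b c])
  moreover have "juxt c x (juxt a y z) \<in> space (Rplus_power n)"
    using juxt_in_space[OF x juxt_in_space[OF y z]] n by (simp add: add.assoc)
  ultimately show ?thesis using f \<sigma> by (simp add: symmetric_everywhere_def)
qed

text \<open>Contracting \<open>f \<frown>\<^sup>r h\<close> with \<open>w\<close> uses up the last arguments of \<open>f \<frown>\<^sup>r h\<close>. If the arguments left over
  from \<open>h\<close> do not suffice, some from \<open>f\<close> are used as well. So the contracted block is \<open>\<alpha> \<beta>\<close> with \<open>\<alpha>\<close> from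
  \<open>f\<close> and \<open>\<beta>\<close> from \<open>h\<close>, and with \<open>z\<close> the block in which \<open>f\<close> and \<open>h\<close> are contracted,
  \<open>f(x, \<alpha>, z) h(z, y, \<beta>) w(\<beta>, \<alpha>, u)\<close> (reversals omitted) is a triple product. If \<open>\<beta>\<close> is not empty,
  integrating over \<open>\<beta>\<close> first gives a contraction of \<open>h\<close> with \<open>w\<close>. Otherwise integrating over \<open>\<alpha>\<close>
  first gives, up to the order of the arguments of \<open>f\<close>, a contraction of \<open>f\<close> with \<open>w\<close>; this is where
  the symmetry of \<open>f\<close> enters.\<close>

lemma contractions_vanish_contraction:
  assumes sym: "symmetric_everywhere n f"
    and f: "L2_kernel n f" and h: "L2_kernel k h" and w: "L2_kernel l w"
    and fw: "contractions_vanish n f l w" and hw: "contractions_vanish k h l w"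
    and r: "r \<le> n" "r \<le> k"
  shows "contractions_vanish (n + k - 2 * r) (contraction n k r f h) l w"
  unfolding contractions_vanish_def
proof (intro allI impI, elim conjE)
  fix p assume p: "1 \<le> p" "p \<le> n + k - 2 * r" "p \<le> l"
  \<comment> \<open>The lengths of the blocks: \<open>b\<close> of the \<open>p\<close> contracted arguments come from \<open>h\<close> and \<open>a\<close> from \<open>f\<close>;
    \<open>X\<close>, \<open>Y\<close> and \<open>U\<close> arguments of \<open>f\<close>, \<open>h\<close> and \<open>w\<close> remain.\<close>
  define b where "b = min p (k - r)"
  define a where "a = p - b"
  define X where "X = n - r - a"
  define Y where "Y = k - r - b"
  define U where "U = l - p"
  have dims: "n = X + a + r" "k = r + (Y + b)" "l = a + b + U" "p = a + b" "a = 0 \<or> Y = 0"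
    "n + k - 2 * r = (X + Y) + (a + b)"
    using p r by (auto simp: a_def b_def X_def Y_def U_def)
  let ?c = "contraction n k r f h"
  note [measurable] = L2_kernel_measurable[OF f] L2_kernel_measurable[OF h] L2_kernel_measurable[OF w]
  have c: "L2_kernel (n + k - 2 * r) ?c" by (rule L2_kernel_contraction; fact)
  note [measurable] = L2_kernel_measurable[OF c]
  define F where "F x \<alpha> z = f (juxt X x (juxt a \<alpha> z))" for x \<alpha> z
  define H where "H y z \<beta> = h (juxt r (flip r z) (juxt Y y \<beta>))" for y z \<beta>
  define W where "W u \<beta> \<alpha> = w (juxt b (flip b \<beta>) (juxt a (flip a \<alpha>) u))" for u \<beta> \<alpha>
  have val_eq: "contraction (n + k - 2 * r) l p ?c w (juxt (X + Y) (juxt X x y) u) =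
      (\<integral>q. (\<integral>z. F x (fst q) z * H y z (snd q) \<partial>Rplus_power r) * W u (snd q) (fst q)
        \<partial>(Rplus_power a \<Otimes>\<^sub>M Rplus_power b))"
    if x: "x \<in> space (Rplus_power X)" and y: "y \<in> space (Rplus_power Y)" and u: "u \<in> space (Rplus_power U)"
    for x y u
  proof -
    have xy: "juxt X x y \<in> space (Rplus_power (X + Y))" by (rule juxt_in_space; fact)
    have "contraction (n + k - 2 * r) l p ?c w (juxt (X + Y) (juxt X x y) u) =
        (\<integral>s. ?c (juxt (X + Y) (juxt X x y) s) * w (juxt (a + b) (flip (a + b) s) u) \<partial>Rplus_power (a + b))"
      using contraction_juxt[of p "n + k - 2 * r" l "juxt X x y" u ?c w] p xy u
      by (simp add: dims)
    also have "\<dots> = (\<integral>q. ?c (juxt (X + Y) (juxt X x y) (juxt a (fst q) (snd q))) *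
        w (juxt (a + b) (flip (a + b) (juxt a (fst q) (snd q))) u) \<partial>(Rplus_power a \<Otimes>\<^sub>M Rplus_power b))"
    proof (rule integral_juxt, rule borel_measurable_times)
      have "n + k - 2 * r - p = X + Y" by (simp add: dims(4,6))
      then show "(\<lambda>s. ?c (juxt (X + Y) (juxt X x y) s)) \<in> borel_measurable (Rplus_power (a + b))"
        using measurable_slices(1)[OF p(2,3), of ?c w "juxt X x y"] xy by (simp flip: dims(4))
      show "(\<lambda>s. w (juxt (a + b) (flip (a + b) s) u)) \<in> borel_measurable (Rplus_power (a + b))"
        using measurable_slices(2)[OF p(2,3), of ?c w u] u by (simp add: U_def flip: dims(4))
    qed
    also have "\<dots> = (\<integral>q. (\<integral>z. F x (fst q) z * H y z (snd q) \<partial>Rplus_power r) * W u (snd q) (fst q)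
        \<partial>(Rplus_power a \<Otimes>\<^sub>M Rplus_power b))"
    proof (rule Bochner_Integration.integral_cong)
      fix q assume "q \<in> space (Rplus_power a \<Otimes>\<^sub>M Rplus_power b)"
      then obtain \<alpha> \<beta> where q: "q = (\<alpha>, \<beta>)" and \<alpha>: "\<alpha> \<in> space (Rplus_power a)"
        and \<beta>: "\<beta> \<in> space (Rplus_power b)" by (auto simp: space_pair_measure)
      \<comment> \<open>One of the two middle blocks is empty, so their order is immaterial.\<close>
      have swap: "juxt (X + Y) (juxt X x y) (juxt a \<alpha> \<beta>) = juxt (X + a) (juxt X x \<alpha>) (juxt Y y \<beta>)"
        using dims(5) x y \<alpha> \<beta> by (auto simp flip: juxt_assoc)
      have "?c (juxt (X + Y) (juxt X x y) (juxt a \<alpha> \<beta>)) =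
          (\<integral>z. F x \<alpha> z * H y z \<beta> \<partial>Rplus_power r)"
        unfolding swap using contraction_juxt[OF r, of "juxt X x \<alpha>" "juxt Y y \<beta>" f h]
          juxt_in_space[OF x \<alpha>] juxt_in_space[OF y \<beta>]
        by (simp add: F_def H_def dims(1,2) flip: juxt_assoc)
      moreover have "w (juxt (a + b) (flip (a + b) (juxt a \<alpha> \<beta>)) u) = W u \<beta> \<alpha>"
        by (simp add: W_def flip_juxt[OF \<alpha> \<beta>] juxt_assoc add.commute)
      ultimately show "?c (juxt (X + Y) (juxt X x y) (juxt a (fst q) (snd q))) *
          w (juxt (a + b) (flip (a + b) (juxt a (fst q) (snd q))) u) =
          (\<integral>z. F x (fst q) z * H y z (snd q) \<partial>Rplus_power r) * W u (snd q) (fst q)"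
        by (simp add: q)
    qed simp
    finally show ?thesis .
  qed
  have Fm: "case_prod (F x) \<in> borel_measurable (Rplus_power a \<Otimes>\<^sub>M Rplus_power r)"
    if x: "x \<in> space (Rplus_power X)" for x
  proof -
    have "(\<lambda>q. juxt X x (juxt a (fst q) (snd q))) \<in> Rplus_power a \<Otimes>\<^sub>M Rplus_power r \<rightarrow>\<^sub>M Rplus_power n"
      by (rule measurable_juxt_eq[where b = "a + r"]) (use x in \<open>simp_all add: dims\<close>)
    then show ?thesis unfolding F_def case_prod_unfold by measurable
  qed
  have Hm: "case_prod (H y) \<in> borel_measurable (Rplus_power r \<Otimes>\<^sub>M Rplus_power b)"
    if y: "y \<in> space (Rplus_power Y)" for y
  proof -
    have "(\<lambda>q. juxt r (flip r (fst q)) (juxt Y y (snd q))) \<in> Rplus_power r \<Otimes>\<^sub>M Rplus_power b \<rightarrow>\<^sub>M Rplus_power k"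
      by (rule measurable_juxt_eq[where b = "Y + b"]) (use y in \<open>simp_all add: dims(2)\<close>)
    then show ?thesis unfolding H_def case_prod_unfold by measurable
  qed
  have Wm: "case_prod (W u) \<in> borel_measurable (Rplus_power b \<Otimes>\<^sub>M Rplus_power a)"
    if u: "u \<in> space (Rplus_power U)" for u
  proof -
    have "(\<lambda>q. juxt b (flip b (fst q)) (juxt a (flip a (snd q)) u)) \<in> Rplus_power b \<Otimes>\<^sub>M Rplus_power a \<rightarrow>\<^sub>M Rplus_power l"
      by (rule measurable_juxt_eq[where b = "a + U"]) (use u in \<open>simp_all add: dims(3)\<close>)
    then show ?thesis unfolding W_def case_prod_unfold by measurable
  qed
  have F2: "AE x in Rplus_power X. (\<integral>\<^sup>+\<alpha>. \<integral>\<^sup>+z. ennreal ((cmod (F x \<alpha> z))\<^sup>2) \<partial>Rplus_power r \<partial>Rplus_power a) < \<infinity>"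
  proof -
    have fX: "(\<lambda>t. ennreal ((cmod (f t))\<^sup>2)) \<in> borel_measurable (Rplus_power (X + (a + r)))"
      using L2_kernel_measurable[OF f] unfolding dims(1) add.assoc by measurable
    have m: "(\<lambda>(x, s). juxt X x s) \<in> Rplus_power X \<Otimes>\<^sub>M Rplus_power (a + r) \<rightarrow>\<^sub>M Rplus_power n"
      using measurable_juxt[of X "a + r"] by (simp add: dims(1) add.assoc)
    note [measurable] = this
    have "(\<integral>\<^sup>+x. \<integral>\<^sup>+s. ennreal ((cmod (f (juxt X x s)))\<^sup>2) \<partial>Rplus_power (a + r) \<partial>Rplus_power X) \<noteq> \<infinity>"
      using f nn_integral_juxt[OF fX]
      by (simp add: L2_kernel_iff square_integral_def dims(1) add.assoc top.not_eq_extremum)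
    then have "AE x in Rplus_power X. (\<integral>\<^sup>+s. ennreal ((cmod (f (juxt X x s)))\<^sup>2) \<partial>Rplus_power (a + r)) \<noteq> \<infinity>"
      by (intro nn_integral_PInf_AE) measurable
    then show ?thesis
    proof (rule AE_mp, intro AE_I2 impI)
      fix x assume x: "x \<in> space (Rplus_power X)"
        and fin: "(\<integral>\<^sup>+s. ennreal ((cmod (f (juxt X x s)))\<^sup>2) \<partial>Rplus_power (a + r)) \<noteq> \<infinity>"
      have "(\<lambda>s. juxt X x s) \<in> Rplus_power (a + r) \<rightarrow>\<^sub>M Rplus_power n"
        by (rule measurable_juxt_eq[where b = "a + r"]) (use x in \<open>simp_all add: dims(1)\<close>)
      then show "(\<integral>\<^sup>+\<alpha>. \<integral>\<^sup>+z. ennreal ((cmod (F x \<alpha> z))\<^sup>2) \<partial>Rplus_power r \<partial>Rplus_power a) < \<infinity>"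
        using fin nn_integral_juxt[of "\<lambda>s. ennreal ((cmod (f (juxt X x s)))\<^sup>2)" a r]
        by (simp add: F_def top.not_eq_extremum)
    qed
  qed
  have H2: "AE y in Rplus_power Y. (\<integral>\<^sup>+\<beta>. \<integral>\<^sup>+z. ennreal ((cmod (H y z \<beta>))\<^sup>2) \<partial>Rplus_power r \<partial>Rplus_power b) < \<infinity>"
  proof -
    define \<Psi> where "\<Psi> v = (\<integral>\<^sup>+z. ennreal ((cmod (h (juxt r (flip r z) v)))\<^sup>2) \<partial>Rplus_power r)" for v
    have [measurable]: "(\<lambda>q. juxt r (flip r (snd q)) (fst q)) \<in> Rplus_power (Y + b) \<Otimes>\<^sub>M Rplus_power r \<rightarrow>\<^sub>M Rplus_power k"
      by (rule measurable_juxt_eq[where b = "Y + b"]) (simp_all add: dims(2))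
    have \<Psi>[measurable]: "\<Psi> \<in> borel_measurable (Rplus_power (Y + b))" unfolding \<Psi>_def
      by (rule Rplus_power.borel_measurable_nn_integral) (simp add: case_prod_unfold)
    have "(\<integral>\<^sup>+v. \<Psi> v \<partial>Rplus_power (Y + b)) \<noteq> \<infinity>"
      using square_integral_blocks(2)[OF r, of f h] h by (simp add: L2_kernel_iff \<Psi>_def dims(2) top.not_eq_extremum)
    then have "(\<integral>\<^sup>+y. \<integral>\<^sup>+\<beta>. \<Psi> (juxt Y y \<beta>) \<partial>Rplus_power b \<partial>Rplus_power Y) \<noteq> \<infinity>"
      by (simp add: nn_integral_juxt)
    then have "AE y in Rplus_power Y. (\<integral>\<^sup>+\<beta>. \<Psi> (juxt Y y \<beta>) \<partial>Rplus_power b) \<noteq> \<infinity>"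
      by (intro nn_integral_PInf_AE) measurable
    then show ?thesis by (simp add: \<Psi>_def H_def top.not_eq_extremum)
  qed
  have W2: "AE u in Rplus_power U. (\<integral>\<^sup>+\<alpha>. \<integral>\<^sup>+\<beta>. ennreal ((cmod (W u \<beta> \<alpha>))\<^sup>2) \<partial>Rplus_power b \<partial>Rplus_power a) < \<infinity>"
  proof -
    have [measurable]: "(\<lambda>q. juxt p (flip p (snd q)) (fst q)) \<in> Rplus_power U \<Otimes>\<^sub>M Rplus_power p \<rightarrow>\<^sub>M Rplus_power l"
      by (rule measurable_juxt_eq[where b = U]) (simp_all add: dims(3,4))
    have wm: "(\<lambda>u. \<integral>\<^sup>+s. ennreal ((cmod (w (juxt p (flip p s) u)))\<^sup>2) \<partial>Rplus_power p) \<in> borel_measurable (Rplus_power U)"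
      by (rule Rplus_power.borel_measurable_nn_integral) (simp add: case_prod_unfold)
    have "(\<integral>\<^sup>+u. \<integral>\<^sup>+s. ennreal ((cmod (w (juxt p (flip p s) u)))\<^sup>2) \<partial>Rplus_power p \<partial>Rplus_power U) \<noteq> \<infinity>"
      using square_integral_blocks(2)[OF p(2,3), of ?c w] w by (simp add: L2_kernel_iff U_def top.not_eq_extremum)
    then have "AE u in Rplus_power U. (\<integral>\<^sup>+s. ennreal ((cmod (w (juxt p (flip p s) u)))\<^sup>2) \<partial>Rplus_power p) \<noteq> \<infinity>"
      by (rule nn_integral_PInf_AE[OF wm])
    then show ?thesis
    proof (rule AE_mp, intro AE_I2 impI)
      fix u assume u: "u \<in> space (Rplus_power U)"
        and fin: "(\<integral>\<^sup>+s. ennreal ((cmod (w (juxt p (flip p s) u)))\<^sup>2) \<partial>Rplus_power p) \<noteq> \<infinity>"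
      have m: "(\<lambda>s. ennreal ((cmod (w (juxt (a + b) (flip (a + b) s) u)))\<^sup>2)) \<in> borel_measurable (Rplus_power (a + b))"
        using measurable_slices(2)[OF p(2,3) L2_kernel_measurable[OF c] L2_kernel_measurable[OF w]] u
        unfolding U_def dims(4)[symmetric] by measurable
      have "(\<integral>\<^sup>+\<alpha>. \<integral>\<^sup>+\<beta>. ennreal ((cmod (W u \<beta> \<alpha>))\<^sup>2) \<partial>Rplus_power b \<partial>Rplus_power a) =
          (\<integral>\<^sup>+\<alpha>. \<integral>\<^sup>+\<beta>. ennreal ((cmod (w (juxt (a + b) (flip (a + b) (juxt a \<alpha> \<beta>)) u)))\<^sup>2) \<partial>Rplus_power b \<partial>Rplus_power a)"
        by (intro nn_integral_cong) (simp add: W_def flip_juxt juxt_assoc add.commute)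
      also have "\<dots> < \<infinity>"
        using fin nn_integral_juxt[OF m] by (simp add: dims(4) top.not_eq_extremum)
      finally show "(\<integral>\<^sup>+\<alpha>. \<integral>\<^sup>+\<beta>. ennreal ((cmod (W u \<beta> \<alpha>))\<^sup>2) \<partial>Rplus_power b \<partial>Rplus_power a) < \<infinity>" .
    qed
  qed
  have zero: "AE u in Rplus_power U. AE x in Rplus_power X. AE y in Rplus_power Y.
      (AE \<alpha> in Rplus_power a. AE z in Rplus_power r. (\<integral>\<beta>. H y z \<beta> * W u \<beta> \<alpha> \<partial>Rplus_power b) = 0) \<or>
      (AE z in Rplus_power r. AE \<beta> in Rplus_power b. (\<integral>\<alpha>. F x \<alpha> z * W u \<beta> \<alpha> \<partial>Rplus_power a) = 0)"
  proof (cases "b = 0")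
    case False
    have "AE t in Rplus_power ((r + (Y + a)) + U). contraction k l b h w t = 0"
    proof -
      have eq: "k + l - 2 * b = (r + (Y + a)) + U" by (simp add: dims(2,3))
      have "1 \<le> b \<and> b \<le> k \<and> b \<le> l" using False by (simp add: dims(2,3))
      then show ?thesis unfolding eq[symmetric] using hw by (auto simp: contractions_vanish_def)
    qed
    from AE_juxt_snd[OF this]
    have "AE u in Rplus_power U. AE y in Rplus_power Y. AE \<alpha> in Rplus_power a. AE z in Rplus_power r.
        contraction k l b h w (juxt (r + (Y + a)) (juxt r (flip r z) (juxt Y y (flip a \<alpha>))) u) = 0"
    proof eventually_elim
      case (elim u)
      from AE_juxt_fst[OF AE_juxt_snd[OF this]] show ?case
      proof eventually_elim
        case (elim y)
        then have "AE \<alpha> in Rplus_power a. AE z in Rplus_power r.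
          contraction k l b h w (juxt (r + (Y + a)) (juxt r z (juxt Y y (flip a \<alpha>))) u) = 0"
          by (subst AE_flip)
        then show ?case by eventually_elim (subst AE_flip)
      qed
    qed
    moreover have "contraction k l b h w (juxt (r + (Y + a)) (juxt r (flip r z) (juxt Y y (flip a \<alpha>))) u) =
        (\<integral>\<beta>. H y z \<beta> * W u \<beta> \<alpha> \<partial>Rplus_power b)"
      if "u \<in> space (Rplus_power U)" "y \<in> space (Rplus_power Y)" "\<alpha> \<in> space (Rplus_power a)" "z \<in> space (Rplus_power r)"
      for u y \<alpha> z
      using contraction_juxt[of b k l "juxt r (flip r z) y" "juxt a (flip a \<alpha>) u" h w]
        juxt_in_space[OF flip_in_space[OF that(4)] that(2)] juxt_in_space[OF flip_in_space[OF that(3)] that(1)]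
      by (simp add: dims(2,3) H_def W_def juxt_assoc add_ac)
    ultimately have "AE u in Rplus_power U. AE y in Rplus_power Y. AE \<alpha> in Rplus_power a. AE z in Rplus_power r.
        (\<integral>\<beta>. H y z \<beta> * W u \<beta> \<alpha> \<partial>Rplus_power b) = 0"
      by (simp cong: AE_cong_simp)
    then show ?thesis by (elim AE_mp) (auto intro!: AE_I2)
  next
    case True
    have "AE t in Rplus_power ((X + r) + U). contraction n l a f w t = 0"
    proof -
      have eq: "n + l - 2 * a = (X + r) + U" using True by (simp add: dims(1,3,4))
      have "1 \<le> a \<and> a \<le> n \<and> a \<le> l" using p(1) True by (simp add: dims(1,3,4))
      then show ?thesis unfolding eq[symmetric] using fw by (auto simp: contractions_vanish_def)
    qed
    from AE_juxt_snd[OF this]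
    have "AE u in Rplus_power U. AE x in Rplus_power X. AE z in Rplus_power r.
        contraction n l a f w (juxt (X + r) (juxt X x z) u) = 0"
      by eventually_elim (rule AE_juxt_fst)
    moreover have "contraction n l a f w (juxt (X + r) (juxt X x z) u) =
        (\<integral>\<alpha>. F x \<alpha> z * W u \<beta> \<alpha> \<partial>Rplus_power a)"
      if x: "x \<in> space (Rplus_power X)" and z: "z \<in> space (Rplus_power r)" and u: "u \<in> space (Rplus_power U)"
      for x z u \<beta>
    proof -
      have "contraction n l a f w (juxt (X + r) (juxt X x z) u) =
          (\<integral>\<alpha>. f (juxt (X + r) (juxt X x z) \<alpha>) * w (juxt a (flip a \<alpha>) u) \<partial>Rplus_power a)"
        using contraction_juxt[of a n l "juxt X x z" u f w] juxt_in_space[OF x z] u True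
        by (simp add: dims(1,3))
      also have "\<dots> = (\<integral>\<alpha>. F x \<alpha> z * W u \<beta> \<alpha> \<partial>Rplus_power a)"
        using symmetric_everywhere_swap_blocks[OF sym dims(1) x _ z] True
        by (intro Bochner_Integration.integral_cong) (simp_all add: F_def W_def flip: juxt_assoc)
      finally show ?thesis .
    qed
    ultimately have "AE u in Rplus_power U. AE x in Rplus_power X. AE z in Rplus_power r.
        \<forall>\<beta>. (\<integral>\<alpha>. F x \<alpha> z * W u \<beta> \<alpha> \<partial>Rplus_power a) = 0"
      by (simp cong: AE_cong_simp)
    then show ?thesis
    proof eventually_elim
      case (elim u)
      then show ?case
      proof eventually_elim
        case (elim x)
        then have "AE z in Rplus_power r. AE \<beta> in Rplus_power b. (\<integral>\<alpha>. F x \<alpha> z * W u \<beta> \<alpha> \<partial>Rplus_power a) = 0"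
          by eventually_elim simp
        then show ?case by simp
      qed
    qed
  qed
  have nested: "AE u in Rplus_power U. AE x in Rplus_power X. AE y in Rplus_power Y.
      contraction (n + k - 2 * r) l p ?c w (juxt (X + Y) (juxt X x y) u) = 0"
    using zero W2 AE_space
  proof eventually_elim
    case (elim u)
    note u = elim
    from u(1) F2 AE_space show ?case
    proof eventually_elim
      case (elim x)
      note x = elim
      from x(1) H2 AE_space show ?case
      proof eventually_elim
        case (elim y)
        note sf = sigma_finite_Rplus_power
        show ?case
          unfolding val_eq[OF x(3) elim(3) u(3)]
          by (rule triple_integral_eq_zero[OF sf sf sf Fm[OF x(3)] Hm[OF elim(3)] Wm[OF u(3)]
              x(2) elim(2) u(2) elim(1)])
      qed
    qed
  qed
  have order: "n + k - 2 * r + l - 2 * p = (X + Y) + U"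
    using contraction_order[OF p(2,3)] by (simp add: U_def dims(4,6))
  have sets: "{t \<in> space (Rplus_power ((X + Y) + U)). contraction (n + k - 2 * r) l p ?c w t = 0}
      \<in> sets (Rplus_power ((X + Y) + U))"
    using sets_contraction_zero[OF p(2,3), of ?c w] unfolding order by simp
  have "AE u in Rplus_power U. AE v in Rplus_power (X + Y).
      contraction (n + k - 2 * r) l p ?c w (juxt (X + Y) v u) = 0"
    using nested AE_space
  proof eventually_elim
    case (elim u)
    have "{v \<in> space (Rplus_power (X + Y)). contraction (n + k - 2 * r) l p ?c w (juxt (X + Y) v u) = 0} =
        (\<lambda>v. juxt (X + Y) v u) -` {t \<in> space (Rplus_power ((X + Y) + U)). contraction (n + k - 2 * r) l p ?c w t = 0} \<inter>
          space (Rplus_power (X + Y))"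
      using elim(2) by (auto simp: juxt_in_space)
    also have "\<dots> \<in> sets (Rplus_power (X + Y))"
      by (rule measurable_sets[OF _ sets]) (use elim(2) in measurable)
    finally show ?case by (rule AE_juxtI_fst) (rule elim(1))
  qed
  then have "AE t in Rplus_power ((X + Y) + U). contraction (n + k - 2 * r) l p ?c w t = 0"
    by (rule AE_juxtI_snd[OF sets])
  then show "AE t in Rplus_power (n + k - 2 * r + l - 2 * p). contraction (n + k - 2 * r) l p ?c w t = 0"
    unfolding order .
qed

section \<open>Tensor products and adjoints of kernels\<close>

lemma borel_measurable_cnj [measurable]: "cnj \<in> borel_measurable borel"
  by (intro borel_measurable_continuous_onI continuous_intros)

lemma contraction_scale_left: "contraction n m p (\<lambda>t. c * f t) g t = c * contraction n m p f g t"
  by (simp add: contraction_def mult.assoc)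

lemma contractions_vanish_scale_left:
  "contractions_vanish n f m g \<Longrightarrow> contractions_vanish n (\<lambda>t. c * f t) m g"
  unfolding contractions_vanish_def contraction_scale_left by auto

text \<open>As long as the contraction does not reach beyond \<open>q\<close>, the factor \<open>w\<close> can be taken out of the
  integral.\<close>

lemma contraction_tensor_assoc:
  assumes p: "p \<le> k" "p \<le> l" and s: "s \<in> space (Rplus_power ((k - p) + (l - p)))"
    and u: "u \<in> space (Rplus_power d)"
  shows "contraction k (l + d) p h (contraction l d 0 q w) (juxt ((k - p) + (l - p)) s u) =
    contraction k l p h q s * w u"
proof -
  let ?T = "contraction l d 0 q w"
  define x where "x = restrict s {..<k - p}"
  define y where "y = tail_block (k - p) (l - p) s"
  have x: "x \<in> space (Rplus_power (k - p))" and y: "y \<in> space (Rplus_power (l - p))"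
    using measurable_space[OF measurable_head_block s] measurable_space[OF measurable_tail_block s]
    by (simp_all add: x_def y_def)
  have sxy: "s = juxt (k - p) x y" using juxt_blocks[OF s] by (simp add: x_def y_def)
  have yu: "juxt (l - p) y u \<in> space (Rplus_power (l + d - p))"
    using juxt_in_space[OF y u] p by simp
  have "contraction k (l + d) p h ?T (juxt ((k - p) + (l - p)) s u) =
      (\<integral>z. h (juxt (k - p) x z) * ?T (juxt p (flip p z) (juxt (l - p) y u)) \<partial>Rplus_power p)"
    unfolding sxy juxt_assoc[symmetric] by (rule contraction_juxt) (use p x yu in auto)
  also have "\<dots> = (\<integral>z. (h (juxt (k - p) x z) * q (juxt p (flip p z) y)) * w u \<partial>Rplus_power p)"
  proof (rule Bochner_Integration.integral_cong)
    fix z assume z: "z \<in> space (Rplus_power p)"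
    have "juxt p (flip p z) y \<in> space (Rplus_power l)"
      using juxt_in_space[OF flip_in_space[OF z] y] p by simp
    from contraction_0_juxt[OF this u, of q w] p
    show "h (juxt (k - p) x z) * ?T (juxt p (flip p z) (juxt (l - p) y u)) =
        (h (juxt (k - p) x z) * q (juxt p (flip p z) y)) * w u"
      by (simp add: juxt_assoc)
  qed simp
  also have "\<dots> = contraction k l p h q s * w u"
    unfolding sxy using contraction_juxt[OF p x y, of h q] by simp
  finally show ?thesis .
qed

text \<open>A contraction with \<open>q \<otimes> w\<close> either stays inside \<open>q\<close>, or it contracts all of \<open>q\<close> and a part of
  \<open>w\<close>. In the second case the integral over the block shared with \<open>q\<close> is a contraction of \<open>h\<close> with \<open>q\<close>.
  An empty \<open>q\<close> would make the hypothesis vacuous, hence \<open>1 \<le> l\<close>.\<close>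

lemma contractions_vanish_tensor:
  assumes h: "L2_kernel k h" and q: "L2_kernel l q" and w: "L2_kernel d w" and l: "1 \<le> l"
    and hq: "contractions_vanish k h l q"
  shows "contractions_vanish k h (l + d) (contraction l d 0 q w)"
  unfolding contractions_vanish_def
proof (intro allI impI, elim conjE)
  let ?T = "contraction l d 0 q w"
  fix p assume p: "1 \<le> p" "p \<le> k" "p \<le> l + d"
  have T: "L2_kernel (l + d) ?T" using L2_kernel_contraction[OF q w, of 0] by simp
  have sets: "{t \<in> space (Rplus_power (k + (l + d) - 2 * p)). contraction k (l + d) p h ?T t = 0}
      \<in> sets (Rplus_power (k + (l + d) - 2 * p))"
    by (rule sets_contraction_zero) (use p h T L2_kernel_measurable in auto)
  show "AE t in Rplus_power (k + (l + d) - 2 * p). contraction k (l + d) p h ?T t = 0"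
  proof (cases "p \<le> l")
    case True
    have eq: "k + (l + d) - 2 * p = ((k - p) + (l - p)) + d" using p True by simp
    have "AE s in Rplus_power ((k - p) + (l - p)). contraction k l p h q s = 0"
      using hq p True unfolding contractions_vanish_def contraction_order[OF p(2) True, symmetric] by auto
    then have "AE s in Rplus_power ((k - p) + (l - p)). AE u in Rplus_power d.
        contraction k (l + d) p h ?T (juxt ((k - p) + (l - p)) s u) = 0"
      using AE_space
    proof eventually_elim
      case (elim s)
      then show ?case using contraction_tensor_assoc[OF p(2) True elim(2), of _ d h q w]
        by (auto intro!: AE_I2)
    qed
    then show ?thesis unfolding eq by (rule AE_juxtI_fst[OF sets[unfolded eq]])
  next
    case False
    define e where "e = p - l"
    define X where "X = k - p"
    define U where "U = d - e"
    have dims: "k = X + (e + l)" "d = e + U" "p = e + l" using p False by (auto simp: e_def X_def U_def)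
    have eq: "k + (l + d) - 2 * p = X + U" by (simp add: dims)
    have eq2: "k + l - 2 * l = X + e" by (simp add: dims)
    note hm = L2_kernel_measurable[OF h] and Tm = L2_kernel_measurable[OF T]
    have "AE t in Rplus_power (X + e). contraction k l l h q t = 0"
      using hq l unfolding contractions_vanish_def eq2[symmetric] by (simp add: dims(1))
    from AE_juxt_fst[OF this]
    have "AE x in Rplus_power X. AE u in Rplus_power U. contraction k (l + d) p h ?T (juxt X x u) = 0"
      using AE_space
    proof eventually_elim
      case (elim x)
      note zero = elim(1) and x = elim(2)
      show ?case
      proof (rule AE_I2)
        fix u assume u: "u \<in> space (Rplus_power U)"
        let ?G = "\<lambda>\<beta> \<alpha>. h (juxt X x (juxt e \<beta> \<alpha>)) * (q (flip l \<alpha>) * w (juxt e (flip e \<beta>) u))"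
        have "contraction k (l + d) p h ?T (juxt X x u) =
            (\<integral>s. h (juxt X x s) * ?T (juxt p (flip p s) u) \<partial>Rplus_power (e + l))"
          using contraction_juxt[OF p(2,3), of x u h ?T] x u by (simp add: dims)
        also have "\<dots> = (\<integral>v. h (juxt X x (juxt e (fst v) (snd v))) *
            ?T (juxt p (flip p (juxt e (fst v) (snd v))) u) \<partial>(Rplus_power e \<Otimes>\<^sub>M Rplus_power l))"
        proof (rule integral_juxt, rule borel_measurable_times)
          show "(\<lambda>s. h (juxt X x s)) \<in> borel_measurable (Rplus_power (e + l))"
            using measurable_slices(1)[OF p(2,3) hm Tm, of x] x unfolding X_def[symmetric] dims(3)[symmetric] by simp
          have "l + d - p = U" by (simp add: dims)
          then show "(\<lambda>s. ?T (juxt p (flip p s) u)) \<in> borel_measurable (Rplus_power (e + l))"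
            using measurable_slices(2)[OF p(2,3) hm Tm, of u] u unfolding dims(3)[symmetric] by simp
        qed
        also have "\<dots> = (\<integral>v. ?G (fst v) (snd v) \<partial>(Rplus_power e \<Otimes>\<^sub>M Rplus_power l))"
        proof (rule Bochner_Integration.integral_cong)
          fix v assume "v \<in> space (Rplus_power e \<Otimes>\<^sub>M Rplus_power l)"
          then have v: "fst v \<in> space (Rplus_power e)" "snd v \<in> space (Rplus_power l)"
            by (auto simp: space_pair_measure)
          have "flip p (juxt e (fst v) (snd v)) = juxt l (flip l (snd v)) (flip e (fst v))"
            using flip_juxt[OF v] by (simp add: dims(3))
          moreover have "juxt e (flip e (fst v)) u \<in> space (Rplus_power d)"
            using juxt_in_space[OF flip_in_space[OF v(1)] u] by (simp add: dims(2))
          ultimately have "?T (juxt p (flip p (juxt e (fst v) (snd v))) u) =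
              q (flip l (snd v)) * w (juxt e (flip e (fst v)) u)"
            using contraction_0_juxt[OF flip_in_space[OF v(2)], of _ d q w]
            by (simp add: juxt_assoc[of l _ e, unfolded add.commute[of l e], symmetric] dims(3))
          then show "h (juxt X x (juxt e (fst v) (snd v))) *
            ?T (juxt p (flip p (juxt e (fst v) (snd v))) u) = ?G (fst v) (snd v)" by simp
        qed simp
        also have "\<dots> = 0"
        \<comment> \<open>Without integrability the integral has the default value zero, which is what is claimed.\<close>
        proof (cases "integrable (Rplus_power e \<Otimes>\<^sub>M Rplus_power l) (\<lambda>v. ?G (fst v) (snd v))")
          case True
          have "(\<integral>v. ?G (fst v) (snd v) \<partial>(Rplus_power e \<Otimes>\<^sub>M Rplus_power l)) =
              (\<integral>\<beta>. \<integral>\<alpha>. ?G \<beta> \<alpha> \<partial>Rplus_power l \<partial>Rplus_power e)"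
            using Rplus_pair.integral_fst'[OF True] by simp
          also have "\<dots> = 0"
          proof (rule integral_eq_zero_AE)
            show "AE \<beta> in Rplus_power e. (\<integral>\<alpha>. ?G \<beta> \<alpha> \<partial>Rplus_power l) = 0"
              using zero AE_space
            proof eventually_elim
              case (elim \<beta>)
              have "(\<integral>\<alpha>. h (juxt X x (juxt e \<beta> \<alpha>)) * q (flip l \<alpha>) \<partial>Rplus_power l) =
                  contraction k l l h q (juxt X x \<beta>)"
                using contraction_juxt[of l k l "juxt X x \<beta>" "\<lambda>_. undefined" h q] juxt_in_space[OF x elim(2)]
                by (simp add: dims(1) juxt_assoc flip_in_space cong: Bochner_Integration.integral_cong)
              then show ?case using elim(1) by (simp add: mult.assoc[symmetric])
            qed
          qed
          finally show ?thesis .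
        qed (simp add: not_integrable_integral_eq)
        finally show "contraction k (l + d) p h ?T (juxt X x u) = 0" .
      qed
    qed
    then show ?thesis unfolding eq by (rule AE_juxtI_fst[OF sets[unfolded eq]])
  qed
qed

lemma adjoint_kernel_flip: "adjoint_kernel n f t = cnj (f (flip n t))"
  by (simp add: adjoint_kernel_def flip_def)

lemma L2_kernel_adjoint:
  assumes f: "L2_kernel n f" shows "L2_kernel n (adjoint_kernel n f)"
proof -
  note [measurable] = L2_kernel_measurable[OF f]
  have "(\<lambda>t. cnj (f (flip n t))) \<in> borel_measurable (Rplus_power n)"
    by measurable
  moreover have "square_integral n (\<lambda>t. cnj (f (flip n t))) = square_integral n f"
    using nn_integral_flip[of "\<lambda>t. ennreal ((cmod (f t))\<^sup>2)" n] by (simp add: square_integral_def)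
  ultimately show ?thesis using f by (simp add: L2_kernel_iff adjoint_kernel_flip[abs_def])
qed

lemma symmetric_everywhere_adjoint:
  assumes f: "symmetric_everywhere n f" and t: "t \<in> space (Rplus_power n)"
  shows "adjoint_kernel n f t = f t"
proof -
  define \<sigma> where "\<sigma> i = (if i < n then n - 1 - i else i)" for i
  have "bij_betw \<sigma> {..<n} {..<n}"
    by (rule bij_betw_byWitness[where f' = \<sigma>]) (auto simp: \<sigma>_def)
  then have "\<sigma> permutes {..<n}" by (rule bij_imp_permutes) (auto simp: \<sigma>_def)
  moreover have "flip n t = t \<circ> \<sigma>"
    using t by (auto simp: fun_eq_iff flip_def \<sigma>_def Rplus_power_extensional)
  ultimately have "f (flip n t) = f t" "f t \<in> \<real>" using f t by (auto simp: symmetric_everywhere_def)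
  then show ?thesis by (simp add: adjoint_kernel_flip Reals_cnj_iff)
qed

text \<open>The kernel form of \<open>(x y)\<^sup>* = y\<^sup>* x\<^sup>*\<close>.\<close>

lemma adjoint_kernel_contraction:
  assumes p: "p \<le> n" "p \<le> m" and t: "t \<in> space (Rplus_power (n + m - 2 * p))"
  shows "adjoint_kernel (n + m - 2 * p) (contraction n m p f g) t =
    contraction m n p (adjoint_kernel m g) (adjoint_kernel n f) t"
proof -
  have eq: "n + m - 2 * p = (m - p) + (n - p)" using p by simp
  define y where "y = restrict t {..<m - p}"
  define x where "x = tail_block (m - p) (n - p) t"
  have y: "y \<in> space (Rplus_power (m - p))" and x: "x \<in> space (Rplus_power (n - p))"
    using measurable_space[OF measurable_head_block t[unfolded eq]] measurable_space[OF measurable_tail_block t[unfolded eq]]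
    by (simp_all add: x_def y_def)
  have txy: "t = juxt (m - p) y x" using juxt_blocks[OF t[unfolded eq]] by (simp add: x_def y_def)
  have "adjoint_kernel (n + m - 2 * p) (contraction n m p f g) t =
      cnj (contraction n m p f g (juxt (n - p) (flip (n - p) x) (flip (m - p) y)))"
    unfolding adjoint_kernel_flip eq txy by (simp add: flip_juxt[OF y x])
  also have "\<dots> = (\<integral>s. cnj (f (juxt (n - p) (flip (n - p) x) s) * g (juxt p (flip p s) (flip (m - p) y))) \<partial>Rplus_power p)"
    unfolding contraction_juxt[OF p flip_in_space[OF x] flip_in_space[OF y]]
    by (simp del: complex_cnj_mult)
  also have "\<dots> = (\<integral>s. adjoint_kernel m g (juxt (m - p) y s) * adjoint_kernel n f (juxt p (flip p s) x) \<partial>Rplus_power p)"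
  proof (rule Bochner_Integration.integral_cong)
    fix s assume s: "s \<in> space (Rplus_power p)"
    have "flip m (juxt (m - p) y s) = juxt p (flip p s) (flip (m - p) y)"
      using flip_juxt[OF y s] p by simp
    moreover have "flip n (juxt p (flip p s) x) = juxt (n - p) (flip (n - p) x) s"
      using flip_juxt[OF flip_in_space[OF s] x] p by (simp add: flip_flip[OF s])
    ultimately show "cnj (f (juxt (n - p) (flip (n - p) x) s) * g (juxt p (flip p s) (flip (m - p) y))) =
        adjoint_kernel m g (juxt (m - p) y s) * adjoint_kernel n f (juxt p (flip p s) x)"
      by (simp add: adjoint_kernel_flip)
  qed simp
  also have "\<dots> = contraction m n p (adjoint_kernel m g) (adjoint_kernel n f) t"
    unfolding txy using contraction_juxt[OF p(2,1) y x, of "adjoint_kernel m g" "adjoint_kernel n f"] by simp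
  finally show ?thesis .
qed

lemma contractions_vanish_adjoint:
  assumes "contractions_vanish n f m g"
  shows "contractions_vanish m (adjoint_kernel m g) n (adjoint_kernel n f)"
  unfolding contractions_vanish_def
proof (intro allI impI, elim conjE)
  fix p assume p: "1 \<le> p" "p \<le> m" "p \<le> n"
  have "AE t in Rplus_power (n + m - 2 * p). contraction n m p f g (flip (n + m - 2 * p) t) = 0"
    using assms p by (subst AE_flip) (auto simp: contractions_vanish_def)
  then have "AE t in Rplus_power (n + m - 2 * p). contraction m n p (adjoint_kernel m g) (adjoint_kernel n f) t = 0"
    using AE_space
  proof eventually_elim
    case (elim t)
    then show ?case using adjoint_kernel_contraction[OF p(3,2) elim(2), of f g]
      by (simp add: adjoint_kernel_flip[of _ "contraction n m p f g"])
  qed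
  then show "AE t in Rplus_power (m + n - 2 * p). contraction m n p (adjoint_kernel m g) (adjoint_kernel n f) t = 0"
    unfolding add.commute[of m n] .
qed

lemma contraction_cong:
  assumes "p \<le> n" "p \<le> m" and "\<And>t. t \<in> space (Rplus_power n) \<Longrightarrow> f t = f' t"
    and "\<And>t. t \<in> space (Rplus_power m) \<Longrightarrow> g t = g' t" and t: "t \<in> space (Rplus_power (n + m - 2 * p))"
  shows "contraction n m p f g t = contraction n m p f' g' t"
proof -
  have t': "t \<in> space (Rplus_power ((n - p) + (m - p)))" using t assms(1,2) by (simp add: contraction_order)
  define x where "x = restrict t {..<n - p}"
  define y where "y = tail_block (n - p) (m - p) t"
  have x: "x \<in> space (Rplus_power (n - p))" and y: "y \<in> space (Rplus_power (m - p))"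
    using measurable_space[OF measurable_head_block t'] measurable_space[OF measurable_tail_block t']
    by (simp_all add: x_def y_def)
  have txy: "t = juxt (n - p) x y" using juxt_blocks[OF t'] by (simp add: x_def y_def)
  have *: "f (juxt (n - p) x s) = f' (juxt (n - p) x s)" "g (juxt p (flip p s) y) = g' (juxt p (flip p s) y)"
    if "s \<in> space (Rplus_power p)" for s
    using assms(3)[of "juxt (n - p) x s"] assms(4)[of "juxt p (flip p s) y"]
      juxt_in_space[OF x that] juxt_in_space[OF flip_in_space[OF that] y] assms(1,2) by simp_all
  show ?thesis unfolding txy contraction_juxt[OF assms(1,2) x y]
    by (rule Bochner_Integration.integral_cong) (simp_all add: *)
qed

lemma contractions_vanish_cong:
  assumes "contractions_vanish n f m g" "\<And>t. t \<in> space (Rplus_power n) \<Longrightarrow> f t = f' t"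
    and "\<And>t. t \<in> space (Rplus_power m) \<Longrightarrow> g t = g' t"
  shows "contractions_vanish n f' m g'"
  using assms(1) unfolding contractions_vanish_def
  by (auto simp: contraction_cong[OF _ _ assms(2,3)] cong: AE_cong_simp)

lemma integrable_L2_kernel_mult:
  assumes f: "L2_kernel n f" and g: "L2_kernel n g"
  shows "integrable (Rplus_power n) (\<lambda>t. f t * cnj (g t))"
proof (rule Bochner_Integration.integrable_bound)
  show "integrable (Rplus_power n) (\<lambda>t. (cmod (f t))\<^sup>2 + (cmod (g t))\<^sup>2)"
    using f g by (auto simp: L2_kernel_def)
  note [measurable] = L2_kernel_measurable[OF f] L2_kernel_measurable[OF g]
  show "(\<lambda>t. f t * cnj (g t)) \<in> borel_measurable (Rplus_power n)" by measurable
  have "x * y \<le> x\<^sup>2 + y\<^sup>2" for x y :: real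
    using sum_squares_bound[of x y] sum_power2_ge_zero[of x y] unfolding mult.assoc by linarith
  then show "AE t in Rplus_power n. norm (f t * cnj (g t)) \<le> norm ((cmod (f t))\<^sup>2 + (cmod (g t))\<^sup>2)"
    by (auto intro!: AE_I2 simp: norm_mult)
qed

lemma integral_tensor:
  assumes f: "L2_kernel n f" and f': "L2_kernel n f'" and g: "L2_kernel m g" and g': "L2_kernel m g'"
  shows "(\<integral>t. contraction n m 0 f g t * cnj (contraction n m 0 f' g' t) \<partial>Rplus_power (n + m)) =
    (\<integral>t. f t * cnj (f' t) \<partial>Rplus_power n) * (\<integral>t. g t * cnj (g' t) \<partial>Rplus_power m)"
proof -
  let ?u = "\<lambda>t. f t * cnj (f' t)" and ?v = "\<lambda>t. g t * cnj (g' t)"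
  have u: "integrable (Rplus_power n) ?u" and v: "integrable (Rplus_power m) ?v"
    using assms by (auto intro: integrable_L2_kernel_mult)
  have [measurable]: "contraction n m 0 f g \<in> borel_measurable (Rplus_power (n + m))"
    "contraction n m 0 f' g' \<in> borel_measurable (Rplus_power (n + m))"
    using assms measurable_contraction[of 0 n m] L2_kernel_measurable by fastforce+
  note [measurable] = borel_measurable_integrable[OF u] borel_measurable_integrable[OF v]
  have int: "integrable (Rplus_power n \<Otimes>\<^sub>M Rplus_power m) (\<lambda>p. ?u (fst p) * ?v (snd p))"
  proof (rule Rplus_pair.Fubini_integrable)
    show "integrable (Rplus_power n) (\<lambda>x. \<integral>y. norm (?u (fst (x, y)) * ?v (snd (x, y))) \<partial>Rplus_power m)"
      using u by (simp add: norm_mult del: norm_mult) (simp add: norm_mult[of "_ * _" "_ * _"] del: norm_mult complex_mod_cnj)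
  qed (use v in auto)
  have "(\<integral>t. contraction n m 0 f g t * cnj (contraction n m 0 f' g' t) \<partial>Rplus_power (n + m)) =
      (\<integral>p. ?u (fst p) * ?v (snd p) \<partial>(Rplus_power n \<Otimes>\<^sub>M Rplus_power m))"
    by (subst integral_juxt)
      (auto intro!: Bochner_Integration.integral_cong simp: space_pair_measure contraction_0_juxt)
  also have "\<dots> = (\<integral>x. \<integral>y. ?u x * ?v y \<partial>Rplus_power m \<partial>Rplus_power n)"
    using Rplus_pair.integral_fst'[OF int] by simp
  also have "\<dots> = (\<integral>t. ?u t \<partial>Rplus_power n) * (\<integral>t. ?v t \<partial>Rplus_power m)" by simp
  finally show ?thesis .
qed

lemma star_contraction_1:
  "t \<in> space (Rplus_power 1) \<Longrightarrow> star_contraction 1 1 1 f g t = f t * g t"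
proof -
  assume t: "t \<in> space (Rplus_power 1)"
  have "(\<lambda>i\<in>{..<1::nat}. t i) = t" using t by (auto simp: fun_eq_iff Rplus_power_extensional)
  then show ?thesis unfolding star_contraction_def diff_self_eq_0 integral_point
    by (simp add: restrict_def cong: if_cong)
qed

section \<open>Bounded operators and their completion\<close>

lemma scaleC_one [simp]: "1 *\<^sub>C x = (x :: 'a::complex_space)"
  using scaleC_of_real[of 1 x] by simp

lemma scaleC_zero_left [simp]: "0 *\<^sub>C x = (0 :: 'a::complex_space)"
  using scaleC_of_real[of 0 x] by simp

lemma scaleC_minus_one: "(-1) *\<^sub>C x = - (x :: 'a::complex_space)"
  using scaleC_of_real[of "-1" x] by simp

lemma cinner_zero_left [simp]: "cinner 0 (y :: 'a::complex_hilbert) = 0"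
  using cinner_scaleC_left[of 0 0 y] by simp

lemma cinner_minus_left: "cinner (- x) y = - cinner x (y :: 'a::complex_hilbert)"
  using cinner_scaleC_left[of "-1" x y] by (simp add: scaleC_minus_one)

lemma cinner_diff_left: "cinner (x - y) z = cinner x z - cinner y (z :: 'a::complex_hilbert)"
  using cinner_add_left[of x "- y" z] by (simp add: cinner_minus_left)

lemma cinner_add_right: "cinner x (y + z) = cinner x y + cinner x (z :: 'a::complex_hilbert)"
  by (metis cinner_add_left cinner_commute complex_cnj_add)

lemma cinner_scaleC_right: "cinner x (c *\<^sub>C y) = cnj c * cinner x (y :: 'a::complex_hilbert)"
  by (metis cinner_commute cinner_scaleC_left complex_cnj_mult)

lemma cinner_self: "cinner x x = complex_of_real ((norm (x :: 'a::complex_hilbert))\<^sup>2)"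
proof (rule complex_eqI)
  show "Re (cinner x x) = Re (complex_of_real ((norm x)\<^sup>2))"
    by (simp add: Re_cinner power2_norm_eq_inner)
  have "Im (cinner x x) = - Im (cinner x x)" using arg_cong[OF cinner_commute[of x x], of Im] by simp
  then show "Im (cinner x x) = Im (complex_of_real ((norm x)\<^sup>2))" by simp
qed

lemma cinner_eq_Complex: "cinner x y = Complex (inner x y) (inner ((- \<i>) *\<^sub>C x) (y :: 'a::complex_hilbert))"
  by (rule complex_eqI) (simp_all add: Re_cinner[symmetric] cinner_scaleC_left)

text \<open>Both parts of the complex inner product are real inner products, which are continuous.\<close>

lemma tendsto_cinner:
  fixes x y :: "'a::complex_hilbert"
  assumes "(f \<longlongrightarrow> x) F" "(g \<longlongrightarrow> y) F"
  shows "((\<lambda>k. cinner (f k) (g k)) \<longlongrightarrow> cinner x y) F"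
  unfolding cinner_eq_Complex
  by (intro tendsto_Complex tendsto_inner assms bounded_linear.tendsto[OF bounded_linear_scaleC])

lemma eq_if_cinner_eq: "(\<And>x. cinner x y = cinner x z) \<Longrightarrow> y = (z :: 'a::complex_hilbert)"
proof -
  assume *: "\<And>x. cinner x y = cinner x z"
  have "inner (y - z) (y - z) = 0"
    using arg_cong[OF *[of "y - z"], of Re] by (simp add: Re_cinner inner_diff_right)
  then show ?thesis by simp
qed

lemma blinfun_compose_id [simp]: "a o\<^sub>L id_blinfun = a" "id_blinfun o\<^sub>L a = a"
  by (auto intro: blinfun_eqI)

lemma blinfun_compose_assoc: "(a o\<^sub>L b) o\<^sub>L c = a o\<^sub>L (b o\<^sub>L c)"
  by (auto intro: blinfun_eqI)

lemma is_adjoint_unique: "is_adjoint a b \<Longrightarrow> is_adjoint a c \<Longrightarrow> b = c"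
  unfolding is_adjoint_def by (intro blinfun_eqI eq_if_cinner_eq) metis

lemma adj_eqI: "is_adjoint a b \<Longrightarrow> adj a = b"
  unfolding adj_def by (rule the_equality) (auto intro: is_adjoint_unique)

lemma is_adjoint_sym: "is_adjoint a b \<Longrightarrow> is_adjoint b a"
  unfolding is_adjoint_def by (metis cinner_commute)

lemma is_adjoint_compose: "is_adjoint a c \<Longrightarrow> is_adjoint b d \<Longrightarrow> is_adjoint (a o\<^sub>L b) (d o\<^sub>L c)"
  unfolding is_adjoint_def by simp

lemma is_adjoint_add: "is_adjoint a c \<Longrightarrow> is_adjoint b d \<Longrightarrow> is_adjoint (a + b) (c + d)"
  unfolding is_adjoint_def by (simp add: blinfun.add_left cinner_add_left cinner_add_right)

lemma is_adjoint_scaleC: "is_adjoint a b \<Longrightarrow> is_adjoint (c *\<^sub>C a) (cnj c *\<^sub>C b)"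
  unfolding is_adjoint_def by (simp add: scaleC_blinfun.rep_eq cinner_scaleC_left cinner_scaleC_right)

lemma is_adjoint_id: "is_adjoint id_blinfun id_blinfun"
  unfolding is_adjoint_def by simp

context von_neumann_algebra
begin

lemma mem_iff: "a \<in> A \<longleftrightarrow> complex_linear a \<and> (\<forall>c \<in> commutant A. c o\<^sub>L a = a o\<^sub>L c)"
proof -
  have "a \<in> A \<longleftrightarrow> a \<in> commutant (commutant A)" by (simp only: bicommutant)
  then show ?thesis by (simp only: commutant_def[of "commutant A"] mem_Collect_eq)
qed

lemma id_mem: "id_blinfun \<in> A"
  by (auto simp: mem_iff complex_linear_def intro: blinfun_eqI)

lemma add_mem: "a \<in> A \<Longrightarrow> b \<in> A \<Longrightarrow> a + b \<in> A"
  unfolding mem_iff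
  by (auto simp: complex_linear_def blinfun.add_left scaleC_add_right blinfun.add_right intro!: blinfun_eqI)
    (metis blinfun_apply_blinfun_compose)

lemma compose_mem: "a \<in> A \<Longrightarrow> b \<in> A \<Longrightarrow> a o\<^sub>L b \<in> A"
  unfolding mem_iff
  by (auto simp: complex_linear_def intro!: blinfun_eqI) (metis blinfun_apply_blinfun_compose)

lemma scaleC_mem: "a \<in> A \<Longrightarrow> c *\<^sub>C a \<in> A"
proof -
  assume a: "a \<in> A"
  have "d o\<^sub>L (c *\<^sub>C a) = (c *\<^sub>C a) o\<^sub>L d" if d: "d \<in> commutant A" for d
  proof (rule blinfun_eqI)
    fix x
    have "blinfun_apply d (blinfun_apply a x) = blinfun_apply a (blinfun_apply d x)"
      using a d unfolding mem_iff by (metis blinfun_apply_blinfun_compose)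
    moreover have "complex_linear d" using d by (simp add: commutant_def)
    ultimately show "blinfun_apply (d o\<^sub>L (c *\<^sub>C a)) x = blinfun_apply ((c *\<^sub>C a) o\<^sub>L d) x"
      by (simp add: scaleC_blinfun.rep_eq complex_linear_def)
  qed
  moreover have "complex_linear (c *\<^sub>C a)"
    using operators[OF a] by (simp add: complex_linear_def scaleC_blinfun.rep_eq scaleC_scaleC mult.commute)
  ultimately show ?thesis by (simp add: mem_iff)
qed

lemma is_adjoint_adj: "a \<in> A \<Longrightarrow> is_adjoint a (adj a)" and adj_mem: "a \<in> A \<Longrightarrow> adj a \<in> A"
  using adjoint_closed adj_eqI by blast+

lemma adj_adj: "a \<in> A \<Longrightarrow> adj (adj a) = a"
  by (rule adj_eqI, rule is_adjoint_sym, rule is_adjoint_adj)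

lemma adj_compose: "a \<in> A \<Longrightarrow> b \<in> A \<Longrightarrow> adj (a o\<^sub>L b) = adj b o\<^sub>L adj a"
  by (intro adj_eqI is_adjoint_compose is_adjoint_adj)

lemma adj_add: "a \<in> A \<Longrightarrow> b \<in> A \<Longrightarrow> adj (a + b) = adj a + adj b"
  by (intro adj_eqI is_adjoint_add is_adjoint_adj)

lemma adj_scaleC: "a \<in> A \<Longrightarrow> adj (c *\<^sub>C a) = cnj c *\<^sub>C adj a"
  by (intro adj_eqI is_adjoint_scaleC is_adjoint_adj)

lemma adj_id: "adj id_blinfun = id_blinfun"
  by (intro adj_eqI is_adjoint_id)

lemma diff_mem: "a \<in> A \<Longrightarrow> b \<in> A \<Longrightarrow> a - b \<in> A"
  using add_mem[of a "(-1) *\<^sub>C b"] scaleC_mem[of b "-1"] by (simp add: scaleC_minus_one)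

lemma adj_diff: "a \<in> A \<Longrightarrow> b \<in> A \<Longrightarrow> adj (a - b) = adj a - adj b"
  using adj_add[of a "(-1) *\<^sub>C b"] adj_scaleC[of b "-1"] scaleC_mem[of b "-1"] by (simp add: scaleC_minus_one)

end

context L2_completion
begin

lemma iota_diff: "a \<in> A \<Longrightarrow> b \<in> A \<Longrightarrow> \<iota> (a - b) = \<iota> a - \<iota> b"
  using iota_add[of a "(-1) *\<^sub>C b"] iota_scale[of b "-1"] scaleC_mem[of b "-1"] by (simp add: scaleC_minus_one)

lemma cinner_iota_adj: "a \<in> A \<Longrightarrow> b \<in> A \<Longrightarrow> cinner (\<iota> (adj a)) (\<iota> (adj b)) = cinner (\<iota> b) (\<iota> a)"
  by (simp add: iota_isometric adj_mem adj_adj phi_tracial)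

lemma norm_iota_adj: "a \<in> A \<Longrightarrow> norm (\<iota> (adj a)) = norm (\<iota> a)"
proof -
  assume "a \<in> A"
  from cinner_iota_adj[OF this this] have "(norm (\<iota> (adj a)))\<^sup>2 = (norm (\<iota> a))\<^sup>2"
    unfolding cinner_self of_real_eq_iff .
  then show ?thesis by (simp add: power2_eq_iff_nonneg)
qed

lemma norm_iota_adj_diff: "a \<in> A \<Longrightarrow> b \<in> A \<Longrightarrow> norm (\<iota> (adj a) - \<iota> (adj b)) = norm (\<iota> a - \<iota> b)"
  using norm_iota_adj[of "a - b"] by (simp add: adj_diff iota_diff adj_mem diff_mem)

text \<open>Faithfulness of \<open>\<phi>\<close> is stated for \<open>a\<^sup>* a\<close> and the norm of \<open>\<iota> a\<close> for \<open>a a\<^sup>*\<close>; the trace property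
  makes the two agree.\<close>

lemma inj_iota: "inj_on \<iota> A"
proof (rule inj_onI)
  fix a b assume ab: "a \<in> A" "b \<in> A" "\<iota> a = \<iota> b"
  have "\<iota> (adj (a - b)) = 0"
    using ab norm_iota_adj_diff[OF ab(1,2)] by (simp add: adj_diff iota_diff adj_mem)
  then have "\<phi> (adj (a - b) o\<^sub>L (a - b)) = 0"
    using iota_isometric[OF adj_mem adj_mem, of "a - b" "a - b"] ab by (simp add: adj_adj diff_mem)
  then show "a = b" using phi_faithful[of "a - b"] ab diff_mem by simp
qed

lemma approximable: obtains b where "range b \<subseteq> A" "(\<lambda>k. \<iota> (b k)) \<longlonglongrightarrow> x"
proof -
  have "x \<in> closure (\<iota> ` A)" by (simp add: iota_dense)
  then obtain y where y: "\<And>k. y k \<in> \<iota> ` A" "y \<longlonglongrightarrow> x" unfolding closure_sequential by auto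
  then obtain b where "\<And>k. b k \<in> A \<and> y k = \<iota> (b k)" unfolding image_iff by metis
  then show thesis using that[of b] y by (metis image_subset_iff ext)
qed

lemma adj_converges:
  assumes b: "range b \<subseteq> A" "(\<lambda>k. \<iota> (b k)) \<longlonglongrightarrow> x"
    and c: "range c \<subseteq> A" "(\<lambda>k. \<iota> (c k)) \<longlonglongrightarrow> x" "(\<lambda>k. \<iota> (adj (c k))) \<longlonglongrightarrow> y"
  shows "(\<lambda>k. \<iota> (adj (b k))) \<longlonglongrightarrow> y"
proof -
  have "(\<lambda>k. \<iota> (b k) - \<iota> (c k)) \<longlonglongrightarrow> 0" using tendsto_diff[OF b(2) c(2)] by simp
  then have "(\<lambda>k. norm (\<iota> (b k) - \<iota> (c k))) \<longlonglongrightarrow> 0" by (rule tendsto_norm_zero)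
  then have "(\<lambda>k. norm (\<iota> (adj (b k)) - \<iota> (adj (c k)))) \<longlonglongrightarrow> 0"
    using b(1) c(1) by (subst norm_iota_adj_diff) auto
  then have "(\<lambda>k. \<iota> (adj (b k)) - \<iota> (adj (c k))) \<longlonglongrightarrow> 0" by (rule tendsto_norm_zero_cancel)
  from tendsto_add[OF this c(3)] show ?thesis by simp
qed

lemma L2_adj_eqI:
  assumes b: "range b \<subseteq> A" "(\<lambda>k. \<iota> (b k)) \<longlonglongrightarrow> x" "(\<lambda>k. \<iota> (adj (b k))) \<longlonglongrightarrow> y"
  shows "L2_adj A \<iota> x = y"
  unfolding L2_adj_def
proof (rule the_equality)
  fix z assume "\<exists>c. range c \<subseteq> A \<and> (\<lambda>k. \<iota> (c k)) \<longlonglongrightarrow> x \<and> (\<lambda>k. \<iota> (adj (c k))) \<longlonglongrightarrow> z"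
  then obtain c where "range c \<subseteq> A" "(\<lambda>k. \<iota> (c k)) \<longlonglongrightarrow> x" "(\<lambda>k. \<iota> (adj (c k))) \<longlonglongrightarrow> z" by blast
  from adj_converges[OF b(1,2) this] b(3) show "z = y" by (rule LIMSEQ_unique)
qed (use b in blast)

text \<open>The involution is isometric by the trace property, so it carries convergent sequences to
  convergent sequences. This is the existence that the description in \<^const>\<open>L2_adj\<close> presupposes.\<close>

lemma L2_adj_limit:
  assumes b: "range b \<subseteq> A" "(\<lambda>k. \<iota> (b k)) \<longlonglongrightarrow> x"
  shows "(\<lambda>k. \<iota> (adj (b k))) \<longlonglongrightarrow> L2_adj A \<iota> x"
proof -
  have "Cauchy (\<lambda>k. \<iota> (b k))" using b(2) by (rule LIMSEQ_imp_Cauchy)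
  then have "Cauchy (\<lambda>k. \<iota> (adj (b k)))"
    using b(1) unfolding Cauchy_def dist_norm by (subst norm_iota_adj_diff) auto
  then obtain y where y: "(\<lambda>k. \<iota> (adj (b k))) \<longlonglongrightarrow> y"
    using Cauchy_convergent convergent_def by blast
  with L2_adj_eqI[OF b y] show ?thesis by simp
qed

lemma L2_adj_iota: "a \<in> A \<Longrightarrow> L2_adj A \<iota> (\<iota> a) = \<iota> (adj a)"
  by (rule L2_adj_eqI[of "\<lambda>_. a"]) auto

lemma L2_adj_L2_adj: "L2_adj A \<iota> (L2_adj A \<iota> x) = x"
proof -
  obtain b where b: "range b \<subseteq> A" "(\<lambda>k. \<iota> (b k)) \<longlonglongrightarrow> x" by (rule approximable)
  show ?thesis
    by (rule L2_adj_eqI[of "\<lambda>k. adj (b k)"]) (use b adj_mem adj_adj L2_adj_limit[OF b] in \<open>auto simp: subset_eq\<close>)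
qed

lemma cinner_L2_adj: "cinner (L2_adj A \<iota> x) (L2_adj A \<iota> y) = cinner y x"
proof -
  obtain b where b: "range b \<subseteq> A" "(\<lambda>k. \<iota> (b k)) \<longlonglongrightarrow> x" by (rule approximable)
  obtain c where c: "range c \<subseteq> A" "(\<lambda>k. \<iota> (c k)) \<longlonglongrightarrow> y" by (rule approximable)
  have "(\<lambda>k. cinner (\<iota> (c k)) (\<iota> (b k))) \<longlonglongrightarrow> cinner (L2_adj A \<iota> x) (L2_adj A \<iota> y)"
    using tendsto_cinner[OF L2_adj_limit[OF b] L2_adj_limit[OF c]] b c
    by (simp add: cinner_iota_adj image_subset_iff)
  with tendsto_cinner[OF c(2) b(2)] show ?thesis by (metis LIMSEQ_unique)
qed

lemma norm_L2_adj: "norm (L2_adj A \<iota> x) = norm x"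
proof -
  have "(norm (L2_adj A \<iota> x))\<^sup>2 = (norm x)\<^sup>2"
    using cinner_L2_adj[of x x] unfolding cinner_self of_real_eq_iff .
  then show ?thesis by (simp add: power2_eq_iff_nonneg)
qed

text \<open>The defining limit of the product, tested against the unit. It extends \<open>\<phi> (a b) = \<langle>a, b\<^sup>*\<rangle>\<close> from
  \<open>A\<close> to unbounded elements.\<close>

lemma L2_state_prod:
  assumes "L2_prod A \<phi> \<iota> x y z"
  shows "L2_state \<iota> z = cinner x (L2_adj A \<iota> y)"
proof -
  obtain b c where b: "range b \<subseteq> A" "(\<lambda>k. \<iota> (b k)) \<longlonglongrightarrow> x" and c: "range c \<subseteq> A" "(\<lambda>k. \<iota> (c k)) \<longlonglongrightarrow> y"
    and z: "\<And>a. a \<in> A \<Longrightarrow> (\<lambda>k. \<phi> (b k o\<^sub>L c k o\<^sub>L adj a)) \<longlonglongrightarrow> cinner z (\<iota> a)"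
    using assms unfolding L2_prod_def by blast
  have "\<phi> (b k o\<^sub>L c k) = cinner (\<iota> (b k)) (\<iota> (adj (c k)))" for k
    using b(1) c(1) by (subst iota_isometric) (auto simp: adj_mem adj_adj image_subset_iff)
  then have "(\<lambda>k. \<phi> (b k o\<^sub>L c k)) \<longlonglongrightarrow> cinner x (L2_adj A \<iota> y)"
    using tendsto_cinner[OF b(2) L2_adj_limit[OF c]] by simp
  moreover have "b k o\<^sub>L c k o\<^sub>L id_blinfun = b k o\<^sub>L c k" for k by (rule blinfun_eqI) simp
  with z[OF id_mem] have "(\<lambda>k. \<phi> (b k o\<^sub>L c k)) \<longlonglongrightarrow> L2_state \<iota> z"
    by (simp add: adj_id L2_state_def)
  ultimately show ?thesis by (rule LIMSEQ_unique[symmetric])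
qed

end

section \<open>Norms of products of free elements\<close>

lemma L2_state_add: "L2_state \<iota> (x + y) = L2_state \<iota> x + L2_state \<iota> y"
  by (simp add: L2_state_def cinner_add_left)

lemma L2_state_scaleC: "L2_state \<iota> (c *\<^sub>C x) = c * L2_state \<iota> x"
  by (simp add: L2_state_def cinner_scaleC_left)

lemma L2_state_diff: "L2_state \<iota> (x - y) = L2_state \<iota> x - L2_state \<iota> y"
  by (simp add: L2_state_def cinner_diff_left)

lemma (in L2_star_algebra) diff_closed: "x \<in> B \<Longrightarrow> y \<in> B \<Longrightarrow> x - y \<in> B"
  using add_closed[of x "(-1) *\<^sub>C y"] scale_closed[of y "-1"] by (simp add: scaleC_minus_one)

lemma (in L2_star_algebra) mul_diff_left: "x \<in> B \<Longrightarrow> y \<in> B \<Longrightarrow> z \<in> B \<Longrightarrow> mul (x - y) z = mul x z - mul y z"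
  using mul_add_left[of x "(-1) *\<^sub>C y" z] mul_scale_left[of y z "-1"] scale_closed[of y "-1"]
  by (simp add: scaleC_minus_one)

lemma (in L2_star_algebra) mul_diff_right: "x \<in> B \<Longrightarrow> y \<in> B \<Longrightarrow> z \<in> B \<Longrightarrow> mul x (y - z) = mul x y - mul x z"
  using mul_add_right[of x y "(-1) *\<^sub>C z"] mul_scale_right[of x z "-1"] scale_closed[of z "-1"]
  by (simp add: scaleC_minus_one)

lemma poly_at_square: "poly_at mul one (monom 1 2) X = mul X (mul X one)"
proof -
  have "degree (monom 1 2 :: complex poly) = 2" by (simp add: degree_monom_eq)
  then show ?thesis by (simp add: poly_at_def numeral_2_eq_2)
qed

text \<open>Freeness is only used for the word formed by \<open>X\<^sup>2\<close> and \<open>Y\<^sup>2\<close>. It says that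
  \<open>\<tau>(X\<^sup>2 Y\<^sup>2) = \<tau>(X\<^sup>2) \<tau>(Y\<^sup>2)\<close>, and by the trace property the left hand side is \<open>\<tau>((X Y) (X Y)\<^sup>*)\<close>.\<close>

lemma norm_mul_if_free:
  assumes "L2_completion A \<phi> \<iota>" and "L2_star_algebra A \<phi> \<iota> B mul" and X: "X \<in> B" and Y: "Y \<in> B"
    and sa: "L2_adj A \<iota> X = X" "L2_adj A \<iota> Y = Y"
    and free: "free_elements mul (\<iota> id_blinfun) (L2_state \<iota>) [X, Y]"
  shows "norm (mul X Y) = norm X * norm Y" and "norm (mul Y X) = norm X * norm Y"
proof -
  interpret L2_completion A \<phi> \<iota> by fact
  interpret alg: L2_star_algebra A \<phi> \<iota> B mul by fact
  let ?\<tau> = "L2_state \<iota>" and ?e = "\<iota> id_blinfun"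
  note closed = X Y alg.mul_closed alg.one_closed alg.scale_closed alg.diff_closed
  have \<tau>mul: "?\<tau> (mul x y) = cinner x (L2_adj A \<iota> y)" if "x \<in> B" "y \<in> B" for x y
    by (rule L2_state_prod[OF alg.mul_L2_prod[OF that]])
  have trace: "?\<tau> (mul x y) = ?\<tau> (mul y x)" if "x \<in> B" "y \<in> B" for x y
    using that cinner_L2_adj[of "L2_adj A \<iota> x" y] by (simp add: \<tau>mul L2_adj_L2_adj)
  have \<tau>e: "?\<tau> ?e = 1"
    by (simp add: L2_state_def iota_isometric id_mem adj_id phi_unital)
  let ?P = "mul X X" and ?Q = "mul Y Y"
  have sq: "mul X X \<in> polynomials_in mul ?e X" "mul Y Y \<in> polynomials_in mul ?e Y"
    unfolding polynomials_in_def using poly_at_square[of mul ?e X] poly_at_square[of mul ?e Y] X Y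
    by (metis alg.mul_one_right rangeI)+
  have "?\<tau> (foldr mul (map (\<lambda>(i, b). b - ?\<tau> b *\<^sub>C ?e) [(0, ?P), (1, ?Q)]) ?e) = 0"
    using free[unfolded free_elements_def free_sets_def, THEN spec[of _ "[(0, ?P), (1, ?Q)]"]] sq
    by simp
  then have "?\<tau> (mul (?P - ?\<tau> ?P *\<^sub>C ?e) (?Q - ?\<tau> ?Q *\<^sub>C ?e)) = 0"
    by (simp add: closed alg.mul_one_right)
  then have "?\<tau> (mul ?P ?Q) = ?\<tau> ?P * ?\<tau> ?Q"
    by (simp add: closed alg.mul_diff_left alg.mul_diff_right alg.mul_scale_left alg.mul_scale_right
        alg.mul_one_left alg.mul_one_right L2_state_diff L2_state_add L2_state_scaleC \<tau>e algebra_simps)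
  moreover have "?\<tau> ?P = (norm X)\<^sup>2" "?\<tau> ?Q = (norm Y)\<^sup>2"
    by (simp_all add: \<tau>mul X Y sa cinner_self)
  moreover have "?\<tau> (mul ?P ?Q) = (norm (mul X Y))\<^sup>2"
  proof -
    \<comment> \<open>Move the first factor \<open>X\<close> to the end.\<close>
    have "mul ?P ?Q = mul X (mul (mul X Y) Y)" by (simp add: closed alg.mul_assoc)
    then have "?\<tau> (mul ?P ?Q) = ?\<tau> (mul (mul (mul X Y) Y) X)" by (simp add: closed trace)
    also have "\<dots> = ?\<tau> (mul (mul X Y) (mul Y X))" by (simp add: closed alg.mul_assoc)
    also have "\<dots> = cinner (mul X Y) (mul X Y)" by (simp add: \<tau>mul closed alg.adj_mul sa)
    finally show ?thesis by (simp add: cinner_self)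
  qed
  ultimately have "complex_of_real ((norm (mul X Y))\<^sup>2) = complex_of_real ((norm X * norm Y)\<^sup>2)"
    by (simp add: power_mult_distrib)
  then have "(norm (mul X Y))\<^sup>2 = (norm X * norm Y)\<^sup>2" unfolding of_real_eq_iff .
  then show "norm (mul X Y) = norm X * norm Y" by (simp add: power2_eq_iff_nonneg)
  moreover have "L2_adj A \<iota> (mul Y X) = mul X Y" by (simp add: alg.adj_mul X Y sa)
  ultimately show "norm (mul Y X) = norm X * norm Y" using norm_L2_adj[of "mul Y X"] by simp
qed

text \<open>Elements that come from \<open>A\<close> have moments of all orders, in the algebra \<open>A\<close> itself.\<close>

lemma bounded_L2_star_algebra:
  assumes "L2_completion A \<phi> \<iota>"
  shows "L2_star_algebra A \<phi> \<iota> (\<iota> ` A) (\<lambda>x y. \<iota> (inv_into A \<iota> x o\<^sub>L inv_into A \<iota> y))"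
proof -
  interpret L2_completion A \<phi> \<iota> by fact
  note closed = id_mem add_mem compose_mem scaleC_mem adj_mem
  have inv: "a \<in> A \<Longrightarrow> inv_into A \<iota> (\<iota> a) = a" for a by (rule inv_into_f_f[OF inj_iota])
  show ?thesis
  proof
    fix x y assume "x \<in> \<iota> ` A" "y \<in> \<iota> ` A"
    then obtain a b where ab: "x = \<iota> a" "a \<in> A" "y = \<iota> b" "b \<in> A" by blast
    then show "L2_prod A \<phi> \<iota> x y (\<iota> (inv_into A \<iota> x o\<^sub>L inv_into A \<iota> y))"
      unfolding L2_prod_def
      by (intro exI[of _ "\<lambda>_. a"] exI[of _ "\<lambda>_. b"]) (auto simp: inv iota_isometric closed)
  qed (auto simp: closed inv L2_adj_iota adj_compose iota_add[symmetric] iota_scale[symmetric]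
    blinfun_compose_assoc intro!: imageI arg_cong[of _ _ \<iota>] blinfun_eqI simp: blinfun.add_left blinfun.add_right
    scaleC_blinfun.rep_eq operators[unfolded complex_linear_def])
qed

section \<open>Kernels of order zero and linear combinations\<close>

lemma L2_kernel_0: "L2_kernel 0 f"
  unfolding L2_kernel_iff square_integral_def nn_integral_point
  by (simp add: Rplus_power_def PiM_empty)

lemma L2_kernel_scale: "L2_kernel n f \<Longrightarrow> L2_kernel n (\<lambda>t. c * f t)"
  by (auto simp: L2_kernel_def norm_mult power_mult_distrib)

lemma L2_kernel_diff: "L2_kernel n f \<Longrightarrow> L2_kernel n g \<Longrightarrow> L2_kernel n (\<lambda>t. f t - g t)"
proof -
  assume f: "L2_kernel n f" and g: "L2_kernel n g"
  note [measurable] = L2_kernel_measurable[OF f] L2_kernel_measurable[OF g]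
  have bound: "(cmod (x - y))\<^sup>2 \<le> 2 * (cmod x)\<^sup>2 + 2 * (cmod y)\<^sup>2" for x y
  proof -
    have "(cmod (x - y))\<^sup>2 \<le> (cmod x + cmod y)\<^sup>2" by (intro power_mono norm_triangle_ineq4) simp
    also have "\<dots> \<le> 2 * (cmod x)\<^sup>2 + 2 * (cmod y)\<^sup>2"
      using sum_squares_bound[of "cmod x" "cmod y"] by (simp add: power2_sum)
    finally show ?thesis .
  qed
  have "integrable (Rplus_power n) (\<lambda>t. (cmod (f t - g t))\<^sup>2)"
    by (rule Bochner_Integration.integrable_bound[where f = "\<lambda>t. 2 * (cmod (f t))\<^sup>2 + 2 * (cmod (g t))\<^sup>2"])
      (use f g bound in \<open>auto simp: L2_kernel_def intro!: AE_I2\<close>)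
  then show ?thesis by (simp add: L2_kernel_def)
qed

lemma square_integral_cong_AE:
  "(AE t in Rplus_power n. f t = g t) \<Longrightarrow> square_integral n f = square_integral n g"
  unfolding square_integral_def by (rule nn_integral_cong_AE) auto

lemma square_integral_eq_0_iff:
  "f \<in> borel_measurable (Rplus_power n) \<Longrightarrow> square_integral n f = 0 \<longleftrightarrow> (AE t in Rplus_power n. f t = 0)"
  unfolding square_integral_def by (subst nn_integral_0_iff_AE) auto

section \<open>Multiple integrals as vectors\<close>

context multiple_integral
begin

lemma I_minus: "L2_kernel n f \<Longrightarrow> I n (\<lambda>t. - f t) = - I n f"
  using I_scale[of n f "-1"] by (simp add: scaleC_minus_one)

lemma I_diff: "L2_kernel n f \<Longrightarrow> L2_kernel n g \<Longrightarrow> I n (\<lambda>t. f t - g t) = I n f - I n g"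
  using I_add[of n f "\<lambda>t. (-1) * g t"] L2_kernel_scale[of n g "-1"] I_minus[of n g] by simp

lemma norm_I: "L2_kernel n f \<Longrightarrow> ennreal ((norm (I n f))\<^sup>2) = square_integral n f"
proof -
  assume f: "L2_kernel n f"
  have "complex_of_real ((norm (I n f))\<^sup>2) = (\<integral>t. complex_of_real ((cmod (f t))\<^sup>2) \<partial>Rplus_power n)"
    using I_isometry[OF f f] by (simp add: cinner_self flip: complex_norm_square)
  also have "\<dots> = complex_of_real (\<integral>t. (cmod (f t))\<^sup>2 \<partial>Rplus_power n)" by (rule integral_complex_of_real)
  finally have "(norm (I n f))\<^sup>2 = (\<integral>t. (cmod (f t))\<^sup>2 \<partial>Rplus_power n)" unfolding of_real_eq_iff .
  then show ?thesis
    using f by (simp add: square_integral_def nn_integral_eq_integral L2_kernel_def)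
qed

lemma I_eq_0_iff: "L2_kernel n f \<Longrightarrow> I n f = 0 \<longleftrightarrow> (AE t in Rplus_power n. f t = 0)"
proof -
  assume f: "L2_kernel n f"
  have "I n f = 0 \<longleftrightarrow> ennreal ((norm (I n f))\<^sup>2) = 0" by simp
  then show ?thesis
    unfolding norm_I[OF f] square_integral_eq_0_iff[OF L2_kernel_measurable[OF f]] .
qed

lemma I_cong_AE:
  assumes "L2_kernel n f" "L2_kernel n g" "AE t in Rplus_power n. f t = g t"
  shows "I n f = I n g"
proof -
  have "I n (\<lambda>t. f t - g t) = 0"
    using assms by (subst I_eq_0_iff) (auto intro: L2_kernel_diff)
  then show ?thesis using assms by (simp add: I_diff)
qed

lemma I_cong:
  "L2_kernel n f \<Longrightarrow> L2_kernel n g \<Longrightarrow> (\<And>t. t \<in> space (Rplus_power n) \<Longrightarrow> f t = g t) \<Longrightarrow> I n f = I n g"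
  by (rule I_cong_AE) (auto intro: AE_I2)

lemma inner_I_orthogonal: "L2_kernel n f \<Longrightarrow> L2_kernel m g \<Longrightarrow> n \<noteq> m \<Longrightarrow> inner (I n f) (I m g) = 0"
  by (simp add: I_orthogonal flip: Re_cinner)

lemma I_0: "I 0 f = f (\<lambda>_. undefined) *\<^sub>C \<iota> id_blinfun"
proof -
  have "I 0 f = I 0 (\<lambda>_. f (\<lambda>_. undefined))"
    by (rule I_cong[OF L2_kernel_0 L2_kernel_0]) (simp add: space_point)
  then show ?thesis by (simp only: I_zero)
qed

lemma one_eq_I: "\<iota> id_blinfun = I 0 (\<lambda>_. 1)"
  by (simp add: I_zero)

lemma L2_state_one: "L2_state \<iota> (\<iota> id_blinfun) = 1"
  unfolding L2_state_def one_eq_I I_isometry[OF L2_kernel_0 L2_kernel_0] integral_point by simp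

lemma L2_state_I: "L2_kernel n f \<Longrightarrow> 1 \<le> n \<Longrightarrow> L2_state \<iota> (I n f) = 0"
  unfolding L2_state_def one_eq_I using I_orthogonal[of n f 0] L2_kernel_0 by simp

lemma norm_I_tensor:
  assumes "L2_kernel n f" "L2_kernel m g"
  shows "norm (I (n + m) (contraction n m 0 f g)) = norm (I n f) * norm (I m g)"
proof -
  have T: "L2_kernel (n + m) (contraction n m 0 f g)" using L2_kernel_contraction[OF assms, of 0] by simp
  have "ennreal ((norm (I (n + m) (contraction n m 0 f g)))\<^sup>2) = square_integral n f * square_integral m g"
    unfolding norm_I[OF T] by (intro square_integral_tensor L2_kernel_measurable assms)
  also have "\<dots> = ennreal ((norm (I n f))\<^sup>2) * ennreal ((norm (I m g))\<^sup>2)"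
    unfolding norm_I[OF assms(1)] norm_I[OF assms(2)] ..
  also have "\<dots> = ennreal ((norm (I n f) * norm (I m g))\<^sup>2)"
    unfolding power_mult_distrib by (rule ennreal_mult[symmetric]) simp_all
  finally have "(norm (I (n + m) (contraction n m 0 f g)))\<^sup>2 = (norm (I n f) * norm (I m g))\<^sup>2"
    by (subst (asm) ennreal_inj) simp_all
  then show ?thesis by (rule power2_eq_imp_eq) simp_all
qed

end

text \<open>The summands of the product formula are orthogonal, because they have different orders, and the
  one without contraction already has norm \<open>\<parallel>f\<parallel> \<parallel>g\<parallel>\<close>. If the product has the same norm, nothing is left for
  the other summands.\<close>

lemma (in free_poisson_integral) contractions_zero_if_norm_product:
  assumes f: "L2_kernel n f" and g: "L2_kernel m g"
    and Z: "L2_prod A \<phi> \<iota> (I n f) (I m g) Z" and norm: "norm Z = norm (I n f) * norm (I m g)"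
  shows "contractions_vanish n f m g"
    and "\<And>p. p \<in> {1..min n m} \<Longrightarrow>
      AE t in Rplus_power (n + m - 2 * p + 1). star_contraction n m p f g t = 0"
proof -
  let ?u = "\<lambda>p. I (n + m - 2 * p) (contraction n m p f g)"
  let ?v = "\<lambda>p. I (n + m - 2 * p + 1) (star_contraction n m p f g)"
  let ?K = "{..min n m} <+> {1..min n m}"
  have star: "\<And>p. p \<in> {1..min n m} \<Longrightarrow> L2_kernel (n + m - 2 * p + 1) (star_contraction n m p f g)"
    and Zeq: "Z = (\<Sum>p\<le>min n m. ?u p) + (\<Sum>p = 1..min n m. ?v p)"
    using Z poisson_product[OF f g, of Z] by blast+
  have L2: "L2_kernel (n + m - 2 * p) (contraction n m p f g)" if "p \<le> min n m" for p
    using that by (intro L2_kernel_contraction f g) auto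
  define ord where "ord = case_sum (\<lambda>p. n + m - 2 * p) (\<lambda>p. n + m - 2 * p + 1)"
  define ker where "ker = case_sum (\<lambda>p. contraction n m p f g) (\<lambda>p. star_contraction n m p f g)"
  have Iord: "case_sum ?u ?v i = I (ord i) (ker i)" for i by (cases i) (simp_all add: ord_def ker_def)
  have L2ord: "L2_kernel (ord i) (ker i)" if "i \<in> ?K" for i
  proof (cases i)
    case (Inl p)
    with that L2[of p] show ?thesis by (auto simp: ord_def ker_def)
  next
    case (Inr p)
    then have "p \<in> {1..min n m}" using that by auto
    from star[OF this] Inr show ?thesis by (simp only: ord_def ker_def sum.case)
  qed
  \<comment> \<open>The two kinds of summands have orders of different parity.\<close>
  have "i = j" if ij: "i \<in> ?K" "j \<in> ?K" "ord i = ord j" for i j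
  proof (cases i; cases j)
    fix p q assume "i = Inl p" "j = Inr q"
    then have "p \<le> n \<and> p \<le> m \<and> q \<le> n \<and> q \<le> m \<and> n + m - 2 * p = n + m - 2 * q + 1"
      using ij by (auto simp: ord_def)
    then have False by presburger
    then show ?thesis ..
  next
    fix p q assume "i = Inr p" "j = Inl q"
    then have "p \<le> n \<and> p \<le> m \<and> q \<le> n \<and> q \<le> m \<and> n + m - 2 * p + 1 = n + m - 2 * q"
      using ij by (auto simp: ord_def)
    then have False by presburger
    then show ?thesis ..
  qed (use ij in \<open>auto simp: ord_def\<close>)
  then have "pairwise (\<lambda>i j. orthogonal (case_sum ?u ?v i) (case_sum ?u ?v j)) ?K"
    unfolding Iord by (intro pairwiseI) (auto simp: orthogonal_def intro!: inner_I_orthogonal L2ord)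
  moreover have "Z = (\<Sum>i\<in>?K. case_sum ?u ?v i)" by (simp add: Zeq sum.Plus)
  ultimately have "(norm Z)\<^sup>2 = (\<Sum>i\<in>?K. (norm (case_sum ?u ?v i))\<^sup>2)"
    by (simp add: norm_sum_Pythagorean)
  also have "\<dots> = (\<Sum>p\<le>min n m. (norm (?u p))\<^sup>2) + (\<Sum>p = 1..min n m. (norm (?v p))\<^sup>2)"
    by (subst sum.Plus) auto
  also have "(\<Sum>p\<le>min n m. (norm (?u p))\<^sup>2) = (norm (?u 0))\<^sup>2 + (\<Sum>p = 1..min n m. (norm (?u p))\<^sup>2)"
    by (simp add: atMost_atLeast0 sum.atLeast_Suc_atMost)
  also have "norm (?u 0) = norm Z" using norm_I_tensor[OF f g] norm by simp
  finally have "(\<Sum>p = 1..min n m. (norm (?u p))\<^sup>2) + (\<Sum>p = 1..min n m. (norm (?v p))\<^sup>2) = 0" by simp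
  then have "(\<Sum>p = 1..min n m. (norm (?u p))\<^sup>2) = 0" "(\<Sum>p = 1..min n m. (norm (?v p))\<^sup>2) = 0"
    by (simp_all add: add_nonneg_eq_0_iff sum_nonneg)
  then have u0: "?u p = 0" and v0: "?v p = 0" if "p \<in> {1..min n m}" for p
    using that by (simp_all add: sum_nonneg_eq_0_iff)
  show "contractions_vanish n f m g"
    unfolding contractions_vanish_def
  proof (intro allI impI, elim conjE)
    fix p assume "1 \<le> p" "p \<le> n" "p \<le> m"
    then show "AE t in Rplus_power (n + m - 2 * p). contraction n m p f g t = 0"
      using I_eq_0_iff[OF L2[of p]] u0[of p] by simp
  qed
  fix p assume p: "p \<in> {1..min n m}"
  show "AE t in Rplus_power (n + m - 2 * p + 1). star_contraction n m p f g t = 0"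
    using v0[OF p] unfolding I_eq_0_iff[OF star[OF p]] .
qed

section \<open>Symmetric representatives\<close>

lemma measurable_compose_permutation:
  assumes "\<sigma> permutes {..<n}"
  shows "(\<lambda>t. t \<circ> \<sigma>) \<in> Rplus_power n \<rightarrow>\<^sub>M Rplus_power n"
proof -
  have "(\<lambda>t. \<lambda>i\<in>{..<n}. t (\<sigma> i)) \<in> Rplus_power n \<rightarrow>\<^sub>M Rplus_power n"
    unfolding Rplus_power_def
  proof (rule measurable_restrict)
    fix i assume "i \<in> {..<n}"
    then have "\<sigma> i \<in> {..<n}" using permutes_in_image[OF assms] by blast
    then show "(\<lambda>t. t (\<sigma> i)) \<in> Pi\<^sub>M {..<n} (\<lambda>_. half_line) \<rightarrow>\<^sub>M half_line"
      by (rule measurable_component_singleton)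
  qed
  moreover have "(\<lambda>i\<in>{..<n}. t (\<sigma> i)) = t \<circ> \<sigma>" if "t \<in> space (Rplus_power n)" for t
    using Rplus_power_extensional[OF that] permutes_not_in[OF assms] by (auto simp: fun_eq_iff restrict_def)
  ultimately show ?thesis by (simp cong: measurable_cong)
qed

text \<open>The points at which \<open>f\<close> is real and invariant under all permutations form a measurable set of
  full measure that is itself invariant; \<open>f\<close> is replaced by zero outside of it.\<close>

lemma symmetric_representative:
  assumes "symmetric_kernel n f"
  obtains f' where "symmetric_everywhere n f'" "L2_kernel n f'" "AE t in Rplus_power n. f t = f' t"
proof
  have f: "L2_kernel n f" using assms by (simp add: symmetric_kernel_def)
  note [measurable] = L2_kernel_measurable[OF f]
  define G where "G t \<longleftrightarrow> Im (f t) = 0 \<and> (\<forall>\<sigma>\<in>{\<sigma>. \<sigma> permutes {..<n}}. f (t \<circ> \<sigma>) = f t)" for t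
  define f' where "f' t = (if G t then f t else 0)" for t
  have "finite {\<sigma>. \<sigma> permutes {..<n}}" by (rule finite_permutations) simp
  then have "AE t in Rplus_power n. \<forall>\<sigma>\<in>{\<sigma>. \<sigma> permutes {..<n}}. f (t \<circ> \<sigma>) = f t"
    using assms by (intro AE_finite_allI) (auto simp: symmetric_kernel_def)
  moreover have "AE t in Rplus_power n. f t \<in> \<real>" using assms by (simp add: symmetric_kernel_def)
  ultimately show ae: "AE t in Rplus_power n. f t = f' t"
    by eventually_elim (simp add: f'_def G_def complex_is_Real_iff)
  have [measurable]: "Measurable.pred (Rplus_power n) G"
  proof -
    have "Measurable.pred (Rplus_power n) (\<lambda>t. f (t \<circ> \<sigma>) = f t)" if "\<sigma> permutes {..<n}" for \<sigma>
    proof -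
      have m: "(\<lambda>t. f (t \<circ> \<sigma>)) \<in> borel_measurable (Rplus_power n)"
        by (rule measurable_compose[OF measurable_compose_permutation[OF that] L2_kernel_measurable[OF f]])
      define d where "d t = f (t \<circ> \<sigma>) - f t" for t
      have [measurable]: "d \<in> borel_measurable (Rplus_power n)"
        unfolding d_def by (intro borel_measurable_diff m) measurable
      have "Measurable.pred (Rplus_power n) (\<lambda>t. d t = 0)" by measurable
      then show ?thesis by (simp add: d_def)
    qed
    then have [measurable]: "Measurable.pred (Rplus_power n) (\<lambda>t. \<forall>\<sigma>\<in>{\<sigma>. \<sigma> permutes {..<n}}. f (t \<circ> \<sigma>) = f t)"
      by (intro pred_intros_finite finite_permutations) auto
    show ?thesis unfolding G_def by measurable
  qed
  have m: "f' \<in> borel_measurable (Rplus_power n)" unfolding f'_def by measurable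
  then show "L2_kernel n f'" using f square_integral_cong_AE[OF ae] by (simp add: L2_kernel_iff)
  have Gcomp: "G (t \<circ> \<sigma>)" "f (t \<circ> \<sigma>) = f t" if "G t" "\<sigma> permutes {..<n}" for t \<sigma>
  proof -
    show eq: "f (t \<circ> \<sigma>) = f t" using that by (simp add: G_def)
    have "f (t \<circ> \<sigma> \<circ> \<rho>) = f t" if "\<rho> permutes {..<n}" for \<rho>
      using \<open>G t\<close> permutes_compose[OF that \<open>\<sigma> permutes {..<n}\<close>] by (simp add: G_def comp_assoc)
    then show "G (t \<circ> \<sigma>)" using that eq by (simp add: G_def)
  qed
  show "symmetric_everywhere n f'"
    unfolding symmetric_everywhere_def
  proof (intro ballI conjI allI impI)
    fix t show "f' t \<in> \<real>" by (simp add: f'_def G_def complex_is_Real_iff)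
  next
    fix t \<sigma> assume \<sigma>: "\<sigma> permutes {..<n}"
    have "G t" if "G (t \<circ> \<sigma>)"
    proof -
      have "t \<circ> \<sigma> \<circ> inv \<sigma> = t" using permutes_inv_o(1)[OF \<sigma>] by (simp add: comp_assoc)
      then show ?thesis using Gcomp(1)[OF that permutes_inv[OF \<sigma>]] by simp
    qed
    then show "f' (t \<circ> \<sigma>) = f' t" using Gcomp[OF _ \<sigma>, of t] by (auto simp: f'_def)
  qed
qed

section \<open>Powers of a Wigner integral\<close>

text \<open>The kernels that arise when powers of \<open>I n f\<close> are expanded by the product formula. Scaling is
  included so that the real span of the corresponding integrals is a complex subspace.\<close>

inductive power_kernel :: "nat \<Rightarrow> kernel \<Rightarrow> nat \<Rightarrow> kernel \<Rightarrow> bool" for n f where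
  unit: "power_kernel n f 0 (\<lambda>_. 1)"
| scale: "power_kernel n f k h \<Longrightarrow> power_kernel n f k (\<lambda>t. c * h t)"
| contract: "power_kernel n f k h \<Longrightarrow> p \<le> n \<Longrightarrow> p \<le> k \<Longrightarrow>
    power_kernel n f (n + k - 2 * p) (contraction n k p f h)"

lemma L2_power_kernel: "L2_kernel n f \<Longrightarrow> power_kernel n f k h \<Longrightarrow> L2_kernel k h"
  by (rotate_tac, induction rule: power_kernel.induct)
    (auto intro: L2_kernel_0 L2_kernel_scale L2_kernel_contraction)

lemma power_kernel_contractions_vanish:
  assumes f: "symmetric_everywhere n f" "L2_kernel n f" and w: "L2_kernel l w"
    and fw: "contractions_vanish n f l w"
    and h: "power_kernel n f k h"
  shows "contractions_vanish k h l w"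
  using h
proof (induction rule: power_kernel.induct)
  case unit
  then show ?case by (simp add: contractions_vanish_def)
next
  case (scale k h c)
  then show ?case by (intro contractions_vanish_scale_left)
next
  case (contract k h p)
  then show ?case
    by (intro contractions_vanish_contraction f w fw L2_power_kernel[OF f(2)]) auto
qed

text \<open>The closure property treats the left factor of a contraction. Taking adjoints exchanges the two
  factors, so it can be applied once for the powers of \<open>f\<close> and once for those of \<open>g\<close>; the first of the
  two families is left with adjoint kernels.\<close>

lemma power_kernels_contractions_vanish:
  assumes f: "symmetric_everywhere n f" "L2_kernel n f" and g: "symmetric_everywhere m g" "L2_kernel m g"
    and fg: "contractions_vanish n f m g"
    and h: "power_kernel n f k h" and q: "power_kernel m g l q"
  shows "contractions_vanish l q k (adjoint_kernel k h)"
proof (rule power_kernel_contractions_vanish[OF g _ _ q])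
  have hL: "L2_kernel k h" by (rule L2_power_kernel[OF f(2) h])
  then show "L2_kernel k (adjoint_kernel k h)" by (rule L2_kernel_adjoint)
  have "contractions_vanish k h m g" by (rule power_kernel_contractions_vanish[OF f g(2) fg h])
  from contractions_vanish_adjoint[OF this] show "contractions_vanish m g k (adjoint_kernel k h)"
    by (rule contractions_vanish_cong) (simp_all add: symmetric_everywhere_adjoint[OF g(1)])
qed

lemma scaleR_eq_scaleC: "r *\<^sub>R x = complex_of_real r *\<^sub>C (x :: 'a::complex_space)"
  by (simp add: scaleC_of_real)

lemma span_scaleC:
  fixes T :: "'a::complex_space set"
  assumes "\<And>v. v \<in> T \<Longrightarrow> c *\<^sub>C v \<in> span T" and "x \<in> span T"
  shows "c *\<^sub>C x \<in> span T"
proof -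
  have "span T \<subseteq> {v. c *\<^sub>C v \<in> span T}"
  proof (rule span_minimal)
    have "c *\<^sub>C (0::'a) = 0" using scaleC_add_right[of c 0 0] by simp
    then show "subspace {v. c *\<^sub>C v \<in> span T}"
      by (auto simp: subspace_def scaleC_add_right span_add span_zero scaleR_eq_scaleC scaleC_scaleC mult.commute)
        (metis scaleC_scaleC scaleR_eq_scaleC mult.commute span_scale)
  qed (use assms(1) in auto)
  then show ?thesis using assms(2) by auto
qed

locale wigner_chaos_algebra = wigner_integral A \<phi> \<iota> S I
  for A :: "('h::complex_hilbert \<Rightarrow>\<^sub>L 'h) set" and \<phi> and \<iota> :: "('h \<Rightarrow>\<^sub>L 'h) \<Rightarrow> 'l::complex_hilbert"
    and S I +
  fixes mul :: "'l \<Rightarrow> 'l \<Rightarrow> 'l"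
  assumes algebra: "L2_star_algebra A \<phi> \<iota> (span {I n f | n f. L2_kernel n f}) mul"
begin

sublocale alg: L2_star_algebra A \<phi> \<iota> "span {I n f | n f. L2_kernel n f}" mul
  by (rule algebra)

abbreviation (input) chaoses :: "'l set" where
  "chaoses \<equiv> span {I n f | n f. L2_kernel n f}"

abbreviation (input) one :: 'l where
  "one \<equiv> \<iota> id_blinfun"

lemma I_in_chaoses: "L2_kernel n f \<Longrightarrow> I n f \<in> chaoses"
  by (rule span_base) auto

lemma mul_I:
  "L2_kernel n f \<Longrightarrow> L2_kernel m g \<Longrightarrow>
    mul (I n f) (I m g) = (\<Sum>p\<le>min n m. I (n + m - 2 * p) (contraction n m p f g))"
  using alg.mul_L2_prod[OF I_in_chaoses I_in_chaoses, of n f m g] wigner_product[of n f m g] by blast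

lemma mul_I_tensor:
  assumes f: "L2_kernel n f" and g: "L2_kernel m g" and fg: "contractions_vanish n f m g"
  shows "mul (I n f) (I m g) = I (n + m) (contraction n m 0 f g)"
proof -
  have "I (n + m - 2 * p) (contraction n m p f g) = 0" if "p \<in> {..min n m} - {0}" for p
    using that fg L2_kernel_contraction[OF f g, of p]
    by (subst I_eq_0_iff) (auto simp: contractions_vanish_def)
  then have "(\<Sum>p\<le>min n m. I (n + m - 2 * p) (contraction n m p f g)) =
      (\<Sum>p\<in>{0}. I (n + m - 2 * p) (contraction n m p f g))"
    by (intro sum.mono_neutral_right) auto
  then show ?thesis by (simp add: mul_I[OF f g])
qed

lemma mul_right_scaleR: "x \<in> chaoses \<Longrightarrow> y \<in> chaoses \<Longrightarrow> mul x (r *\<^sub>R y) = r *\<^sub>R mul x y"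
  and mul_left_scaleR: "x \<in> chaoses \<Longrightarrow> y \<in> chaoses \<Longrightarrow> mul (r *\<^sub>R x) y = r *\<^sub>R mul x y"
  unfolding scaleR_eq_scaleC by (rule alg.mul_scale_right alg.mul_scale_left; assumption)+

lemma mul_zero: "x \<in> chaoses \<Longrightarrow> mul x 0 = 0" "x \<in> chaoses \<Longrightarrow> mul 0 x = 0"
  using mul_right_scaleR[of x x 0] mul_left_scaleR[of x x 0] by simp_all

lemma mul_in_subspace:
  assumes V: "subspace V" and T: "T \<subseteq> chaoses" and x: "x \<in> chaoses" and v: "v \<in> span T"
    and base: "\<And>t. t \<in> T \<Longrightarrow> mul x t \<in> V"
  shows "mul x v \<in> V"
proof -
  have "span T \<subseteq> {v \<in> chaoses. mul x v \<in> V}"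
    by (rule span_minimal)
      (use T base x V in \<open>auto simp: subspace_def span_zero span_add span_scale mul_zero alg.mul_add_right mul_right_scaleR\<close>)
  with v show ?thesis by auto
qed

lemma mul_in_subspace':
  assumes V: "subspace V" and T: "T \<subseteq> chaoses" and x: "x \<in> chaoses" and v: "v \<in> span T"
    and base: "\<And>t. t \<in> T \<Longrightarrow> mul t x \<in> V"
  shows "mul v x \<in> V"
proof -
  have "span T \<subseteq> {v \<in> chaoses. mul v x \<in> V}"
    by (rule span_minimal)
      (use T base x V in \<open>auto simp: subspace_def span_zero span_add span_scale mul_zero alg.mul_add_left mul_left_scaleR\<close>)
  with v show ?thesis by auto
qed

text \<open>A polynomial in \<open>I n f\<close> is a sum of integrals of power kernels, by expanding powers from the left,
  and also a sum of integrals of adjoints of power kernels, by expanding them from the right. The first form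
  suits multiplication of a word from the left; the second one describes a letter that is itself
  multiplied by another letter from the left. The parameter \<open>j\<close> bounds the orders from below, so
  \<open>j = 1\<close> describes centered elements.\<close>

definition left_chaos :: "nat \<Rightarrow> kernel \<Rightarrow> nat \<Rightarrow> 'l set" where
  "left_chaos n f j = span {I k h | k h. j \<le> k \<and> power_kernel n f k h}"

definition right_chaos :: "nat \<Rightarrow> kernel \<Rightarrow> nat \<Rightarrow> 'l set" where
  "right_chaos n f j = span {I k (adjoint_kernel k h) | k h. j \<le> k \<and> power_kernel n f k h}"

lemma power_in_chaoses: "X \<in> chaoses \<Longrightarrow> power_by mul one X j \<in> chaoses"
  by (induction j) (auto intro: alg.one_closed alg.mul_closed)

lemma power_commutes: "X \<in> chaoses \<Longrightarrow> mul X (power_by mul one X j) = mul (power_by mul one X j) X"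
proof (induction j)
  case (Suc j)
  have "mul (mul X (power_by mul one X j)) X = mul X (mul (power_by mul one X j) X)"
    by (intro alg.mul_assoc power_in_chaoses Suc.prems)
  then show ?case using Suc by simp
qed (simp add: alg.mul_one_left alg.mul_one_right)

lemma power_left_chaos:
  assumes f: "L2_kernel n f"
  shows "power_by mul one (I n f) j \<in> left_chaos n f 0"
proof (induction j)
  case 0
  have "\<exists>k h. \<iota> id_blinfun = I k h \<and> 0 \<le> k \<and> power_kernel n f k h"
    using power_kernel.unit one_eq_I by blast
  then show ?case unfolding left_chaos_def by (auto intro: span_base)
next
  case (Suc j)
  show ?case unfolding power_by.simps
  proof (rule mul_in_subspace[OF _ _ I_in_chaoses[OF f] Suc[unfolded left_chaos_def]])
    fix t assume "t \<in> {I k h | k h. 0 \<le> k \<and> power_kernel n f k h}"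
    then obtain k h where t: "t = I k h" and h: "power_kernel n f k h" by blast
    show "mul (I n f) t \<in> left_chaos n f 0"
      unfolding t mul_I[OF f L2_power_kernel[OF f h]] left_chaos_def
      by (intro span_sum span_base) (use power_kernel.contract[OF h] in auto)
  qed (auto simp: left_chaos_def intro!: I_in_chaoses L2_power_kernel[OF f])
qed

text \<open>Contracting \<open>h\<^sup>*\<close> with \<open>f = f\<^sup>*\<close> on the right gives the adjoint of a contraction of \<open>f\<close> with \<open>h\<close>.\<close>

lemma power_right_chaos:
  assumes f: "L2_kernel n f" "symmetric_everywhere n f"
  shows "power_by mul one (I n f) j \<in> right_chaos n f 0"
proof (induction j)
  case 0
  have "\<iota> id_blinfun = I 0 (adjoint_kernel 0 (\<lambda>_. 1))" by (simp add: I_0 adjoint_kernel_def)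
  then have "\<exists>k h. \<iota> id_blinfun = I k (adjoint_kernel k h) \<and> 0 \<le> k \<and> power_kernel n f k h"
    using power_kernel.unit by blast
  then show ?case unfolding right_chaos_def by (auto intro: span_base)
next
  case (Suc j)
  show ?case unfolding power_by.simps power_commutes[OF I_in_chaoses[OF f(1)]]
  proof (rule mul_in_subspace'[OF _ _ I_in_chaoses[OF f(1)] Suc[unfolded right_chaos_def]])
    fix t assume "t \<in> {I k (adjoint_kernel k h) | k h. 0 \<le> k \<and> power_kernel n f k h}"
    then obtain k h where t: "t = I k (adjoint_kernel k h)" and h: "power_kernel n f k h" by blast
    have hL: "L2_kernel k h" by (rule L2_power_kernel[OF f(1) h])
    have "I (k + n - 2 * p) (contraction k n p (adjoint_kernel k h) f) =
        I (n + k - 2 * p) (adjoint_kernel (n + k - 2 * p) (contraction n k p f h))" if p: "p \<le> k" "p \<le> n" for p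
      unfolding add.commute[of k n]
    proof (rule I_cong)
      show "L2_kernel (n + k - 2 * p) (contraction k n p (adjoint_kernel k h) f)"
        using L2_kernel_contraction[OF L2_kernel_adjoint[OF hL] f(1) p] unfolding add.commute[of k n] .
      show "L2_kernel (n + k - 2 * p) (adjoint_kernel (n + k - 2 * p) (contraction n k p f h))"
        by (intro L2_kernel_adjoint L2_kernel_contraction f hL p)
      fix t assume t: "t \<in> space (Rplus_power (n + k - 2 * p))"
      have "contraction k n p (adjoint_kernel k h) f t = contraction k n p (adjoint_kernel k h) (adjoint_kernel n f) t"
        by (rule contraction_cong) (use p t symmetric_everywhere_adjoint[OF f(2)] in \<open>auto simp: add.commute\<close>)
      then show "contraction k n p (adjoint_kernel k h) f t = adjoint_kernel (n + k - 2 * p) (contraction n k p f h) t"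
        using adjoint_kernel_contraction[OF p(2,1) t, of f h] by simp
    qed
    then have eq: "mul t (I n f) = (\<Sum>p\<le>min k n. I (n + k - 2 * p) (adjoint_kernel (n + k - 2 * p) (contraction n k p f h)))"
      unfolding t mul_I[OF L2_kernel_adjoint[OF hL] f(1)] by (intro sum.cong) auto
    show "mul t (I n f) \<in> right_chaos n f 0"
      unfolding eq right_chaos_def
      by (intro span_sum span_base) (use power_kernel.contract[OF h] in auto)
  qed (auto simp: right_chaos_def intro!: I_in_chaoses L2_kernel_adjoint[OF L2_power_kernel[OF f(1)]])
qed

lemma left_chaos_scaleC: "L2_kernel n f \<Longrightarrow> v \<in> left_chaos n f j \<Longrightarrow> c *\<^sub>C v \<in> left_chaos n f j"
  unfolding left_chaos_def
proof (rule span_scaleC)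
  fix v assume f: "L2_kernel n f" and "v \<in> {I k h | k h. j \<le> k \<and> power_kernel n f k h}"
  then obtain k h where v: "v = I k h" "j \<le> k" and h: "power_kernel n f k h" by blast
  have "c *\<^sub>C v = I k (\<lambda>t. c * h t)" using I_scale[OF L2_power_kernel[OF f h]] v by simp
  then show "c *\<^sub>C v \<in> span {I k h | k h. j \<le> k \<and> power_kernel n f k h}"
    using v power_kernel.scale[OF h] by (intro span_base) blast
qed

lemma right_chaos_scaleC: "L2_kernel n f \<Longrightarrow> v \<in> right_chaos n f j \<Longrightarrow> c *\<^sub>C v \<in> right_chaos n f j"
  unfolding right_chaos_def
proof (rule span_scaleC)
  fix v assume f: "L2_kernel n f" and "v \<in> {I k (adjoint_kernel k h) | k h. j \<le> k \<and> power_kernel n f k h}"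
  then obtain k h where v: "v = I k (adjoint_kernel k h)" "j \<le> k" and h: "power_kernel n f k h" by blast
  have "c *\<^sub>C v = I k (adjoint_kernel k (\<lambda>t. cnj c * h t))"
    using I_scale[OF L2_kernel_adjoint[OF L2_power_kernel[OF f h]], of c] v by (simp add: adjoint_kernel_def[abs_def])
  then show "c *\<^sub>C v \<in> span {I k (adjoint_kernel k h) | k h. j \<le> k \<and> power_kernel n f k h}"
    using v power_kernel.scale[OF h] by (intro span_base) blast
qed

text \<open>Integrals of positive order have state zero, and those of order zero are multiples of the unit, so
  subtracting the state removes exactly the part of order zero.\<close>

lemma center_in_span:
  assumes G: "\<And>k h. G k h \<Longrightarrow> L2_kernel k h" and v: "v \<in> span {I k h | k h. 0 \<le> k \<and> G k h}"
  shows "v - L2_state \<iota> v *\<^sub>C one \<in> span {I k h | k h. 1 \<le> k \<and> G k h}" (is "_ \<in> ?V")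
proof -
  have "span {I k h | k h. 0 \<le> k \<and> G k h} \<subseteq> {v. v - L2_state \<iota> v *\<^sub>C one \<in> ?V}"
  proof (rule span_minimal)
    have zero: "L2_state \<iota> 0 = 0" by (simp add: L2_state_def)
    show "subspace {v. v - L2_state \<iota> v *\<^sub>C one \<in> ?V}"
      unfolding subspace_def
    proof (intro conjI ballI allI; unfold mem_Collect_eq)
      show "0 - L2_state \<iota> 0 *\<^sub>C one \<in> ?V" by (simp add: zero span_zero)
    next
      fix x y assume "x - L2_state \<iota> x *\<^sub>C one \<in> ?V" "y - L2_state \<iota> y *\<^sub>C one \<in> ?V"
      then have "(x - L2_state \<iota> x *\<^sub>C one) + (y - L2_state \<iota> y *\<^sub>C one) \<in> ?V" by (rule span_add)
      then show "x + y - L2_state \<iota> (x + y) *\<^sub>C one \<in> ?V"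
        by (simp add: L2_state_add scaleC_add_left algebra_simps)
    next
      fix c x assume "x - L2_state \<iota> x *\<^sub>C one \<in> ?V"
      then have "c *\<^sub>R (x - L2_state \<iota> x *\<^sub>C one) \<in> ?V" by (rule span_scale)
      moreover have "L2_state \<iota> (c *\<^sub>R x) *\<^sub>C one = c *\<^sub>R (L2_state \<iota> x *\<^sub>C one)"
        by (simp add: scaleR_eq_scaleC L2_state_scaleC scaleC_scaleC)
      ultimately show "c *\<^sub>R x - L2_state \<iota> (c *\<^sub>R x) *\<^sub>C one \<in> ?V"
        by (simp add: scaleR_diff_right)
    qed
    show "{I k h | k h. 0 \<le> k \<and> G k h} \<subseteq> {v. v - L2_state \<iota> v *\<^sub>C one \<in> ?V}"
    proof clarify
      fix k h assume h: "G k h"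
      show "I k h - L2_state \<iota> (I k h) *\<^sub>C one \<in> ?V"
      proof (cases "k = 0")
        case True
        then show ?thesis by (simp add: I_0 L2_state_scaleC L2_state_one span_zero)
      next
        case False
        then have "1 \<le> k" by simp
        with h show ?thesis by (simp add: L2_state_I[OF G[OF h]] del: One_nat_def) (auto intro!: span_base)
      qed
    qed
  qed
  with v show ?thesis by auto
qed

lemma centered_polynomial_chaos:
  assumes f: "L2_kernel n f" "symmetric_everywhere n f" and b: "b \<in> polynomials_in mul one (I n f)"
  shows "b - L2_state \<iota> b *\<^sub>C one \<in> left_chaos n f 1" "b - L2_state \<iota> b *\<^sub>C one \<in> right_chaos n f 1"
proof -
  obtain P where P: "b = (\<Sum>k\<le>degree P. coeff P k *\<^sub>C power_by mul one (I n f) k)"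
    using b by (auto simp: polynomials_in_def poly_at_def)
  have "b \<in> left_chaos n f 0"
    unfolding P by (subst left_chaos_def, intro span_sum, fold left_chaos_def)
      (intro left_chaos_scaleC power_left_chaos f)
  then show "b - L2_state \<iota> b *\<^sub>C one \<in> left_chaos n f 1"
    unfolding left_chaos_def by (rule center_in_span[rotated]) (rule L2_power_kernel[OF f(1)])
  have set_eq: "{I k (adjoint_kernel k h) | k h. j \<le> k \<and> power_kernel n f k h} =
      {I k h' | k h'. j \<le> k \<and> (\<exists>h. h' = adjoint_kernel k h \<and> power_kernel n f k h)}" for j
    by blast
  have "b \<in> right_chaos n f 0"
    unfolding P by (subst right_chaos_def, intro span_sum, fold right_chaos_def)
      (intro right_chaos_scaleC power_right_chaos f)
  then show "b - L2_state \<iota> b *\<^sub>C one \<in> right_chaos n f 1"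
    unfolding right_chaos_def set_eq
    by (rule center_in_span[rotated]) (auto intro: L2_kernel_adjoint[OF L2_power_kernel[OF f(1)]])
qed

section \<open>Freeness of Wigner integrals\<close>

text \<open>The graph of the map \<open>I h \<mapsto> I (h \<otimes> q)\<close>. Given as a span of pairs, it is linear by construction,
  and only its single-valuedness is left to show.\<close>

definition tensor_graph :: "nat \<Rightarrow> kernel \<Rightarrow> ('l \<times> 'l) set" where
  "tensor_graph d q = span {(I k h, I (k + d) (contraction k d 0 h q)) | k h. L2_kernel k h}"

text \<open>For two kernels of the same order this is Fubini's theorem, and kernels of different orders give
  zero on both sides; bilinearity extends it to the spans.\<close>

lemma inner_tensor_graph:
  assumes q: "L2_kernel d q" and x: "x \<in> tensor_graph d q" and y: "y \<in> tensor_graph d q"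
  shows "inner (snd x) (snd y) = (norm (I d q))\<^sup>2 * inner (fst x) (fst y)"
proof -
  let ?T = "{(I k h, I (k + d) (contraction k d 0 h q)) | k h. L2_kernel k h}"
  let ?P = "\<lambda>x y. inner (snd x) (snd y) = (norm (I d q))\<^sup>2 * inner (fst x :: 'l) (fst y)"
  have T: "L2_kernel (k + d) (contraction k d 0 h q)" if "L2_kernel k h" for k h
    using L2_kernel_contraction[OF that q, of 0] by simp
  have base: "?P x y" if xT: "x \<in> ?T" and yT: "y \<in> ?T" for x y
  proof -
    obtain k h k' h' where x: "x = (I k h, I (k + d) (contraction k d 0 h q))" and h: "L2_kernel k h"
      and y: "y = (I k' h', I (k' + d) (contraction k' d 0 h' q))" and h': "L2_kernel k' h'"
      using xT yT by auto
    show ?thesis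
    proof (cases "k = k'")
      case True
      with h' have h': "L2_kernel k h'" by simp
      have "cinner (I (k + d) (contraction k d 0 h q)) (I (k + d) (contraction k d 0 h' q)) =
          cinner (I k h) (I k h') * cinner (I d q) (I d q)"
        by (simp add: I_isometry T h h' q integral_tensor)
      from arg_cong[OF this, of Re] show ?thesis
        by (simp add: x y True[symmetric] cinner_self Re_cinner del: of_real_power)
    next
      case False
      then show ?thesis by (simp add: x y inner_I_orthogonal T h h')
    qed
  qed
  have "span ?T \<subseteq> {y. ?P x y}" if "\<And>y. y \<in> ?T \<Longrightarrow> ?P x y" for x
    by (rule span_minimal) (use that in \<open>auto simp: subspace_def inner_add_right algebra_simps\<close>)
  moreover have "span ?T \<subseteq> {x. ?P x y}" if "\<And>x. x \<in> ?T \<Longrightarrow> ?P x y" for y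
    by (rule span_minimal) (use that in \<open>auto simp: subspace_def inner_add_left algebra_simps\<close>)
  ultimately show ?thesis using base x y unfolding tensor_graph_def by blast
qed

text \<open>In particular \<open>I (h \<otimes> q)\<close> summed over two representations of the same vector gives the same
  result; this mediates between the left and the right form of a polynomial.\<close>

lemma tensor_graph_functional:
  assumes q: "L2_kernel d q" and "(a, b) \<in> tensor_graph d q" "(a, c) \<in> tensor_graph d q"
  shows "b = c"
proof -
  have "(a, b) - (a, c) \<in> tensor_graph d q" using assms(2,3) unfolding tensor_graph_def by (rule span_diff)
  from inner_tensor_graph[OF q this this] show ?thesis by simp
qed

text \<open>It contains the alternating products of centered polynomials whose first letter is a polynomial in
  \<open>I n f\<close>: only the first factor of the kernel is specified. All orders are positive.\<close>

definition word_chaos :: "nat \<Rightarrow> kernel \<Rightarrow> 'l set" where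
  "word_chaos n f = span {I (k + l) (contraction k l 0 (adjoint_kernel k h) w) | k h l w.
     1 \<le> k \<and> power_kernel n f k h \<and> L2_kernel l w}"

lemma word_chaos_in_chaoses: assumes f: "L2_kernel n f" shows "word_chaos n f \<subseteq> chaoses"
  unfolding word_chaos_def
proof (rule span_minimal)
  show "{I (k + l) (contraction k l 0 (adjoint_kernel k h) w) | k h l w.
     1 \<le> k \<and> power_kernel n f k h \<and> L2_kernel l w} \<subseteq> chaoses"
    using L2_kernel_contraction[OF L2_kernel_adjoint[OF L2_power_kernel[OF f]], of _ _ _ _ 0]
    by (auto intro!: I_in_chaoses)
qed simp

lemma L2_state_word_chaos:
  assumes f: "L2_kernel n f" and v: "v \<in> word_chaos n f"
  shows "L2_state \<iota> v = 0"
proof -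
  have "word_chaos n f \<subseteq> {v. L2_state \<iota> v = 0}"
    unfolding word_chaos_def
  proof (rule span_minimal)
    show "subspace {v. L2_state \<iota> v = 0}"
      by (auto simp: subspace_def L2_state_add scaleR_eq_scaleC L2_state_scaleC) (simp add: L2_state_def)
    show "{I (k + l) (contraction k l 0 (adjoint_kernel k h) w) | k h l w.
       1 \<le> k \<and> power_kernel n f k h \<and> L2_kernel l w} \<subseteq> {v. L2_state \<iota> v = 0}"
      using L2_kernel_contraction[OF L2_kernel_adjoint[OF L2_power_kernel[OF f]], of _ _ _ _ 0]
      by (auto intro!: L2_state_I)
  qed
  with v show ?thesis by auto
qed

lemma right_chaos_subset_word_chaos:
  assumes f: "L2_kernel n f" shows "right_chaos n f 1 \<subseteq> word_chaos n f"
  unfolding right_chaos_def word_chaos_def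
proof (rule span_mono, clarify)
  fix k h assume k: "1 \<le> k" and h: "power_kernel n f k h"
  note hL = L2_kernel_adjoint[OF L2_power_kernel[OF f h]]
  have "I k (adjoint_kernel k h) = I (k + 0) (contraction k 0 0 (adjoint_kernel k h) (\<lambda>_. 1))"
    unfolding add_0_right
  proof (rule I_cong[OF hL])
    show "L2_kernel k (contraction k 0 0 (adjoint_kernel k h) (\<lambda>_. 1))"
      using L2_kernel_contraction[OF hL L2_kernel_0, of 0] by simp
    fix t assume t: "t \<in> space (Rplus_power k)"
    show "adjoint_kernel k h t = contraction k 0 0 (adjoint_kernel k h) (\<lambda>_. 1) t"
      using contraction_0_juxt[OF t point_in_space, of "adjoint_kernel k h" "\<lambda>_. 1"] t by simp
  qed
  then show "\<exists>k' h' l w. I k (adjoint_kernel k h) = I (k' + l) (contraction k' l 0 (adjoint_kernel k' h') w) \<and>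
      1 \<le> k' \<and> power_kernel n f k' h' \<and> L2_kernel l w"
    using k h L2_kernel_0 by blast
qed

text \<open>In its left form, the letter is a sum of integrals of power kernels of \<open>f\<close>. All contractions of
  these with the first factor of the word vanish, so multiplication by the word \<open>I q\<close> is tensoring with \<open>q\<close>.
  Tensoring may be computed from the right form of the letter instead, which puts an adjoint power
  kernel of \<open>f\<close> in front of \<open>q\<close>.\<close>

lemma letter_mul_word_chaos:
  assumes f: "L2_kernel n f" "symmetric_everywhere n f" and g: "L2_kernel m g" "symmetric_everywhere m g"
    and gf: "contractions_vanish m g n f"
    and aL: "a \<in> left_chaos n f 1" and aR: "a \<in> right_chaos n f 1" and v: "v \<in> word_chaos m g"
  shows "mul a v \<in> word_chaos n f"
proof -
  have left_sub: "{I k h | k h. 1 \<le> k \<and> power_kernel n f k h} \<subseteq> chaoses"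
    by (auto intro!: I_in_chaoses L2_power_kernel[OF f(1)])
  have aW: "a \<in> chaoses" using aL span_minimal[OF left_sub subspace_span] by (auto simp: left_chaos_def)
  show ?thesis
  proof (rule mul_in_subspace[OF _ _ aW v[unfolded word_chaos_def]])
    show "subspace (word_chaos n f)" by (simp add: word_chaos_def)
    show "{I (k + l) (contraction k l 0 (adjoint_kernel k h) w) | k h l w.
       1 \<le> k \<and> power_kernel m g k h \<and> L2_kernel l w} \<subseteq> chaoses"
      using word_chaos_in_chaoses[OF g(1)] unfolding word_chaos_def by (rule order_trans[OF span_superset])
    fix t assume "t \<in> {I (k + l) (contraction k l 0 (adjoint_kernel k h) w) | k h l w.
       1 \<le> k \<and> power_kernel m g k h \<and> L2_kernel l w}"
    then obtain k h l w where t: "t = I (k + l) (contraction k l 0 (adjoint_kernel k h) w)"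
      and k: "1 \<le> k" and h: "power_kernel m g k h" and w: "L2_kernel l w" by blast
    define d where "d = k + l"
    define q where "q = contraction k l 0 (adjoint_kernel k h) w"
    note hL = L2_kernel_adjoint[OF L2_power_kernel[OF g(1) h]]
    have q: "L2_kernel d q" using L2_kernel_contraction[OF hL w, of 0] by (simp add: d_def q_def)
    have tq: "t = I d q" by (simp add: t d_def q_def)
    \<comment> \<open>Left form: multiplication by \<open>t\<close> is tensoring with \<open>q\<close>.\<close>
    have left: "(a, mul a t) \<in> tensor_graph d q"
    proof -
      have "left_chaos n f 1 \<subseteq> {a \<in> chaoses. (a, mul a t) \<in> tensor_graph d q}"
        unfolding left_chaos_def
      proof (rule span_minimal)
        show "{I k h | k h. 1 \<le> k \<and> power_kernel n f k h} \<subseteq> {a \<in> chaoses. (a, mul a t) \<in> tensor_graph d q}"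
        proof clarify
          fix k' h' assume h': "power_kernel n f k' h'"
          note h'L = L2_power_kernel[OF f(1) h']
          have "contractions_vanish k' h' k (adjoint_kernel k h)"
            by (rule power_kernels_contractions_vanish[OF g(2,1) f(2,1) gf h h'])
          then have "contractions_vanish k' h' d q"
            unfolding d_def q_def by (rule contractions_vanish_tensor[OF h'L hL w k])
          then have "mul (I k' h') t = I (k' + d) (contraction k' d 0 h' q)"
            unfolding tq by (rule mul_I_tensor[OF h'L q])
          then show "I k' h' \<in> chaoses \<and> (I k' h', mul (I k' h') t) \<in> tensor_graph d q"
            unfolding tensor_graph_def using h'L by (auto intro!: span_base I_in_chaoses)
        qed
        have tW: "t \<in> chaoses" unfolding tq by (rule I_in_chaoses[OF q])
        show "subspace {a \<in> chaoses. (a, mul a t) \<in> tensor_graph d q}"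
          unfolding subspace_def
        proof (intro conjI ballI allI)
          show "0 \<in> {a \<in> chaoses. (a, mul a t) \<in> tensor_graph d q}"
            using tW by (auto simp: mul_zero tensor_graph_def zero_prod_def[symmetric] span_zero)
        next
          fix x y assume "x \<in> {a \<in> chaoses. (a, mul a t) \<in> tensor_graph d q}"
            "y \<in> {a \<in> chaoses. (a, mul a t) \<in> tensor_graph d q}"
          then show "x + y \<in> {a \<in> chaoses. (a, mul a t) \<in> tensor_graph d q}"
            using span_add[of "(x, mul x t)" _ "(y, mul y t)"] tW
            by (auto simp: tensor_graph_def alg.mul_add_left span_add)
        next
          fix c x assume "x \<in> {a \<in> chaoses. (a, mul a t) \<in> tensor_graph d q}"
          then show "c *\<^sub>R x \<in> {a \<in> chaoses. (a, mul a t) \<in> tensor_graph d q}"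
            using span_scale[of "(x, mul x t)" _ c] tW
            by (auto simp: tensor_graph_def mul_left_scaleR span_scale)
        qed
      qed
      with aL show ?thesis by auto
    qed
    \<comment> \<open>Right form: tensoring with \<open>q\<close> leads into the word space of \<open>f\<close>.\<close>
    have "\<exists>b\<in>word_chaos n f. (a, b) \<in> tensor_graph d q"
    proof -
      have "right_chaos n f 1 \<subseteq> {a. \<exists>b\<in>word_chaos n f. (a, b) \<in> tensor_graph d q}"
        unfolding right_chaos_def
      proof (rule span_minimal)
        show "{I k (adjoint_kernel k h) | k h. 1 \<le> k \<and> power_kernel n f k h} \<subseteq>
            {a. \<exists>b\<in>word_chaos n f. (a, b) \<in> tensor_graph d q}"
        proof clarify
          fix k' h' assume k': "1 \<le> k'" and h': "power_kernel n f k' h'"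
          note h'L = L2_kernel_adjoint[OF L2_power_kernel[OF f(1) h']]
          let ?b = "I (k' + d) (contraction k' d 0 (adjoint_kernel k' h') q)"
          have "?b \<in> word_chaos n f" unfolding word_chaos_def using k' h' q by (intro span_base) blast
          moreover have "(I k' (adjoint_kernel k' h'), ?b) \<in> tensor_graph d q"
            unfolding tensor_graph_def using h'L by (intro span_base) blast
          ultimately show "\<exists>b\<in>word_chaos n f. (I k' (adjoint_kernel k' h'), b) \<in> tensor_graph d q" by blast
        qed
        show "subspace {a. \<exists>b\<in>word_chaos n f. (a, b) \<in> tensor_graph d q}"
          unfolding subspace_def
        proof (intro conjI ballI allI)
          have "(0, 0) \<in> tensor_graph d q" by (auto simp: tensor_graph_def zero_prod_def[symmetric] span_zero)
          then show "0 \<in> {a. \<exists>b\<in>word_chaos n f. (a, b) \<in> tensor_graph d q}"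
            by (auto simp: word_chaos_def span_zero)
        next
          fix x y assume "x \<in> {a. \<exists>b\<in>word_chaos n f. (a, b) \<in> tensor_graph d q}"
            "y \<in> {a. \<exists>b\<in>word_chaos n f. (a, b) \<in> tensor_graph d q}"
          then obtain b c where b: "b \<in> word_chaos n f" "(x, b) \<in> tensor_graph d q"
            and c: "c \<in> word_chaos n f" "(y, c) \<in> tensor_graph d q" by blast
          then have "b + c \<in> word_chaos n f" "(x + y, b + c) \<in> tensor_graph d q"
            using span_add[of "(x, b)" _ "(y, c)"] by (auto simp: tensor_graph_def word_chaos_def span_add)
          then show "x + y \<in> {a. \<exists>b\<in>word_chaos n f. (a, b) \<in> tensor_graph d q}" by blast
        next
          fix c x assume "x \<in> {a. \<exists>b\<in>word_chaos n f. (a, b) \<in> tensor_graph d q}"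
          then obtain b where "b \<in> word_chaos n f" "(x, b) \<in> tensor_graph d q" by blast
          then have "c *\<^sub>R b \<in> word_chaos n f" "(c *\<^sub>R x, c *\<^sub>R b) \<in> tensor_graph d q"
            using span_scale[of "(x, b)" _ c] by (auto simp: tensor_graph_def word_chaos_def span_scale)
          then show "c *\<^sub>R x \<in> {a. \<exists>b\<in>word_chaos n f. (a, b) \<in> tensor_graph d q}" by blast
        qed
      qed
      with aR show ?thesis by auto
    qed
    then show "mul a t \<in> word_chaos n f" using tensor_graph_functional[OF q left] by blast
  qed
qed

text \<open>Alternating products are built from right to left, each letter moving the product between the
  two word spaces, on which the state vanishes.\<close>

theorem free_if_contractions_vanish:
  assumes f: "L2_kernel n f" "symmetric_everywhere n f" and g: "L2_kernel m g" "symmetric_everywhere m g"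
    and fg: "contractions_vanish n f m g" and gf: "contractions_vanish m g n f"
  shows "L2_free A \<phi> \<iota> [I n f, I m g]"
proof -
  let ?Xs = "[I n f, I m g]" and ?\<tau> = "L2_state \<iota>"
  define ord where "ord i = (if i = 0 then n else m)" for i :: nat
  define ker where "ker i = (if i = 0 then f else g)" for i :: nat
  have ker: "L2_kernel (ord i) (ker i)" "symmetric_everywhere (ord i) (ker i)" for i
    using f g by (simp_all add: ord_def ker_def)
  have letter: "b - ?\<tau> b *\<^sub>C one \<in> left_chaos (ord i) (ker i) 1" "b - ?\<tau> b *\<^sub>C one \<in> right_chaos (ord i) (ker i) 1"
    if "i < 2" "b \<in> map (polynomials_in mul one) ?Xs ! i" for i b
  proof -
    from that have "b \<in> polynomials_in mul one (I (ord i) (ker i))"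
      by (auto simp: ord_def ker_def nth_Cons split: nat.splits)
    from centered_polynomial_chaos[OF ker this]
    show "b - ?\<tau> b *\<^sub>C one \<in> left_chaos (ord i) (ker i) 1" "b - ?\<tau> b *\<^sub>C one \<in> right_chaos (ord i) (ker i) 1" .
  qed
  have word: "foldr mul (map (\<lambda>(i, b). b - ?\<tau> b *\<^sub>C one) u) one \<in> word_chaos (ord (fst (hd u))) (ker (fst (hd u)))"
    if "u \<noteq> []" "\<forall>(i, b) \<in> set u. i < 2 \<and> b \<in> map (polynomials_in mul one) ?Xs ! i" "distinct_adj (map fst u)" for u
    using that
  proof (induction u)
    case (Cons x u)
    obtain i b where x: "x = (i, b)" by (cases x)
    have ib: "i < 2" "b \<in> map (polynomials_in mul one) ?Xs ! i" using Cons.prems x by auto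
    note a = letter[OF ib]
    show ?case
    proof (cases u)
      case Nil
      have "b - ?\<tau> b *\<^sub>C one \<in> word_chaos (ord i) (ker i)"
        using right_chaos_subset_word_chaos[OF ker(1)] a(2) by blast
      moreover from this have "b - ?\<tau> b *\<^sub>C one \<in> chaoses" using word_chaos_in_chaoses[OF ker(1)] by blast
      ultimately show ?thesis using Nil x by (simp add: alg.mul_one_right)
    next
      case (Cons y u')
      obtain i' b' where y: "y = (i', b')" by (cases y)
      have i': "i' < 2" "i \<noteq> i'" using Cons.prems Cons x y by auto
      have "contractions_vanish (ord i') (ker i') (ord i) (ker i)"
        using ib(1) i' fg gf by (auto simp: ord_def ker_def)
      moreover have "foldr mul (map (\<lambda>(i, b). b - ?\<tau> b *\<^sub>C one) u) one \<in> word_chaos (ord i') (ker i')"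
        using Cons.IH Cons.prems Cons y by simp
      ultimately have "mul (b - ?\<tau> b *\<^sub>C one) (foldr mul (map (\<lambda>(i, b). b - ?\<tau> b *\<^sub>C one) u) one)
          \<in> word_chaos (ord i) (ker i)"
        by (intro letter_mul_word_chaos[OF ker ker _ a])
      then show ?thesis by (simp add: x)
    qed
  qed simp
  have "free_elements mul one ?\<tau> ?Xs"
    unfolding free_elements_def free_sets_def
    using L2_state_word_chaos[OF ker(1) word] by (simp add: numeral_2_eq_2)
  then show ?thesis
    unfolding L2_free_def using algebra I_in_chaoses[OF f(1)] I_in_chaoses[OF g(1)]
    by (intro exI[of _ chaoses] exI[of _ mul]) simp
qed

end

section \<open>Kernels of one variable\<close>

(* The order 1 of a kernel is kept as a numeral below. *)
declare One_nat_def [simp del]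

definition interval_points :: "real \<Rightarrow> real \<Rightarrow> (nat \<Rightarrow> real) set" where
  "interval_points a b = PiE {..<1} (\<lambda>_. {a..b})"

abbreviation interval_kernel :: "real \<Rightarrow> real \<Rightarrow> kernel" where
  "interval_kernel a b \<equiv> box_kernel 1 (\<lambda>_. a) (\<lambda>_. b)"

lemma interval_kernel_eq: "interval_kernel a b = indicator (interval_points a b)"
  by (simp add: box_kernel_def interval_points_def)

lemma interval_points_sets:
  assumes "0 \<le> a" shows "interval_points a b \<in> sets (Rplus_power 1)"
proof -
  have "{a..b} \<in> sets half_line" using assms by (subst sets_restrict_space_iff) auto
  then show ?thesis unfolding interval_points_def Rplus_power_def by (intro sets_PiM_I_finite) auto
qed

lemma emeasure_interval_points:
  assumes "0 \<le> a" "a \<le> b" shows "emeasure (Rplus_power 1) (interval_points a b) = ennreal (b - a)"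
proof -
  have s: "{a..b} \<in> sets half_line" using assms by (subst sets_restrict_space_iff) auto
  have "emeasure (Rplus_power 1) (interval_points a b) = (\<Prod>i<(1::nat). emeasure half_line {a..b})"
    unfolding interval_points_def Rplus_power_def using s by (intro half_line.emeasure_PiM) auto
  also have "\<dots> = ennreal (b - a)"
    using assms by (simp add: emeasure_restrict_space)
  finally show ?thesis .
qed

lemma L2_interval_kernel:
  assumes "0 \<le> a" "a \<le> b" shows "L2_kernel 1 (interval_kernel a b)"
proof -
  note [measurable] = interval_points_sets[OF assms(1), of b]
  have "ennreal ((cmod (indicator (interval_points a b) t))\<^sup>2) = indicator (interval_points a b) t" for t
    by (auto simp: indicator_def)
  then have "square_integral 1 (indicator (interval_points a b)) = emeasure (Rplus_power 1) (interval_points a b)"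
    by (simp add: square_integral_def)
  then show ?thesis
    unfolding L2_kernel_iff interval_kernel_eq by (simp add: emeasure_interval_points[OF assms])
qed

lemma integral_interval_kernel:
  assumes "0 \<le> a" "a \<le> b"
  shows "integrable (Rplus_power 1) (interval_kernel a b)"
    and "(\<integral>t. interval_kernel a b t \<partial>Rplus_power 1) = complex_of_real (b - a)"
proof -
  note s = interval_points_sets[OF assms(1), of b]
  have eq: "interval_kernel a b = (\<lambda>t. complex_of_real (indicator (interval_points a b) t))"
    by (auto simp: interval_kernel_eq indicator_def)
  show "integrable (Rplus_power 1) (interval_kernel a b)"
    unfolding eq using s by (intro integrable_of_real) (simp add: emeasure_interval_points[OF assms])
  show "(\<integral>t. interval_kernel a b t \<partial>Rplus_power 1) = complex_of_real (b - a)"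
    unfolding eq integral_complex_of_real using sets.sets_into_space[OF s] assms
    by (simp add: measure_def emeasure_interval_points Int_absorb2)
qed

lemma symmetric_everywhere_order_1:
  assumes "\<And>t. f t \<in> \<real>" shows "symmetric_everywhere 1 f"
proof -
  have id: "\<sigma> = id" if "\<sigma> permutes {..<1}" for \<sigma> :: "nat \<Rightarrow> nat"
  proof
    fix i show "\<sigma> i = id i"
      using permutes_in_image[OF that, of i] permutes_not_in[OF that, of i] by (cases "i < 1") auto
  qed
  have "t \<circ> \<sigma> = t" if "\<sigma> permutes {..<1}" for \<sigma> and t :: "nat \<Rightarrow> real"
    using id[OF that] by simp
  then show ?thesis using assms by (simp add: symmetric_everywhere_def)
qed

lemma symmetric_kernelI:
  "L2_kernel n f \<Longrightarrow> symmetric_everywhere n f \<Longrightarrow> symmetric_kernel n f"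
  by (auto simp: symmetric_kernel_def symmetric_everywhere_def)

text \<open>It is orthogonal to the indicator function of \<open>[0, 2]\<close>, but its pointwise product with that function
  is the kernel itself. For kernels of one variable the first contraction is the integral of the
  product, and the star contraction is the pointwise product.\<close>

definition two_step_kernel :: kernel where
  "two_step_kernel t = interval_kernel 0 1 t - interval_kernel 1 2 t"

lemma L2_two_step: "L2_kernel 1 two_step_kernel"
  unfolding two_step_kernel_def by (intro L2_kernel_diff L2_interval_kernel) auto

lemma interval_kernel_real: "interval_kernel a b t \<in> \<real>" "two_step_kernel t \<in> \<real>"
  by (auto simp: interval_kernel_eq two_step_kernel_def indicator_def)

lemma interval_times_two_step: "interval_kernel 0 2 t * two_step_kernel t = two_step_kernel t"
proof -
  have "interval_points 0 1 \<subseteq> interval_points 0 2" "interval_points 1 2 \<subseteq> interval_points 0 2"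
    unfolding interval_points_def by (intro PiE_mono; simp)+
  then show ?thesis by (auto simp: two_step_kernel_def interval_kernel_eq indicator_def)
qed

lemma two_step_not_zero: "\<not> (AE t in Rplus_power 1. two_step_kernel t = 0)"
proof
  let ?Q = "interval_points 0 (1/2)"
  assume zero: "AE t in Rplus_power 1. two_step_kernel t = 0"
  have one: "two_step_kernel t = 1" if t: "t \<in> ?Q" for t
  proof -
    have "t 0 \<in> {0..1/2}" using t unfolding interval_points_def by (rule PiE_mem) simp
    then have "t \<notin> interval_points 1 2" by (auto simp: interval_points_def PiE_def Pi_def)
    moreover have "t \<in> interval_points 0 1"
      using t PiE_mono[of "{..<1::nat}" "\<lambda>_. {0..1/2::real}" "\<lambda>_. {0..1}"] by (auto simp: interval_points_def)
    ultimately show ?thesis by (simp add: two_step_kernel_def interval_kernel_eq)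
  qed
  from zero have "AE t in Rplus_power 1. t \<notin> ?Q" by eventually_elim (use one in force)
  then have "emeasure (Rplus_power 1) ?Q = 0"
    using interval_points_sets[of 0 "1/2"] by (subst (asm) AE_iff_measurable[where N = ?Q])
      (use sets.sets_into_space in auto)
  then show False by (simp add: emeasure_interval_points)
qed

lemma contractions_vanish_order_1:
  assumes f: "f \<in> borel_measurable (Rplus_power 1)" and g: "g \<in> borel_measurable (Rplus_power 1)"
    and zero: "(\<integral>t. f t * g t \<partial>Rplus_power 1) = 0"
  shows "contractions_vanish 1 f 1 g"
  unfolding contractions_vanish_def
proof (intro allI impI, elim conjE)
  fix p :: nat assume "1 \<le> p" "p \<le> 1"
  then have p: "p = 1" by simp
  have flip1: "flip 1 s = s" if "s \<in> space (Rplus_power 1)" for s :: "nat \<Rightarrow> real"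
    using that by (auto simp: flip_def fun_eq_iff Rplus_power_extensional)
  have "contraction 1 1 1 f g t = 0" if "t \<in> space (Rplus_power 0)" for t
  proof -
    have "contraction 1 1 1 f g t = (\<integral>s. f s * g (juxt 1 (flip 1 s) t) \<partial>Rplus_power 1)"
      using contraction_juxt[of 1 1 1 "\<lambda>_. undefined" t f g] that by simp
    also have "\<dots> = (\<integral>s. f s * g s \<partial>Rplus_power 1)"
      by (rule Bochner_Integration.integral_cong) (use that in \<open>simp_all add: flip1\<close>)
    finally show ?thesis using zero by simp
  qed
  then show "AE t in Rplus_power (1 + 1 - 2 * p). contraction 1 1 p f g t = 0"
    unfolding p by (auto intro!: AE_I2)
qed

lemma (in free_poisson_integral) interval_integral_bounded:
  assumes "L2_completion A \<phi> \<iota>" and "0 \<le> a" "a \<le> b"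
  shows "I 1 (interval_kernel a b) \<in> \<iota> ` A"
proof -
  interpret L2_completion A \<phi> \<iota> by fact
  have "N t \<in> A" if "0 \<le> t" for t
    using poisson that unfolding free_poisson_process_def von_neumann_filtration_def
      von_neumann_filtration_axioms_def by blast
  then have "compensated N t \<in> A" if "0 \<le> t" for t
    using that by (simp add: compensated_def diff_mem scaleR_eq_scaleC scaleC_mem id_mem)
  then have "compensated N b - compensated N a \<in> A" using assms by (intro diff_mem) auto
  moreover have "I 1 (interval_kernel a b) = \<iota> (compensated N b - compensated N a)"
    by (subst I_box) (use assms in \<open>simp_all add: One_nat_def\<close>)
  ultimately show ?thesis by blast
qed

section \<open>Comparison of the two kinds of freeness\<close>

text \<open>The product taken in the other order has the same norm, which yields the contractions with \<open>f\<close> and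
  \<open>g\<close> exchanged.\<close>

lemma (in free_poisson_integral) free_imp_contractions_vanish:
  assumes "L2_completion A \<phi> \<iota>"
    and f: "L2_kernel n f" "symmetric_everywhere n f" and g: "L2_kernel m g" "symmetric_everywhere m g"
    and free: "L2_free A \<phi> \<iota> [I n f, I m g]"
  shows "contractions_vanish n f m g" "contractions_vanish m g n f"
    and "\<And>p. p \<in> {1..min n m} \<Longrightarrow>
      AE t in Rplus_power (n + m - 2 * p + 1). star_contraction n m p f g t = 0"
proof -
  obtain B mul where alg: "L2_star_algebra A \<phi> \<iota> B mul" and XY: "I n f \<in> B" "I m g \<in> B"
    and free: "free_elements mul (\<iota> id_blinfun) (L2_state \<iota>) [I n f, I m g]"
    using free by (auto simp: L2_free_def)
  interpret alg: L2_star_algebra A \<phi> \<iota> B mul by fact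
  have sa: "L2_adj A \<iota> (I k h) = I k h" if "L2_kernel k h" "symmetric_everywhere k h" for k h
    using that by (simp add: I_adjoint) (intro I_cong L2_kernel_adjoint symmetric_everywhere_adjoint)
  note norm = norm_mul_if_free[OF assms(1) alg XY sa[OF f] sa[OF g] free]
  note zero = contractions_zero_if_norm_product[OF f(1) g(1) alg.mul_L2_prod[OF XY] norm(1)]
  show "contractions_vanish n f m g" by (rule zero(1))
  show "AE t in Rplus_power (n + m - 2 * p + 1). star_contraction n m p f g t = 0" if "p \<in> {1..min n m}" for p
    by (rule zero(2)[OF that])
  show "contractions_vanish m g n f"
    using norm(2) by (intro contractions_zero_if_norm_product(1)[OF g(1) f(1) alg.mul_L2_prod[OF XY(2,1)]])
      (simp add: mult.commute)
qed

theorem theorem5p1: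
  fixes A :: "('h::complex_hilbert \<Rightarrow>\<^sub>L 'h) set" and \<phi> :: "('h \<Rightarrow>\<^sub>L 'h) \<Rightarrow> complex"
    and \<iota> :: "('h \<Rightarrow>\<^sub>L 'h) \<Rightarrow> 'l::complex_hilbert"
    and S N :: "real \<Rightarrow> 'h \<Rightarrow>\<^sub>L 'h" and IS IN :: "nat \<Rightarrow> kernel \<Rightarrow> 'l"
  assumes "L2_completion A \<phi> \<iota>"
    and "wigner_integral A \<phi> \<iota> S IS"
    and "free_poisson_integral A \<phi> \<iota> N IN"
  shows "(\<forall>n m f g. 1 \<le> n \<and> 1 \<le> m \<and> symmetric_kernel n f \<and> symmetric_kernel m g \<and>
            L2_free A \<phi> \<iota> [IN n f, IN m g] \<longrightarrow> L2_free A \<phi> \<iota> [IS n f, IS m g])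
       \<and> (\<exists>n m f g. 1 \<le> n \<and> 1 \<le> m \<and> symmetric_kernel n f \<and> symmetric_kernel m g \<and>
            L2_free A \<phi> \<iota> [IS n f, IS m g] \<and>
            L2_moments_exist A \<phi> \<iota> [IN n f, IN m g] \<and> \<not> L2_free A \<phi> \<iota> [IN n f, IN m g])"
proof (intro conjI allI impI)
  interpret S: wigner_integral A \<phi> \<iota> S IS by fact
  interpret N: free_poisson_integral A \<phi> \<iota> N IN by fact
  obtain mul where mul: "L2_star_algebra A \<phi> \<iota> (span {IS n f | n f. L2_kernel n f}) mul"
    using S.wigner_algebra by blast
  interpret S: wigner_chaos_algebra A \<phi> \<iota> S IS mul
    by (intro wigner_chaos_algebra.intro wigner_chaos_algebra_axioms.intro assms(2) mul)
  {
    fix n m f g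
    assume *: "1 \<le> n \<and> 1 \<le> m \<and> symmetric_kernel n f \<and> symmetric_kernel m g \<and> L2_free A \<phi> \<iota> [IN n f, IN m g]"
    have fL: "L2_kernel n f" and gL: "L2_kernel m g" using * by (auto simp: symmetric_kernel_def)
    obtain f' where f': "symmetric_everywhere n f'" "L2_kernel n f'" "AE t in Rplus_power n. f t = f' t"
      using * symmetric_representative by blast
    obtain g' where g': "symmetric_everywhere m g'" "L2_kernel m g'" "AE t in Rplus_power m. g t = g' t"
      using * symmetric_representative by blast
    have "L2_free A \<phi> \<iota> [IN n f', IN m g']"
      using * N.I_cong_AE[OF fL f'(2,3)] N.I_cong_AE[OF gL g'(2,3)] by simp
    from N.free_imp_contractions_vanish(1,2)[OF assms(1) f'(2,1) g'(2,1) this]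
    have "L2_free A \<phi> \<iota> [IS n f', IS m g']"
      by (rule S.free_if_contractions_vanish[OF f'(2,1) g'(2,1)])
    then show "L2_free A \<phi> \<iota> [IS n f, IS m g]"
      using S.I_cong_AE[OF fL f'(2,3)] S.I_cong_AE[OF gL g'(2,3)] by simp
  }
  \<comment> \<open>The pair of order one kernels that separates the two notions of freeness.\<close>
  let ?f = "interval_kernel 0 2" and ?g = two_step_kernel
  have f: "L2_kernel 1 ?f" "symmetric_everywhere 1 ?f"
    using L2_interval_kernel[of 0 2] interval_kernel_real by (auto intro: symmetric_everywhere_order_1)
  have g: "L2_kernel 1 ?g" "symmetric_everywhere 1 ?g"
    using L2_two_step interval_kernel_real by (auto intro: symmetric_everywhere_order_1)
  have "(\<integral>t. ?g t \<partial>Rplus_power 1) = 0"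
    unfolding two_step_kernel_def using integral_interval_kernel[of 0 1] integral_interval_kernel[of 1 2]
    by (subst Bochner_Integration.integral_diff) auto
  then have fg: "contractions_vanish 1 ?f 1 ?g" and gf: "contractions_vanish 1 ?g 1 ?f"
    using L2_kernel_measurable[OF f(1)] L2_kernel_measurable[OF g(1)]
    by (auto intro!: contractions_vanish_order_1 simp: interval_times_two_step mult.commute[of "two_step_kernel _"])
  have free: "L2_free A \<phi> \<iota> [IS 1 ?f, IS 1 ?g]" by (rule S.free_if_contractions_vanish[OF f g fg gf])
  have moments: "L2_moments_exist A \<phi> \<iota> [IN 1 ?f, IN 1 ?g]"
  proof -
    interpret alg: L2_star_algebra A \<phi> \<iota> "\<iota> ` A" "\<lambda>x y. \<iota> (inv_into A \<iota> x o\<^sub>L inv_into A \<iota> y)"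
      by (rule bounded_L2_star_algebra[OF assms(1)])
    have "IN 1 ?g = IN 1 (interval_kernel 0 1) - IN 1 (interval_kernel 1 2)"
      unfolding two_step_kernel_def by (intro N.I_diff L2_interval_kernel) auto
    then have "IN 1 ?g \<in> \<iota> ` A"
      using alg.diff_closed N.interval_integral_bounded[OF assms(1)] by simp
    moreover have "IN 1 ?f \<in> \<iota> ` A" using N.interval_integral_bounded[OF assms(1)] by simp
    ultimately show ?thesis unfolding L2_moments_exist_def using alg.L2_star_algebra_axioms by auto
  qed
  have not_free: "\<not> L2_free A \<phi> \<iota> [IN 1 ?f, IN 1 ?g]"
  proof
    assume "L2_free A \<phi> \<iota> [IN 1 ?f, IN 1 ?g]"
    note star = N.free_imp_contractions_vanish(3)[OF assms(1) f g this]
    have eq: "1 + 1 - 2 * 1 + 1 = (1 :: nat)" by simp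
    have "AE t in Rplus_power (1 + 1 - 2 * 1 + 1). star_contraction 1 1 1 ?f ?g t = 0"
      by (rule star) simp
    then have "AE t in Rplus_power 1. star_contraction 1 1 1 ?f ?g t = 0" unfolding eq .
    then have "AE t in Rplus_power 1. ?g t = 0"
      using AE_space by eventually_elim (simp add: star_contraction_1 interval_times_two_step del: One_nat_def)
    with two_step_not_zero show False ..
  qed
  show "\<exists>n m f g. 1 \<le> n \<and> 1 \<le> m \<and> symmetric_kernel n f \<and> symmetric_kernel m g \<and>
      L2_free A \<phi> \<iota> [IS n f, IS m g] \<and>
      L2_moments_exist A \<phi> \<iota> [IN n f, IN m g] \<and> \<not> L2_free A \<phi> \<iota> [IN n f, IN m g]"
    using symmetric_kernelI[OF f] symmetric_kernelI[OF g] free moments not_free by blast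
qed

end
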